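(* Let $k\in\mathbb N$, $k\ge1$, let $K=\{A_j\}_{j=1}^{k+1}\subset\operatorname{diag}(2,\mathbb R)$ and $\{J_j\}_{j=3}^{k+1}\subset\operatorname{diag}(2,\mathbb R)$ be such that $$\operatorname{rank}(A_1-A_2)=1,\qquad \operatorname{rank}(A_j-A_{j'})=2\ \text{ for every }j\ne j',\ j,j'\ge2,$$ $$J_3=\lambda_3A_1+(1-\lambda_3)A_2,\qquad J_j=\lambda_jA_{j-1}+(1-\lambda_j)J_{j-1}\ \text{ for }j\ge4,$$ for some $0<\lambda_j<1$. Let $$F=\begin{cases}\lambda A_1+(1-\lambda)A_2& k=1,\\ \lambda A_{k+1}+(1-\lambda)J_{k+1}& k\ge2,\end{cases}$$ for some $0<\lambda<1$. Then for every $p\in[1,\infty)$, $b\in\mathbb R^2$ and $\epsilon\in(0,1)$ there exist $u_\epsilon\in W^{1,\infty}((0,1)^2;\mathbb R^2)$ and $\chi_\epsilon\in BV((0,1)^2;K)$ such that $u_\epsilon(x)=Fx+b$ for every $x\in\mathbb R^2\setminus(0,1)^2$ (that is, $u_\epsilon$ attains the boundary values $Fx+b$ and is extended by $Fx+b$ outside the square) and $$E_\epsilon(u_\epsilon,\chi_\epsilon)\le C\,\epsilon^{\frac p{k+p}},$$ with a constant $C>0$ independent of $\epsilon$, where $$E_\epsilon(u,\chi):=\int_{(0,1)^2}\operatorname{dist}^p(\nabla u,K)\,dx+\epsilon\|D^2u\|_{TV((0,1)^2)}.$$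
   Context: $\operatorname{diag}(2,\mathbb R)$ denotes the real diagonal $2\times2$ matrices. $\|D^2u\|_{TV((0,1)^2)}$ is the total variation on $(0,1)^2$ of the distributional second derivative of $u$. The value of the energy $E_\epsilon(u,\chi)$ does not depend on its second argument $\chi$. The constant $C$ is independent of $\epsilon$ but may depend on other fixed quantities, such as $p$, $k$ and the matrices involved.
   Formalization: The condition rank(A_j − J_j) = 1 for 3 ≤ j ≤ k+1 is added; without it the claim fails, e.g. for k = 2, p = 2, A_1 = 0, A_2 = diag(1,0), A_3 = diag(5,5). *)

theory Defs
  imports "HOL-Analysis.Analysis"
begin

definition unit_square :: "(real^2) set" where
  "unit_square = box 0 1"

definition diag2 :: "(real^2^2) set" where
  "diag2 = {M. \<forall>i j. i \<noteq> j \<longrightarrow> M $ i $ j = 0}"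


definition partial_deriv :: "2 \<Rightarrow> (real^2 \<Rightarrow> real) \<Rightarrow> real^2 \<Rightarrow> real" where
  "partial_deriv i \<phi> x = frechet_derivative \<phi> (at x) (axis i 1)"

primrec C_times :: "nat \<Rightarrow> (real^2 \<Rightarrow> real) \<Rightarrow> bool" where
  "C_times 0 \<phi> \<longleftrightarrow> continuous_on UNIV \<phi>"
| "C_times (Suc n) \<phi> \<longleftrightarrow>
     (\<forall>x. \<phi> differentiable (at x)) \<and> (\<forall>i. C_times n (partial_deriv i \<phi>))"

text \<open>\<open>C_c^\<infinity>(\<Omega>)\<close>, the functions being extended by zero to the whole plane.\<close>

definition test_functions :: "(real^2) set \<Rightarrow> (real^2 \<Rightarrow> real) set" where
  "test_functions \<Omega> =
     {\<phi>. (\<forall>n. C_times n \<phi>) \<and> compact (closure {x. \<phi> x \<noteq> 0}) \<and> closure {x. \<phi> x \<noteq> 0} \<subseteq> \<Omega>}"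


definition locally_integrable :: "(real^2) set \<Rightarrow> (real^2 \<Rightarrow> 'b::euclidean_space) \<Rightarrow> bool" where
  "locally_integrable \<Omega> f \<longleftrightarrow> (\<forall>C. compact C \<and> C \<subseteq> \<Omega> \<longrightarrow> f absolutely_integrable_on C)"

text \<open>Row \<open>i\<close>, column \<open>j\<close> of the gradient of \<open>u\<close> is the derivative of \<open>u $ i\<close> in direction \<open>j\<close>.\<close>

definition is_weak_gradient :: "(real^2) set \<Rightarrow> (real^2 \<Rightarrow> real^2) \<Rightarrow> (real^2 \<Rightarrow> real^2^2) \<Rightarrow> bool" where
  "is_weak_gradient \<Omega> u G \<longleftrightarrow>
     locally_integrable \<Omega> u \<and> locally_integrable \<Omega> G \<and>
     (\<forall>\<phi>\<in>test_functions \<Omega>. \<forall>i j.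
        (LINT x|lebesgue_on \<Omega>. u x $ i * partial_deriv j \<phi> x) =
        - (LINT x|lebesgue_on \<Omega>. G x $ i $ j * \<phi> x))"

text \<open>A representative of the weak gradient; it is determined up to null sets of \<open>\<Omega>\<close>
  whenever \<open>u\<close> is weakly differentiable, and unspecified otherwise.\<close>

definition weak_gradient :: "(real^2) set \<Rightarrow> (real^2 \<Rightarrow> real^2) \<Rightarrow> real^2 \<Rightarrow> real^2^2" where
  "weak_gradient \<Omega> u = (SOME G. is_weak_gradient \<Omega> u G)"

definition L_infinity :: "(real^2) set \<Rightarrow> (real^2 \<Rightarrow> 'b::euclidean_space) set" where
  "L_infinity \<Omega> =
     {f \<in> borel_measurable (lebesgue_on \<Omega>). \<exists>M. AE x in lebesgue_on \<Omega>. norm (f x) \<le> M}"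

definition W_1_infinity :: "(real^2) set \<Rightarrow> (real^2 \<Rightarrow> real^2) set" where
  "W_1_infinity \<Omega> = {u \<in> L_infinity \<Omega>. \<exists>G\<in>L_infinity \<Omega>. is_weak_gradient \<Omega> u G}"


text \<open>Total variations are suprema over tensor-valued test fields that are pointwise bounded
  by one in the Euclidean (Frobenius) norm, which is the norm of the type \<open>real^2^2^2\<close>.
  The zero field is admissible, so clipping negative values by \<open>ennreal\<close> does not change
  the supremum.\<close>

definition test_fields :: "(real^2) set \<Rightarrow> (real^2 \<Rightarrow> real^2^2^2) set" where
  "test_fields \<Omega> =
     {\<Phi>. (\<forall>i j k. (\<lambda>x. \<Phi> x $ i $ j $ k) \<in> test_functions \<Omega>) \<and> (\<forall>x. norm (\<Phi> x) \<le> 1)}"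

text \<open>Total variation of the distributional derivative \<open>D chi\<close> of an integrable
  matrix field \<open>chi\<close>.\<close>

definition TV_D :: "(real^2) set \<Rightarrow> (real^2 \<Rightarrow> real^2^2) \<Rightarrow> ennreal" where
  "TV_D \<Omega> chi = (SUP \<Phi>\<in>test_fields \<Omega>. ennreal
     (- (LINT x|lebesgue_on \<Omega>. (\<Sum>i\<in>UNIV. \<Sum>j\<in>UNIV. \<Sum>k\<in>UNIV.
          chi x $ i $ j * partial_deriv k (\<lambda>y. \<Phi> y $ i $ j $ k) x))))"

text \<open>Total variation of the distributional second derivative \<open>D^2 u\<close> of a locally
  integrable \<open>u\<close>; both derivatives are moved to the test field, and the value is infinite
  if \<open>D^2 u\<close> is not a finite measure.\<close>

definition TV_D2 :: "(real^2) set \<Rightarrow> (real^2 \<Rightarrow> real^2) \<Rightarrow> ennreal" where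
  "TV_D2 \<Omega> u = (SUP \<Phi>\<in>test_fields \<Omega>. ennreal
     (LINT x|lebesgue_on \<Omega>. (\<Sum>i\<in>UNIV. \<Sum>j\<in>UNIV. \<Sum>k\<in>UNIV.
          u x $ i * partial_deriv j (partial_deriv k (\<lambda>y. \<Phi> y $ i $ j $ k)) x)))"

definition BV_into :: "(real^2) set \<Rightarrow> (real^2^2) set \<Rightarrow> (real^2 \<Rightarrow> real^2^2) set" where
  "BV_into \<Omega> K =
     {chi. integrable (lebesgue_on \<Omega>) chi \<and> TV_D \<Omega> chi < \<infinity> \<and> (AE x in lebesgue_on \<Omega>. chi x \<in> K)}"


text \<open>The second argument \<open>chi\<close> is kept as in the usual notation; the value does not depend on it.
  Distances of matrices are taken in the Frobenius norm.\<close>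

definition energy ::
  "real \<Rightarrow> (real^2^2) set \<Rightarrow> real \<Rightarrow> (real^2 \<Rightarrow> real^2) \<Rightarrow> (real^2 \<Rightarrow> real^2^2) \<Rightarrow> ennreal" where
  "energy p K \<epsilon> u chi =
     (\<integral>\<^sup>+ x. ennreal (infdist (weak_gradient unit_square u x) K powr p) \<partial>lebesgue_on unit_square)
     + ennreal \<epsilon> * TV_D2 unit_square u"

text \<open>Since \<open>unit_square\<close> is open, prescribing \<open>u\<close> off \<open>unit_square\<close> constrains its boundary
  trace only for the continuous representative of \<open>u\<close>, hence the continuity requirement.\<close>

definition attains_affine_boundary :: "real^2^2 \<Rightarrow> real^2 \<Rightarrow> (real^2 \<Rightarrow> real^2) \<Rightarrow> bool" where
  "attains_affine_boundary F b u \<longleftrightarrow>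
     continuous_on (closure unit_square) u \<and> (\<forall>x. x \<notin> unit_square \<longrightarrow> u x = F *v x + b)"

end

theory Submission
  imports Defs
begin

text \<open>
  The map is built by branching inside branching. If \<open>F = \<lambda> A + (1 - \<lambda>) J\<close> with \<open>A - J\<close> a multiple
  of \<open>e\<^sub>1 \<otimes> e\<^sub>1\<close>, a sawtooth of period \<open>w\<close> in direction \<open>e\<^sub>1\<close> with gradients \<open>A\<close> and \<open>J\<close> is refined
  towards the top and the bottom of the square. One generation halves the period and shrinks the height
  by the factor \<open>\<theta> = 2 powr (- 1 - 1 / p)\<close>, so that both the shear energy and the surface energy of the
  generations form geometric series of ratio \<open>2 powr (- 1 / p)\<close>. The cells are arranged so that the
  phase \<open>J\<close> always occupies parallelograms. These are tiled by sheared copies of side about \<open>w\<close> of the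
  construction for \<open>J\<close>, used with the parameter \<open>\<epsilon> / w\<close>. If its energy is of order
  \<open>\<epsilon> powr (p / (m + p))\<close>, the choice \<open>w = \<epsilon> powr (1 / (m + 1 + p))\<close> gives the
  order \<open>\<epsilon> powr (p / (m + 1 + p))\<close> for \<open>F\<close>.

  All maps are affine on finitely many compact convex pieces, and their energy is controlled by the areas
  and diameters of the pieces. Weak gradient and total variation are computed by difference
  quotients: for a convex set \<open>S\<close> the indicator functions of \<open>S\<close> and \<open>t e + S\<close> differ on a set of measure
  at most \<open>4 t\<close> times the diameter of \<open>S\<close>.
\<close>

section \<open>Piecewise affine maps\<close>

text \<open>A piece \<open>(S, M, c)\<close> stands for the affine map \<open>x \<mapsto> M *v x + c\<close> on \<open>S\<close>. Pieces may overlap: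
  all estimates only need the pieces to cover the domain.\<close>

type_synonym pieces = "((real^2) set \<times> (real^2^2) \<times> (real^2)) list"

text \<open>The obstacle is the boundary data of the tiles. In the slanted strip of a branched cell
  the affine map to be replaced has gradient \<open>J\<close> plus a shear of size about w / h, not
  \<open>J\<close>. The lower order map u0 is therefore inserted as a correction: the sheared affine
  map g plus L (u0 - J) evaluated at the preimage under the affine map of the unit square onto the
  tile. The correction vanishes on the boundary, so tiles fit together without interpolation layers,
  and the shear \<sigma> changes each gradient by O(\<sigma>). This costs \<sigma>^p per unit area,
  the order of the shear energy (w / h)^p allotted to every cell.

  The period w balances the inner construction, (\<epsilon> / w) powr (p / (m + p)), against the
  shear, w powr p: equality means \<epsilon> = w powr (m + 1 + p).

  Two bounds accompany the energy through the induction. The total area of the pieces is what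
  multiplies the shear error, and a gradient bound independent of \<epsilon> limits the jumps of the
  gradient when diameters are turned into total variation.\<close>

abbreviation affine_pieces :: "real \<Rightarrow> (real^2 \<Rightarrow> real^2) \<Rightarrow> pieces \<Rightarrow> bool" where
  "affine_pieces R u ps \<equiv>
     \<forall>(S, M, c)\<in>set ps. compact S \<and> convex S \<and> norm M \<le> R \<and> (\<forall>x\<in>S. u x = M *v x + c)"

abbreviation piece_union :: "pieces \<Rightarrow> (real^2) set" where
  "piece_union ps \<equiv> (\<Union>(S, M, c)\<in>set ps. S)"

abbreviation piece_area :: "pieces \<Rightarrow> real" where
  "piece_area ps \<equiv> (\<Sum>(S, M, c)\<leftarrow>ps. measure lebesgue S)"

abbreviation piece_energy :: "(real^2^2) set \<Rightarrow> real \<Rightarrow> real \<Rightarrow> pieces \<Rightarrow> real" where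
  "piece_energy K p \<epsilon> ps \<equiv>
     (\<Sum>(S, M, c)\<leftarrow>ps. measure lebesgue S * infdist M K powr p + \<epsilon> * diameter S)"

text \<open>\<open>a\<close> bounds the area of the pieces counted with overlaps, because a shear
  error that is constant on each piece has to be summed over all of them. The term
  \<open>\<epsilon> * diameter S\<close> stands for the surface energy: the perimeter of a convex
  planar set is at most pi times its diameter.\<close>

definition pw_affine ::
  "(real^2^2) set \<Rightarrow> real \<Rightarrow> real \<Rightarrow> real \<Rightarrow> (real^2) set \<Rightarrow> (real^2 \<Rightarrow> real^2) \<Rightarrow> real \<Rightarrow> real \<Rightarrow> bool"
where
  "pw_affine K p R \<epsilon> D u a E \<longleftrightarrow>
     (\<exists>ps.
        (affine_pieces R u ps) \<and>
        D = piece_union ps \<and>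
        piece_area ps \<le> a \<and>
        piece_energy K p \<epsilon> ps \<le> E)"

lemma pw_affine_single:
  assumes "compact S" "convex S" "norm M \<le> R" "\<And>x. x \<in> S \<Longrightarrow> u x = M *v x + c"
    "measure lebesgue S \<le> a" "measure lebesgue S * infdist M K powr p + \<epsilon> * diameter S \<le> E"
  shows "pw_affine K p R \<epsilon> S u a E"
  unfolding pw_affine_def using assms by (intro exI[of _ "[(S, M, c)]"]) auto

lemma pw_affine_mono:
  assumes "pw_affine K p R \<epsilon> D u a E" "R \<le> R'" "a \<le> a'" "E \<le> E'" "\<And>x. x \<in> D \<Longrightarrow> u x = u' x"
  shows "pw_affine K p R' \<epsilon> D u' a' E'"
proof -
  obtain ps where ps: "affine_pieces R u ps"
    "D = piece_union ps" "piece_area ps \<le> a"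
    "piece_energy K p \<epsilon> ps \<le> E"
    using assms(1) unfolding pw_affine_def by blast
  show ?thesis unfolding pw_affine_def
  proof (intro exI[of _ ps] conjI ballI)
    fix z assume z: "z \<in> set ps"
    obtain S M c where [simp]: "z = (S, M, c)" by (cases z)
    have "compact S \<and> convex S \<and> norm M \<le> R \<and> (\<forall>x\<in>S. u x = M *v x + c)" using ps(1) z by auto
    moreover have "S \<subseteq> D" using ps(2) z by auto
    ultimately show "case z of (S, M, c) \<Rightarrow> compact S \<and> convex S \<and> norm M \<le> R' \<and> (\<forall>x\<in>S. u' x = M *v x + c)"
      using assms(2,5) by (auto simp: subset_iff)
  qed (use ps assms in auto)
qed

lemma pw_affine_union:
  assumes "pw_affine K p R \<epsilon> D1 u a1 E1" "pw_affine K p R \<epsilon> D2 u a2 E2"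
  shows "pw_affine K p R \<epsilon> (D1 \<union> D2) u (a1 + a2) (E1 + E2)"
proof -
  obtain ps where ps: "affine_pieces R u ps"
    "D1 = piece_union ps" "piece_area ps \<le> a1"
    "piece_energy K p \<epsilon> ps \<le> E1"
    using assms(1) unfolding pw_affine_def by blast
  obtain qs where qs: "affine_pieces R u qs"
    "D2 = piece_union qs" "piece_area qs \<le> a2"
    "piece_energy K p \<epsilon> qs \<le> E2"
    using assms(2) unfolding pw_affine_def by blast
  show ?thesis unfolding pw_affine_def
    by (rule exI[of _ "ps @ qs"]) (use ps qs in \<open>auto intro!: add_mono\<close>)
qed

lemma pw_affine_glue:
  assumes "pw_affine K p R \<epsilon> D1 u1 a1 E1" "pw_affine K p R \<epsilon> D2 u2 a2 E2"
    "\<And>x. x \<in> D1 \<Longrightarrow> u x = u1 x" "\<And>x. x \<in> D2 \<Longrightarrow> u x = u2 x"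
  shows "pw_affine K p R \<epsilon> (D1 \<union> D2) u (a1 + a2) (E1 + E2)"
  by (rule pw_affine_union; rule pw_affine_mono) (use assms in auto)

lemma diameter_linear_image_le:
  fixes S :: "'a::metric_space set" and T :: "'a \<Rightarrow> 'b::real_normed_vector"
  assumes "bounded S" "\<And>x y. x \<in> S \<Longrightarrow> y \<in> S \<Longrightarrow> dist (T x) (T y) \<le> \<nu> * dist x y" "0 \<le> \<nu>"
  shows "diameter (T ` S) \<le> \<nu> * diameter S"
proof (rule diameter_le)
  show "T ` S \<noteq> {} \<or> 0 \<le> \<nu> * diameter S" using assms by (simp add: diameter_ge_0)
  fix x y assume "x \<in> T ` S" "y \<in> T ` S"
  then obtain x' y' where *: "x' \<in> S" "y' \<in> S" "x = T x'" "y = T y'" by auto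
  have "dist (T x') (T y') \<le> \<nu> * dist x' y'" by (rule assms(2)[OF *(1,2)])
  also have "\<dots> \<le> \<nu> * diameter S" using diameter_bounded_bound[OF assms(1) *(1,2)] assms(3)
    by (simp add: mult_left_mono)
  finally show "norm (x - y) \<le> \<nu> * diameter S" using * by (simp add: dist_norm)
qed

lemma measure_affine_image:
  fixes N :: "real^2^2"
  assumes "compact S"
  shows "measure lebesgue ((\<lambda>x. c + N *v x) ` S) = \<bar>det N\<bar> * measure lebesgue S"
proof -
  have "(\<lambda>x. c + N *v x) ` S = (+) c ` ((*v) N ` S)" by (simp add: image_image)
  then have "measure lebesgue ((\<lambda>x. c + N *v x) ` S) = measure lebesgue ((*v) N ` S)"
    using measure_translation by metis
  also have "\<dots> = \<bar>det (matrix ((*v) N))\<bar> * measure lebesgue S"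
    by (rule measure_linear_image) (use assms lmeasurable_compact in auto)
  finally show ?thesis by simp
qed

text \<open>The common form of all changes of variables below: tiles, reflection, exchange of
  coordinates, addition of a constant. Areas grow at most by \<open>d\<close> and diameters at most
  by \<nu>, so the new surface term is dominated by the old one, taken with \<delta> and the factor
  \<open>d * c1\<close>, once \<open>\<epsilon> * \<nu> \<le> d * (c1 * \<delta>)\<close>. The
  constant \<open>c2\<close> is the part of the elastic error that does not shrink with the distance
  to the wells; it is multiplied by the area.\<close>

lemma pw_affine_map:
  fixes N :: "real^2^2"
  assumes pa: "pw_affine K p R \<delta> D u a E"
    and T: "\<And>y. T y = c0 + N *v y"
    and det: "\<bar>det N\<bar> \<le> d"
    and \<nu>: "\<And>y. norm (N *v y) \<le> \<nu> * norm y" "0 \<le> \<nu>"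
    and R': "\<And>M. norm M \<le> R \<Longrightarrow> norm (\<Psi> M) \<le> R'"
    and c1: "\<And>M. norm M \<le> R \<Longrightarrow> infdist (\<Psi> M) K' powr p \<le> c1 * infdist M K powr p + c2"
    and c: "0 \<le> c1" "0 \<le> c2" "0 \<le> \<epsilon>"
    and \<epsilon>: "\<epsilon> * \<nu> \<le> d * (c1 * \<delta>)"
    and u': "\<And>y M c. y \<in> D \<Longrightarrow> u y = M *v y + c \<Longrightarrow> u' (T y) = \<Psi> M *v T y + \<gamma> M c"
  shows "pw_affine K' p R' \<epsilon> (T ` D) u' (d * a) (d * (c1 * E + c2 * a))"
proof -
  have d0: "d \<ge> 0" using det by linarith
  obtain ps where ps: "affine_pieces R u ps"
    "D = piece_union ps" "piece_area ps \<le> a"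
    "piece_energy K p \<delta> ps \<le> E"
    using pa unfolding pw_affine_def by blast
  have TT: "T = (\<lambda>x. c0 + N *v x)" using T by auto
  define f where "f = (\<lambda>(S, M, c). (T ` S, \<Psi> M, \<gamma> M c))"
  have meas: "measure lebesgue (T ` S) \<le> d * measure lebesgue S" if "compact S" for S
    unfolding TT measure_affine_image[OF that] by (intro mult_right_mono det) auto
  have diam: "diameter (T ` S) \<le> \<nu> * diameter S" if "compact S" for S
  proof (rule diameter_linear_image_le)
    show "dist (T x) (T y) \<le> \<nu> * dist x y" for x y
      using \<nu>(1)[of "x - y"] by (simp add: TT dist_norm matrix_vector_mult_diff_distrib)
  qed (use that compact_imp_bounded \<nu> in auto)
  show ?thesis unfolding pw_affine_def
  proof (intro exI[of _ "map f ps"] conjI ballI)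
    fix z assume "z \<in> set (map f ps)"
    then obtain S M c where z: "z = (T ` S, \<Psi> M, \<gamma> M c)" "(S, M, c) \<in> set ps" by (auto simp: f_def)
    have *: "compact S" "convex S" "norm M \<le> R" "\<And>x. x\<in>S \<Longrightarrow> u x = M *v x + c" using ps(1) z by auto
    have SD: "S \<subseteq> D" using ps(2) z by auto
    have "compact (T ` S)" unfolding TT
      by (intro compact_continuous_image continuous_intros *)
    moreover have "convex (T ` S)"
    proof -
      have "T ` S = (+) c0 ` ((*v) N ` S)" by (simp add: TT image_image)
      then show ?thesis using * by (simp add: convex_linear_image)
    qed
    ultimately show "case z of (S, M, c) \<Rightarrow> compact S \<and> convex S \<and> norm M \<le> R' \<and> (\<forall>x\<in>S. u' x = M *v x + c)"
      using z R' * u' SD by auto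
  next
    show "T ` D = (\<Union>(S, M, c)\<in>set (map f ps). S)" unfolding ps(2) by (force simp: f_def)
  next
    have "piece_area (map f ps) \<le> (\<Sum>(S, M, c)\<leftarrow>ps. d * measure lebesgue S)"
      unfolding map_map by (rule sum_list_mono) (use meas ps(1) in \<open>auto simp: f_def\<close>)
    also have "\<dots> = d * piece_area ps"
      by (simp add: case_prod_unfold sum_list_const_mult)
    also have "\<dots> \<le> d * a" using ps(3) d0 by (simp add: mult_left_mono)
    finally show "piece_area (map f ps) \<le> d * a" .
  next
    have "piece_energy K' p \<epsilon> (map f ps)
      \<le> (\<Sum>(S, M, c)\<leftarrow>ps. d * c1 * (measure lebesgue S * infdist M K powr p + \<delta> * diameter S) + d * c2 * measure lebesgue S)"
      unfolding map_map
    proof (rule sum_list_mono)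
      fix z assume z: "z \<in> set ps"
      obtain S M c where [simp]: "z = (S, M, c)" by (cases z)
      have *: "compact S" "norm M \<le> R" using ps(1) z by auto
      have "measure lebesgue (T ` S) * infdist (\<Psi> M) K' powr p \<le> (d * measure lebesgue S) * (c1 * infdist M K powr p + c2)"
        by (intro mult_mono meas c1 *) (use d0 in auto)
      moreover have "\<epsilon> * diameter (T ` S) \<le> d * c1 * \<delta> * diameter S"
      proof -
        have "\<epsilon> * diameter (T ` S) \<le> \<epsilon> * (\<nu> * diameter S)" using diam[OF *(1)] c(3) by (rule mult_left_mono)
        also have "\<dots> = (\<epsilon> * \<nu>) * diameter S" by simp
        also have "\<dots> \<le> (d * (c1 * \<delta>)) * diameter S"
          by (intro mult_right_mono \<epsilon>) (simp add: diameter_ge_0 compact_imp_bounded *)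
        finally show ?thesis by (simp add: mult.assoc)
      qed
      ultimately show "((\<lambda>(S, M, c). measure lebesgue S * infdist M K' powr p + \<epsilon> * diameter S) \<circ> f) z \<le>
         (case z of (S, M, c) \<Rightarrow> d * c1 * (measure lebesgue S * infdist M K powr p + \<delta> * diameter S) + d * c2 * measure lebesgue S)"
        by (simp add: f_def algebra_simps)
    qed
    also have "\<dots> = d * c1 * piece_energy K p \<delta> ps +
       d * c2 * piece_area ps"
      by (simp add: case_prod_unfold sum_list_addf sum_list_const_mult)
    also have "\<dots> \<le> d * c1 * E + d * c2 * a"
      by (intro add_mono mult_left_mono ps) (use d0 c in auto)
    finally show "piece_energy K' p \<epsilon> (map f ps)
       \<le> d * (c1 * E + c2 * a)" by (simp add: algebra_simps)
  qed
qed

section \<open>Parallelograms and prescribed boundary values\<close>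

definition para :: "real^2 \<Rightarrow> real \<Rightarrow> real \<Rightarrow> real \<Rightarrow> (real^2) set" where
  "para c s h \<sigma> = {x. 0 \<le> x$2 - c$2 \<and> x$2 - c$2 \<le> h \<and>
     0 \<le> x$1 - c$1 - \<sigma> * (x$2 - c$2) \<and> x$1 - c$1 - \<sigma> * (x$2 - c$2) \<le> s}"

definition opara :: "real^2 \<Rightarrow> real \<Rightarrow> real \<Rightarrow> real \<Rightarrow> (real^2) set" where
  "opara c s h \<sigma> = {x. 0 < x$2 - c$2 \<and> x$2 - c$2 < h \<and>
     0 < x$1 - c$1 - \<sigma> * (x$2 - c$2) \<and> x$1 - c$1 - \<sigma> * (x$2 - c$2) < s}"

text \<open>\<open>W\<close> is the part of \<open>D\<close> where the values are left free. Two
  fillings with the same \<open>g\<close> agree on the overlap of their domains as soon as neither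
  free part meets the other domain; this replaces every continuity check at interfaces. With
  \<open>W = {}\<close> the map is \<open>g\<close> itself.\<close>

definition fillable where
  "fillable K p R \<epsilon> D W g a E \<longleftrightarrow> (\<exists>u. pw_affine K p R \<epsilon> D u a E \<and> (\<forall>x\<in>D - W. u x = g x))"

abbreviation fillable_square where
  "fillable_square K p R \<epsilon> F \<equiv> fillable K p R \<epsilon> (para 0 1 1 0) (opara 0 1 1 0) (\<lambda>x. F *v x)"

lemma fillable_glue:
  assumes "fillable K p R \<epsilon> D1 W1 g a1 E1" "fillable K p R \<epsilon> D2 W2 g a2 E2"
    "W1 \<inter> D2 = {}" "W2 \<inter> D1 = {}" "W1 \<subseteq> W" "W2 \<subseteq> W"
  shows "fillable K p R \<epsilon> (D1 \<union> D2) W g (a1 + a2) (E1 + E2)"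
proof -
  obtain u1 where u1: "pw_affine K p R \<epsilon> D1 u1 a1 E1" "\<forall>x\<in>D1 - W1. u1 x = g x"
    using assms(1) unfolding fillable_def by blast
  obtain u2 where u2: "pw_affine K p R \<epsilon> D2 u2 a2 E2" "\<forall>x\<in>D2 - W2. u2 x = g x"
    using assms(2) unfolding fillable_def by blast
  define u where "u x = (if x \<in> D1 then u1 x else u2 x)" for x
  have "pw_affine K p R \<epsilon> (D1 \<union> D2) u (a1 + a2) (E1 + E2)"
  proof (rule pw_affine_glue[OF u1(1) u2(1)])
    show "u x = u1 x" if "x \<in> D1" for x using that by (simp add: u_def)
    show "u x = u2 x" if "x \<in> D2" for x
    proof (cases "x \<in> D1")
      case True
      then have "x \<in> D1 - W1" "x \<in> D2 - W2" using that assms(3,4) by blast+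
      then show ?thesis using u1(2) u2(2) True by (simp add: u_def)
    qed (simp add: u_def)
  qed
  moreover have "\<forall>x\<in>(D1 \<union> D2) - W. u x = g x" using assms(5,6) u1(2) u2(2) by (auto simp: u_def)
  ultimately show ?thesis unfolding fillable_def by blast
qed

lemma fillable_mono:
  assumes "fillable K p R \<epsilon> D W g a E" "R \<le> R'" "a \<le> a'" "E \<le> E'" "\<And>x. x \<in> D - W' \<Longrightarrow> g x = g' x" "W \<subseteq> W'"
  shows "fillable K p R' \<epsilon> D W' g' a' E'"
proof -
  obtain u where u: "pw_affine K p R \<epsilon> D u a E" "\<forall>x\<in>D - W. u x = g x"
    using assms(1) unfolding fillable_def by blast
  then show ?thesis unfolding fillable_def using pw_affine_mono[OF u(1) assms(2-4)] assms(5,6)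
    by (metis DiffE DiffI subsetD)
qed

section \<open>Two by two matrices and pieces of boxes\<close>

definition mat2 :: "real \<Rightarrow> real \<Rightarrow> real \<Rightarrow> real \<Rightarrow> real^2^2" where
  "mat2 a b c d = vector [vector [a, b], vector [c, d]]"

lemma mat2_nth [simp]:
  "mat2 a b c d $ 1 $ 1 = a" "mat2 a b c d $ 1 $ 2 = b"
  "mat2 a b c d $ 2 $ 1 = c" "mat2 a b c d $ 2 $ 2 = d"
  by (simp_all add: mat2_def)

lemma matrix_vector_mult_2:
  fixes M :: "real^2^2"
  shows "(M *v x) $ 1 = M$1$1 * x$1 + M$1$2 * x$2" "(M *v x) $ 2 = M$2$1 * x$1 + M$2$2 * x$2"
  by (simp_all add: matrix_vector_mult_def sum_2)

lemma vec2_eq_iff: "(x::real^2) = y \<longleftrightarrow> x$1 = y$1 \<and> x$2 = y$2"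
  by (simp add: vec_eq_iff forall_2)

lemma mat2_eq_iff: "(M::real^2^2) = N \<longleftrightarrow> M$1$1 = N$1$1 \<and> M$1$2 = N$1$2 \<and> M$2$1 = N$2$1 \<and> M$2$2 = N$2$2"
  by (simp add: vec_eq_iff forall_2)

lemma norm_vec2_le: "norm (x::real^2) \<le> \<bar>x$1\<bar> + \<bar>x$2\<bar>"
  using norm_le_l1_cart[of x] by (simp add: sum_2)

lemma norm_mat2_le: "norm (M::real^2^2) \<le> \<bar>M$1$1\<bar> + \<bar>M$1$2\<bar> + \<bar>M$2$1\<bar> + \<bar>M$2$2\<bar>"
proof -
  have "norm M \<le> norm (M$1) + norm (M$2)"
    unfolding norm_vec_def[of M] using L2_set_le_sum[of UNIV "\<lambda>i. norm (M$i)"] by (simp add: sum_2)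
  then show ?thesis using norm_vec2_le[of "M$1"] norm_vec2_le[of "M$2"] by linarith
qed

lemma abs_mat_nth_le: "\<bar>(M::real^2^2) $ i $ j\<bar> \<le> norm M"
  using component_le_norm_cart[of "M$i" j] Finite_Cartesian_Product.norm_nth_le[of M i] by simp

lemma diag2_iff: "M \<in> diag2 \<longleftrightarrow> M$1$2 = 0 \<and> M$2$1 = 0"
  unfolding diag2_def by (auto simp: forall_2)

lemma abs_add_le: "\<bar>x\<bar> \<le> a \<Longrightarrow> \<bar>y\<bar> \<le> b \<Longrightarrow> \<bar>x + y\<bar> \<le> a + b" for x :: real
  by linarith

lemma abs_diff_le: "\<bar>x\<bar> \<le> a \<Longrightarrow> \<bar>y\<bar> \<le> b \<Longrightarrow> \<bar>x - y\<bar> \<le> a + b" for x :: real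
  by linarith

lemma para_closed: "closed (para c s h \<sigma>)"
proof -
  have "para c s h \<sigma> = {x. 0 \<le> x$2 - c$2} \<inter> {x. x$2 - c$2 \<le> h} \<inter>
     {x. 0 \<le> x$1 - c$1 - \<sigma> * (x$2 - c$2)} \<inter> {x. x$1 - c$1 - \<sigma> * (x$2 - c$2) \<le> s}"
    by (auto simp: para_def)
  then show ?thesis by (simp only:) (intro closed_Int closed_Collect_le continuous_intros)
qed

lemma para_eq_cbox: "para c w h 0 = cbox c (c + vector [w, h])"
  by (auto simp: para_def mem_box_cart forall_2)

lemma measure_para: "0 \<le> w \<Longrightarrow> 0 \<le> h \<Longrightarrow> measure lebesgue (para c w h 0) = w * h"
proof -
  assume *: "0 \<le> w" "0 \<le> h"
  then have "cbox c (c + vector [w, h]) \<noteq> {}" by (auto simp: interval_ne_empty_cart forall_2)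
  then have "measure lborel (cbox c (c + vector [w, h])) = w * h" using * by (subst content_cbox_cart) (auto simp: UNIV_2)
  then show ?thesis by (simp add: para_eq_cbox)
qed

lemma convex_halfplane2: "convex {x::real^2. a * x$1 + b * x$2 \<le> k}"
  using convex_halfspace_le[of "vector [a, b] :: real^2" k] by (simp add: inner_vec_def sum_2)

lemma closed_halfplane2: "closed {x::real^2. a * x$1 + b * x$2 \<le> k}"
  by (intro closed_Collect_le continuous_intros)

text \<open>Only the enclosing box enters: its area and \<open>w + h\<close> bound the area and the
  diameter of the piece, so triangles and trapezoids need no exact formulas.\<close>

lemma pw_affine_box_piece:
  assumes S: "S \<subseteq> para c w h 0" "closed S" "convex S"
    and u: "\<And>x. x \<in> S \<Longrightarrow> u x = M *v x + b" and M: "norm M \<le> R" "infdist M K \<le> e"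
    and *: "0 \<le> w" "0 \<le> h" "0 \<le> \<epsilon>" "0 \<le> p"
  shows "pw_affine K p R \<epsilon> S u (w * h) (w * h * e powr p + \<epsilon> * (w + h))"
proof (rule pw_affine_single[OF _ S(3) M(1) u])
  show cS: "compact S" using S(1,2) compact_cbox[of c "c + vector [w,h]"]
    by (metis closed_Int_compact inf.absorb1 para_eq_cbox)
  show m: "measure lebesgue S \<le> w * h"
    unfolding measure_para[OF *(1,2), of c, symmetric]
    by (rule measure_mono_fmeasurable) (use S(1) cS lmeasurable_compact[OF cS] in \<open>auto simp: para_eq_cbox fmeasurableD\<close>)
  have "diameter S \<le> w + h"
  proof (rule diameter_le)
    fix x y assume "x \<in> S" "y \<in> S"
    then have "x \<in> para c w h 0" "y \<in> para c w h 0" using S by auto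
    then have "\<bar>x$1 - y$1\<bar> \<le> w" "\<bar>x$2 - y$2\<bar> \<le> h" by (auto simp: para_def)
    then show "norm (x - y) \<le> w + h" using norm_vec2_le[of "x - y"] by simp
  qed (use * in auto)
  then show "measure lebesgue S * infdist M K powr p + \<epsilon> * diameter S \<le> w * h * e powr p + \<epsilon> * (w + h)"
    by (intro add_mono mult_mono m powr_mono2 M)
      (use * infdist_nonneg diameter_ge_0[OF compact_imp_bounded[OF cS]] in auto)
qed

lemma powr_add_le:
  assumes "0 \<le> x" "0 \<le> y" "0 \<le> (p::real)"
  shows "(x + y) powr p \<le> (2 * x) powr p + (2 * y) powr p"
proof (cases "x \<le> y")
  case True
  then have "(x + y) powr p \<le> (2 * y) powr p" using assms by (intro powr_mono2) auto
  then show ?thesis by (simp add: add_increasing)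
next
  case False
  then have "(x + y) powr p \<le> (2 * x) powr p" using assms by (intro powr_mono2) auto
  then show ?thesis by (simp add: add_increasing2)
qed

section \<open>Sheared copies of a filling\<close>

locale wells =
  fixes K :: "(real^2^2) set" and p :: real
  assumes K: "finite K" "K \<noteq> {}" "K \<subseteq> diag2" and p: "p \<ge> 1"
begin

lemma infdist_attained: obtains A where "A \<in> K" "infdist M K = dist M A"
  using infdist_attains_inf[of K M] K finite_imp_closed by metis

text \<open>Where \<open>u0\<close> has gradient \<open>M\<close>, the copy has the gradient of
  \<open>g\<close> plus \<open>L (M - J)\<close> times the inverse of \<open>N\<close>; this is
  \<Psi>. For \<sigma> = 0 it is the conjugate of \<open>M\<close> by \<open>L\<close>. The shear
  adds entries bounded by \<sigma> times a constant and by \<sigma> times the off-diagonal part of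
  \<open>M\<close>, which the distance to the diagonal wells controls. The bounds
  \<open>t \<le> s\<close>, \<open>s \<le> 5 * t\<close> and \<open>\<sigma> \<le> 4\<close> make
  all constants uniform over the tiles.\<close>

lemma fillable_tile:
  assumes unit: "fillable_square K p R0 \<delta> J a0 E0"
    and J: "J \<in> diag2" "norm J \<le> R0"
    and g: "\<And>x. x \<in> para c s t \<sigma> \<Longrightarrow> g x = mat2 (J$1$1) (\<alpha> * \<sigma>) 0 (J$2$2) *v x + k"
    and st: "0 < s" "0 < t" "t \<le> s" "s \<le> 5 * t" and \<sigma>: "0 \<le> \<sigma>" "\<sigma> \<le> 4"
    and \<epsilon>: "0 \<le> \<epsilon>" "6 * \<epsilon> \<le> t * c1 * \<delta>"
    and c1: "24 powr p \<le> c1" and R: "20 * R0 + 4 * \<bar>\<alpha>\<bar> \<le> R"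
  shows "fillable K p R \<epsilon> (para c s t \<sigma>) (opara c s t \<sigma>) g (s * t * a0)
     (s * t * (c1 * E0 + (2 * (\<bar>\<alpha>\<bar> + 2 * R0)) powr p * \<sigma> powr p * a0))"
proof -
  let ?m = "2 * (\<bar>\<alpha>\<bar> + 2 * R0)"
  obtain u0 where u0: "pw_affine K p R0 \<delta> (para 0 1 1 0) u0 a0 E0"
    "\<And>x. x \<in> para 0 1 1 0 \<Longrightarrow> x \<notin> opara 0 1 1 0 \<Longrightarrow> u0 x = J *v x" using unit unfolding fillable_def by blast
  define N where "N = mat2 s (\<sigma> * t) 0 t"
  \<comment> \<open>The values are scaled by \<open>L = diag s t\<close> as well, since conjugation by \<open>L\<close> fixes the diagonal
    wells and hence also works for tiles that are not squares.\<close>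
  define T where "T y = c + N *v y" for y
  define Ti :: "real^2 \<Rightarrow> real^2" where "Ti x = vector [(x$1 - c$1 - \<sigma> * (x$2 - c$2)) / s, (x$2 - c$2) / t]" for x
  have T1: "T y $ 1 = c$1 + s * y$1 + \<sigma> * t * y$2" and T2: "T y $ 2 = c$2 + t * y$2" for y
    by (simp_all add: T_def N_def matrix_vector_mult_2)
  have TiT: "Ti (T y) = y" for y using st by (simp add: Ti_def vec2_eq_iff T1 T2)
  have TTi: "T (Ti x) = x" for x using st by (simp add: Ti_def vec2_eq_iff T1 T2)
  have Ti_para: "Ti x \<in> para 0 1 1 0" if "x \<in> para c s t \<sigma>" for x
    using that st by (auto simp: Ti_def para_def field_simps)
  have T_para: "T y \<in> para c s t \<sigma>" if "y \<in> para 0 1 1 0" for y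
  proof -
    have "0 \<le> t * y$2" "t * y$2 \<le> t * 1" "0 \<le> s * y$1" "s * y$1 \<le> s * 1"
      using that st by (auto simp: para_def)
    then show ?thesis by (simp add: para_def T1 T2)
  qed
  have img: "T ` para 0 1 1 0 = para c s t \<sigma>"
    using T_para Ti_para TTi by (metis image_eqI image_subsetI subsetI subset_antisym)
  define L :: "real^2 \<Rightarrow> real^2" where "L z = vector [s * z$1, t * z$2]" for z
  define u where "u x = g x + L (u0 (Ti x) - J *v Ti x)" for x
  define \<Psi> where "\<Psi> M = mat2 (M$1$1) (\<alpha>*\<sigma> + (s/t) * M$1$2 - \<sigma> * (M$1$1 - J$1$1)) ((t/s) * M$2$1)
     (M$2$2 - \<sigma> * (t/s) * M$2$1)" for M :: "real^2^2"
  \<comment> \<open>With \<open>G\<close> the gradient of \<open>g\<close>,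
    \<open>L ((M - J) y)\<close> equals \<open>(\<Psi> M - G) (T y - c)\<close>; the offset absorbs
    the contribution of the corner \<open>c\<close>.\<close>
  define \<gamma> where "\<gamma> M k' = k + L k' - (\<Psi> M - mat2 (J$1$1) (\<alpha> * \<sigma>) 0 (J$2$2)) *v c" for M k'
  have r1: "0 \<le> s/t" "s/t \<le> 5" "0 \<le> t/s" "t/s \<le> 1" using st by (auto simp: field_simps)
  have st_le: "\<bar>(s/t) * z\<bar> \<le> 5 * \<bar>z\<bar>" "\<bar>(t/s) * z\<bar> \<le> \<bar>z\<bar>" "\<bar>\<sigma> * (t/s) * z\<bar> \<le> 4 * \<bar>z\<bar>" for z
  proof -
    show "\<bar>(s/t) * z\<bar> \<le> 5 * \<bar>z\<bar>" unfolding abs_mult using r1 by (intro mult_right_mono) auto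
    show *: "\<bar>(t/s) * z\<bar> \<le> \<bar>z\<bar>" using r1(3,4) mult_right_mono[OF r1(4), of "\<bar>z\<bar>"] by (simp only: abs_mult abs_of_nonneg) simp
    have "\<bar>\<sigma>\<bar> * \<bar>(t/s) * z\<bar> \<le> 4 * \<bar>z\<bar>" using \<sigma> * by (intro mult_mono) auto
    then show "\<bar>\<sigma> * (t/s) * z\<bar> \<le> 4 * \<bar>z\<bar>" by (simp add: abs_mult mult.assoc)
  qed
  have pa: "pw_affine K p R \<epsilon> (T ` para 0 1 1 0) u (s * t * a0)
     (s * t * (c1 * E0 + (?m powr p * \<sigma> powr p) * a0))"
  proof (rule pw_affine_map[OF u0(1), where \<nu> = "6 * s" and N = N and \<Psi> = \<Psi> and \<gamma> = \<gamma>])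
    show "T y = c + N *v y" for y by (simp add: T_def)
    show "\<bar>det N\<bar> \<le> s * t" using st by (simp add: det_2 N_def)
    show "norm (N *v y) \<le> 6 * s * norm y" for y
    proof -
      have y: "\<bar>y$1\<bar> \<le> norm y" "\<bar>y$2\<bar> \<le> norm y" by (simp_all add: component_le_norm_cart)
      have "norm (N *v y) \<le> \<bar>s * y$1 + \<sigma> * t * y$2\<bar> + \<bar>t * y$2\<bar>"
        using norm_vec2_le[of "N *v y"] by (simp add: N_def matrix_vector_mult_2)
      also have "\<dots> \<le> s * \<bar>y$1\<bar> + \<sigma> * t * \<bar>y$2\<bar> + t * \<bar>y$2\<bar>"
        using abs_triangle_ineq[of "s * y$1" "\<sigma> * t * y$2"] st \<sigma> by (simp add: abs_mult)
      also have "\<dots> \<le> s * norm y + 4 * s * norm y + s * norm y"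
        by (intro add_mono mult_mono y) (use st \<sigma> in auto)
      finally show ?thesis by simp
    qed
    show "norm (\<Psi> M) \<le> R" if M: "norm M \<le> R0" for M
    proof -
      have e: "\<bar>M$i$j\<bar> \<le> R0" "\<bar>J$i$j\<bar> \<le> R0" for i j
        using abs_mat_nth_le[of M i j] abs_mat_nth_le[of J i j] M J by auto
      have a: "\<bar>\<alpha> * \<sigma>\<bar> \<le> 4 * \<bar>\<alpha>\<bar>" unfolding abs_mult using \<sigma> mult_right_mono[of \<sigma> 4 "\<bar>\<alpha>\<bar>"] by (simp add: mult.commute)
      have b: "\<bar>\<sigma> * (M$1$1 - J$1$1)\<bar> \<le> 4 * (2 * R0)" unfolding abs_mult
        using \<sigma> e[of 1 1] by (intro mult_mono) auto
      have "norm (\<Psi> M) \<le> \<bar>M$1$1\<bar> + \<bar>\<alpha>*\<sigma> + (s/t) * M$1$2 - \<sigma> * (M$1$1 - J$1$1)\<bar> + \<bar>(t/s) * M$2$1\<bar>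
          + \<bar>M$2$2 - \<sigma> * (t/s) * M$2$1\<bar>" using norm_mat2_le[of "\<Psi> M"] unfolding \<Psi>_def by simp
      \<comment> \<open>The multiples of \<open>R0\<close> are 1 + 5 + 8 + 1 + 5 = 20, the
        coefficient in the hypothesis on \<open>R\<close>.\<close>
      also have "\<dots> \<le> R0 + (4 * \<bar>\<alpha>\<bar> + 5 * R0 + 4 * (2 * R0)) + R0 + (R0 + 4 * R0)"
        by (intro add_mono abs_add_le abs_diff_le a b e order.trans[OF st_le(1)] order.trans[OF st_le(2)]
            order.trans[OF st_le(3)] mult_left_mono) auto
      also have "\<dots> \<le> R" using R by simp
      finally show ?thesis .
    qed
    show "infdist (\<Psi> M) K powr p \<le> c1 * infdist M K powr p + ?m powr p * \<sigma> powr p"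
      if M: "norm M \<le> R0" for M
    proof -
      obtain A where A: "A \<in> K" "infdist M K = dist M A" by (rule infdist_attained)
      have A0: "A$1$2 = 0" "A$2$1 = 0" using A K(3) diag2_iff by auto
      define D where "D = dist M A"
      have e: "\<bar>M$i$j - A$i$j\<bar> \<le> D" for i j
        using abs_mat_nth_le[of "M - A" i j] by (simp add: D_def dist_norm)
      have e2: "\<bar>M$1$1\<bar> \<le> R0" "\<bar>J$1$1\<bar> \<le> R0" using abs_mat_nth_le[of M 1 1] abs_mat_nth_le[of J 1 1] M J by auto
      have b: "\<bar>\<sigma> * (\<alpha> - (M$1$1 - J$1$1))\<bar> \<le> \<sigma> * (\<bar>\<alpha>\<bar> + 2 * R0)" unfolding abs_mult
        using \<sigma> e2 by (intro mult_mono) auto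
      have D0: "D \<ge> 0" by (simp add: D_def)
      have "infdist (\<Psi> M) K \<le> norm (\<Psi> M - A)" using infdist_le[OF A(1)] by (simp add: dist_norm)
      also have "\<dots> \<le> \<bar>M$1$1 - A$1$1\<bar> + \<bar>\<sigma> * (\<alpha> - (M$1$1 - J$1$1)) + (s/t) * M$1$2\<bar> + \<bar>(t/s) * M$2$1\<bar>
          + \<bar>(M$2$2 - A$2$2) - \<sigma> * (t/s) * M$2$1\<bar>" using norm_mat2_le[of "\<Psi> M - A"]
          unfolding \<Psi>_def by (simp add: A0 algebra_simps)
      \<comment> \<open>The off-diagonal entries of \<open>A\<close> vanish, so those of
        \<open>M\<close> are at most \<open>D\<close>. The sum is 1 + 5 + 1 + 5 = 12 times
        \<open>D\<close>, and \<open>powr_add_le\<close> doubles 12 to the 24 in the bound on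
        \<open>c1\<close>.\<close>
      also have "\<dots> \<le> D + (\<sigma> * (\<bar>\<alpha>\<bar> + 2 * R0) + 5 * D) + D + (D + 4 * D)"
        by (intro add_mono abs_add_le abs_diff_le b e order.trans[OF st_le(1)] order.trans[OF st_le(2)]
            order.trans[OF st_le(3)] mult_left_mono) (use e[of 1 2] e[of 2 1] A0 in auto)
      finally have 1: "infdist (\<Psi> M) K \<le> 12 * D + \<sigma> * (\<bar>\<alpha>\<bar> + 2 * R0)" by simp
      have R0: "0 \<le> R0" using M norm_ge_zero order_trans by blast
      have "infdist (\<Psi> M) K powr p \<le> (12 * D + \<sigma> * (\<bar>\<alpha>\<bar> + 2 * R0)) powr p"
        by (rule powr_mono2) (use 1 p infdist_nonneg in auto)
      also have "\<dots> \<le> (2 * (12 * D)) powr p + (2 * (\<sigma> * (\<bar>\<alpha>\<bar> + 2 * R0))) powr p"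
        by (rule powr_add_le) (use D0 \<sigma> R0 p in auto)
      also have "(2 * (12 * D)) powr p = 24 powr p * D powr p" by (simp add: powr_mult D0)
      also have "2 * (\<sigma> * (\<bar>\<alpha>\<bar> + 2 * R0)) = ?m * \<sigma>" by simp
      also have "(?m * \<sigma>) powr p = ?m powr p * \<sigma> powr p"
        using R0 \<sigma> by (subst powr_mult) auto
      finally show ?thesis using mult_right_mono[OF c1, of "D powr p"] A(2) by (simp add: D_def)
    qed
    show "u (T y) = \<Psi> M *v T y + \<gamma> M k'" if y: "y \<in> para 0 1 1 0" "u0 y = M *v y + k'" for y M k'
    proof -
      have J0: "J$1$2 = 0" "J$2$1 = 0" using J diag2_iff by auto
      have "g (T y) = mat2 (J$1$1) (\<alpha> * \<sigma>) 0 (J$2$2) *v T y + k" by (rule g) (rule T_para[OF y(1)])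
      then have uTy: "u (T y) = mat2 (J$1$1) (\<alpha> * \<sigma>) 0 (J$2$2) *v T y + k + L (M *v y + k' - J *v y)"
        by (simp add: u_def TiT y(2))
      \<comment> \<open>Naming the ratios turns both identities into polynomial ones.\<close>
      define q where "q = s/t"
      define r where "r = t/s"
      have qr: "s = q * t" "t = r * s" using st by (simp_all add: q_def r_def)
      have id1: "j * (d1 + s * y1 + \<sigma> * t * y2) + \<alpha> * \<sigma> * (d2 + t * y2) + k1 + s * (m * y1 + n * y2 + l - j * y1)
        = m * (d1 + s * y1 + \<sigma> * t * y2) + (\<alpha> * \<sigma> + q * n - \<sigma> * (m - j)) * (d2 + t * y2)
          + (k1 + s * l - ((m - j) * d1 + (\<alpha> * \<sigma> + q * n - \<sigma> * (m - j) - \<alpha> * \<sigma>) * d2))"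
        for j d1 y1 y2 d2 k1 m n l :: real unfolding qr(1) by (simp add: algebra_simps)
      have id2: "j * (d2 + t * y2) + k2 + t * (m * y1 + n * y2 + l - j * y2)
        = r * m * (d1 + s * y1 + \<sigma> * t * y2) + (n - \<sigma> * r * m) * (d2 + t * y2)
          + (k2 + t * l - (r * m * d1 + (n - \<sigma> * r * m - j) * d2))"
        for j d1 y1 y2 d2 k2 m n l :: real
        using qr(2) by algebra
      show ?thesis unfolding vec2_eq_iff
      proof
        show "u (T y) $ 1 = (\<Psi> M *v T y + \<gamma> M k') $ 1"
          using id1[of "J$1$1" "c$1" "y$1" "y$2" "c$2" "k$1" "M$1$1" "M$1$2" "k'$1"] unfolding uTy
          by (simp add: matrix_vector_mult_2 T1 T2 J0 \<gamma>_def \<Psi>_def L_def q_def)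
        show "u (T y) $ 2 = (\<Psi> M *v T y + \<gamma> M k') $ 2"
          using id2[of "J$2$2" "c$2" "y$2" "k$2" "M$2$1" "y$1" "M$2$2" "k'$2" "c$1"] unfolding uTy
          by (simp add: matrix_vector_mult_2 T1 T2 J0 \<gamma>_def \<Psi>_def L_def r_def)
      qed
    qed
    show "\<epsilon> * (6 * s) \<le> s * t * (c1 * \<delta>)" using mult_left_mono[OF \<epsilon>(2), of s] st by (simp add: ac_simps)
    show "0 \<le> c1" using c1 powr_ge_zero[of 24 p] by linarith
  qed (use st \<epsilon> in auto)
  moreover have "\<forall>x\<in>para c s t \<sigma> - opara c s t \<sigma>. u x = g x"
  proof
    fix x assume x: "x \<in> para c s t \<sigma> - opara c s t \<sigma>"
    then have "Ti x \<in> para 0 1 1 0" using Ti_para by auto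
    moreover have "Ti x \<notin> opara 0 1 1 0" using x st by (auto simp: Ti_def opara_def field_simps)
    ultimately have "u0 (Ti x) = J *v Ti x" by (rule u0(2))
    then show "u x = g x" by (simp add: u_def L_def vec2_eq_iff)
  qed
  ultimately show ?thesis unfolding fillable_def img by auto
qed

end

section \<open>One branching cell\<close>

text \<open>The connection between \<open>A\<close> and \<open>J\<close> is \<alpha> times e1 (x)
  e1, and \<open>F\<close> is \<open>la * A + (1 - la) * J\<close>. The assumption
  \<open>unit\<close> is the induction hypothesis for \<open>J\<close>. It is used with parameter
  \<epsilon> / (B w) on cells of width w, and \<open>B\<close> leaves enough room for this parameter
  to stay below 1 down to the finest generation.\<close>

locale lamination_step = wells +
  fixes A J F :: "real^2^2" and la \<alpha> R0 C0 \<rho> B :: real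
  assumes A_K: "A \<in> K" and J: "J \<in> diag2" "norm J \<le> R0"
    and A: "A = mat2 (J$1$1 + \<alpha>) 0 0 (J$2$2)" and F: "F = mat2 (J$1$1 + la * \<alpha>) 0 0 (J$2$2)"
    and la: "0 < la" "la < 1" and C0: "0 \<le> C0" and \<rho>: "0 < \<rho>" "\<rho> \<le> 1" and B: "1 \<le> B"
    and unit: "\<And>\<delta>. 0 < \<delta> \<Longrightarrow> \<delta> < 1 \<Longrightarrow>
      fillable_square K p R0 \<delta> J C0 (C0 * \<delta> powr \<rho>)"
begin

definition R where "R = 20 * R0 + 4 * \<bar>\<alpha>\<bar>"
text \<open>The second term compensates the width \<open>(1 - la) * w / 2\<close> of a strip of
  phase \<open>J\<close> and the factor \<open>B\<close>: it is exactly what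
  \<open>30 * \<epsilon> \<le> x0 * c1 * \<delta>\<close> needs in
  \<open>fillable_cell\<close>.\<close>

definition c1 where "c1 = max (24 powr p) (60 * B / (1 - la))"
definition c2 where "c2 = (2 * (\<bar>\<alpha>\<bar> + 2 * R0)) powr p"

lemma R0: "0 \<le> R0" using J norm_ge_zero order_trans by blast

lemma c12: "0 \<le> c1" "0 \<le> c2"
  unfolding c1_def c2_def by (auto intro: order_trans[OF powr_ge_zero[of 24 p]] simp: max.coboundedI1)

section \<open>Tiling a parallelogram of phase J\<close>

definition tile_energy where "tile_energy \<delta> \<sigma> = c1 * (C0 * \<delta> powr \<rho>) + c2 * \<sigma> powr p * C0"

text \<open>Consecutive tiles meet only in a horizontal side, where both equal \<open>g\<close>. The
  corner of the next tile is displaced by \<sigma> times the height reached, which keeps the slanted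
  sides aligned.\<close>

lemma fillable_stack:
  assumes g: "\<And>x. x \<in> para c s (real n * t) \<sigma> \<Longrightarrow> g x = mat2 (J$1$1) (\<alpha> * \<sigma>) 0 (J$2$2) *v x + k"
    and n: "n \<ge> 1" and st: "0 < s" "0 < t" "t \<le> s" "s \<le> 5 * t" and \<sigma>: "0 \<le> \<sigma>" "\<sigma> \<le> 4"
    and \<epsilon>: "0 \<le> \<epsilon>" "6 * \<epsilon> \<le> t * c1 * \<delta>" and \<delta>: "0 < \<delta>" "\<delta> < 1"
  shows "fillable K p R \<epsilon> (para c s (n * t) \<sigma>) (opara c s (n * t) \<sigma>) g (n * (s * t * C0))
     (n * (s * t * tile_energy \<delta> \<sigma>))"
  using n g
proof (induction n rule: nat_induct_at_least)
  case base
  show ?case unfolding tile_energy_def c2_def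
    using fillable_tile[OF unit[OF \<delta>] J base[simplified] st \<sigma> \<epsilon>, where R = R] by (simp add: R_def c1_def)
next
  case (Suc n)
  define m where "m = real n * t"
  define c' where "c' = c + vector [\<sigma> * m, m]"
  have c': "c' $ 1 = c$1 + \<sigma> * m" "c' $ 2 = c$2 + m" by (auto simp: c'_def)
  have sub: "x$1 - c'$1 - \<sigma> * (x$2 - c'$2) = x$1 - c$1 - \<sigma> * (x$2 - c$2)" for x
    unfolding c' by (simp add: algebra_simps)
  have nt: "real (Suc n) * t = m + t" "0 \<le> m" using st by (auto simp: m_def algebra_simps)
  have D: "para c s (real (Suc n) * t) \<sigma> = para c s (m) \<sigma> \<union> para c' s t \<sigma>"
    unfolding para_def sub unfolding c' nt(1) using st nt(2) by auto
  have 1: "fillable K p R \<epsilon> (para c s m \<sigma>) (opara c s m \<sigma>) g (n * (s * t * C0))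
     (n * (s * t * tile_energy \<delta> \<sigma>))"
    unfolding m_def by (rule Suc.IH) (use Suc.prems D in \<open>auto simp: m_def\<close>)
  have 2: "fillable K p R \<epsilon> (para c' s t \<sigma>) (opara c' s t \<sigma>) g (s * t * C0)
     (s * t * tile_energy \<delta> \<sigma>)"
    unfolding tile_energy_def c2_def
    by (rule fillable_tile[OF unit[OF \<delta>] J _ st \<sigma> \<epsilon>]) (use Suc.prems D in \<open>auto simp: R_def c1_def\<close>)
  have "fillable K p R \<epsilon> (para c s (real (Suc n) * t) \<sigma>) (opara c s (real (Suc n) * t) \<sigma>) g
      (n * (s * t * C0) + s * t * C0)
      (n * (s * t * tile_energy \<delta> \<sigma>)
        + s * t * tile_energy \<delta> \<sigma>)"
    unfolding D
  proof (rule fillable_glue[OF 1 2])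
    show "opara c s (m) \<sigma> \<inter> para c' s t \<sigma> = {}" "opara c' s t \<sigma> \<inter> para c s (m) \<sigma> = {}"
      unfolding para_def opara_def sub unfolding c' by auto
    show "opara c s (m) \<sigma> \<subseteq> opara c s (real (Suc n) * t) \<sigma>"
      "opara c' s t \<sigma> \<subseteq> opara c s (real (Suc n) * t) \<sigma>"
      unfolding opara_def sub unfolding c' nt(1) using nt(2) st by auto
  qed
  then show ?case by (simp add: algebra_simps)
qed

text \<open>With n the ceiling of h / s, tiles of height t = h / n satisfy \<open>t \<le> s\<close>,
  and n s \<le> h + s \<le> 5 h = 5 n t gives \<open>s \<le> 5 * t\<close>. The loss of 5 turns the
  6 of a tile into 30.\<close>

lemma fillable_para:
  assumes g: "\<And>x. x \<in> para c s h \<sigma> \<Longrightarrow> g x = mat2 (J$1$1) (\<alpha> * \<sigma>) 0 (J$2$2) *v x + k"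
    and sh: "0 < s" "s \<le> 4 * h" and \<sigma>: "0 \<le> \<sigma>" "\<sigma> \<le> 4"
    and \<epsilon>: "0 \<le> \<epsilon>" "30 * \<epsilon> \<le> s * c1 * \<delta>" and \<delta>: "0 < \<delta>" "\<delta> < 1"
  shows "fillable K p R \<epsilon> (para c s h \<sigma>) (opara c s h \<sigma>) g (s * h * C0)
     (s * h * tile_energy \<delta> \<sigma>)"
proof -
  define n where "n = nat \<lceil>h / s\<rceil>"
  have h: "0 < h" using sh by linarith
  have n1: "n \<ge> 1" using divide_pos_pos[OF h sh(1)] unfolding n_def by linarith
  have n2: "h / s \<le> real n" unfolding n_def by linarith
  have n3: "real n \<le> h / s + 1" unfolding n_def using divide_pos_pos[OF h sh(1)] by linarith
  define t where "t = h / real n"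
  have n0: "0 < real n" using n1 by simp
  have nt: "real n * t = h" using n0 by (simp add: t_def)
  have t: "0 < t" "t \<le> s" using h n0 n2 sh(1) by (auto simp: t_def field_simps)
  have "real n * s \<le> h + s" using n3 sh(1) by (simp add: field_simps)
  then have "real n * s \<le> real n * (5 * t)" using sh(2) nt by linarith
  then have t5: "s \<le> 5 * t" using n0 by simp
  have "s * (c1 * \<delta>) \<le> 5 * t * (c1 * \<delta>)" using t5 c12 \<delta> by (intro mult_right_mono) auto
  then have "6 * \<epsilon> \<le> t * c1 * \<delta>" using \<epsilon> by (simp add: mult.assoc)
  from fillable_stack[of c s n t \<sigma> g k \<epsilon> \<delta>, unfolded nt, OF g n1 sh(1) t t5 \<sigma> \<epsilon>(1) this \<delta>]
  moreover have "real n * (s * t * z) = s * h * z" for z using nt by (metis mult.assoc mult.left_commute)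
  ultimately show ?thesis by simp
qed

text \<open>One tooth of the laminate: multiplied by \<alpha> and added to \<open>F\<close> in the
  first component, slope \<open>- la\<close> produces gradient \<open>J\<close> and slope
  \<open>1 - la\<close> produces \<open>A\<close>.\<close>

definition saw where "saw w z = max (- la * z) ((1 - la) * (z - w))"

text \<open>From left to right: a vertical strip of \<open>J\<close>, a wedge of \<open>A\<close>
  opening upwards from a point, a slanted strip of \<open>J\<close> of the same width, and a
  trapezoid of \<open>A\<close> narrowing upwards. The bottom carries one tooth of period w, the top
  two of period w / 2. Only the slanted strip depends on \<open>y\<close>, with slope \<sigma>, so
  both regions of \<open>A\<close> have gradient exactly \<open>A\<close> and the shear is confined
  to a parallelogram.\<close>

definition cell_profile where
  "cell_profile w h x y =
     (let x0 = (1 - la) * w / 2; \<sigma> = la * w / (2 * h) in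
      if x \<le> x0 then - la * x
      else if x \<le> x0 + \<sigma> * y then (1 - la) * x - x0
      else if x \<le> 2 * x0 + \<sigma> * y then - la * x + \<sigma> * y
      else (1 - la) * (x - w))"

definition Cc where "Cc = C0 + 2 + 2 * c1 * C0 + c2 * C0 + 18 * B"

text \<open>Per unit area: the inner construction with the rescaled parameter, plus the shear energy
  of the slanted strip.\<close>

definition cell_energy where
  "cell_energy \<epsilon> w h = w * h * ((\<epsilon> / (B * w)) powr \<rho> + (w / h) powr p)"

text \<open>The two strips of \<open>J\<close> are tiled and the two regions of \<open>A\<close>
  keep the profile, so the latter pay only for their interfaces. The bound
  \<open>w \<le> 8 * h\<close> provides what the tiles require, \<open>\<sigma> \<le> 4\<close> and
  \<open>x0 \<le> 4 * h\<close>.\<close>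

lemma fillable_cell:
  assumes wh: "0 < w" "w \<le> 8 * h" and \<epsilon>: "0 < \<epsilon>" "\<epsilon> < B * w"
  shows "fillable K p R \<epsilon> (para c w h 0) (opara c w h 0)
     (\<lambda>x. F *v x + vector [\<alpha> * cell_profile w h (x$1 - c$1) (x$2 - c$2), 0])
     (Cc * (w * h)) (Cc * cell_energy \<epsilon> w h)"
    (is "fillable _ _ _ _ _ _ ?g _ _")
proof -
  define \<delta> where "\<delta> = \<epsilon> / (B * w)"
  have h: "0 < h" using wh by linarith
  have Bw: "0 < B * w" using B wh by simp
  have \<delta>: "0 < \<delta>" "\<delta> < 1" using \<epsilon> Bw by (auto simp: \<delta>_def)
  define x0 where "x0 = (1 - la) * w / 2"
  define \<sigma> where "\<sigma> = la * w / (2 * h)"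
  have x0: "0 < x0" "2 * x0 = w - la * w" using la wh by (auto simp: x0_def field_simps)
  have x0w: "2 * x0 \<le> w" using x0(2) la wh by simp
  have \<sigma>h: "2 * (\<sigma> * h) = la * w" using h by (simp add: \<sigma>_def)
  have \<sigma>0: "0 \<le> \<sigma>" using la wh h by (simp add: \<sigma>_def)
  have \<sigma>wh: "\<sigma> \<le> w / h" using la wh h by (simp add: \<sigma>_def field_simps)
  have law: "la * w \<le> w" using la wh by simp
  have \<sigma>4: "\<sigma> \<le> 4" unfolding \<sigma>_def by (subst pos_divide_le_eq) (use law wh h in linarith)+
  have \<sigma>y: "0 \<le> \<sigma> * y \<and> 2 * (\<sigma> * y) \<le> la * w" if "0 \<le> y" "y \<le> h" for y
    using that \<sigma>0 mult_left_mono[OF that(2) \<sigma>0] \<sigma>h by auto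
  have prof: "cell_profile w h x y = (if x \<le> x0 then - la * x
      else if x \<le> x0 + \<sigma> * y then (1 - la) * x - x0
      else if x \<le> 2 * x0 + \<sigma> * y then - la * x + \<sigma> * y
      else (1 - la) * (x - w))" for x y
    by (simp add: cell_profile_def Let_def x0_def \<sigma>_def)
  have p1: "cell_profile w h x y = - la * x" if "x \<le> x0" for x y using that by (simp add: prof)
  have p2: "cell_profile w h x y = (1 - la) * x - x0" if "x0 \<le> x" "x \<le> x0 + \<sigma> * y" for x y
    using that by (auto simp: prof algebra_simps)
  have p3: "cell_profile w h x y = - la * x + \<sigma> * y" if "x0 + \<sigma> * y \<le> x" "x \<le> 2 * x0 + \<sigma> * y" "0 \<le> \<sigma> * y" for x y
    using that by (auto simp: prof algebra_simps)
  have p4: "cell_profile w h x y = (1 - la) * (x - w)" if "2 * x0 + \<sigma> * y \<le> x" "0 \<le> \<sigma> * y" for x y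
    using that x0 by (auto simp: prof algebra_simps)
  define c3 where "c3 = c + vector [x0, 0]"
  have c3: "c3$1 = c$1 + x0" "c3$2 = c$2" by (auto simp: c3_def)
  define P1 where "P1 = para c x0 h 0"
  define P3 where "P3 = para c3 x0 h \<sigma>"
  define P2 where "P2 = para c w h 0 \<inter> {x. (-1) * x$1 + 0 * x$2 \<le> - c$1 - x0} \<inter>
     {x. 1 * x$1 + (-\<sigma>) * x$2 \<le> c$1 + x0 - \<sigma> * c$2}"
  define P4 where "P4 = para c w h 0 \<inter> {x. (-1) * x$1 + \<sigma> * x$2 \<le> - c$1 - 2 * x0 + \<sigma> * c$2}"
  have P2_iff: "x \<in> P2 \<longleftrightarrow> x \<in> para c w h 0 \<and> x0 \<le> x$1 - c$1 \<and> x$1 - c$1 \<le> x0 + \<sigma> * (x$2 - c$2)" for x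
    by (auto simp: P2_def algebra_simps)
  have P4_iff: "x \<in> P4 \<longleftrightarrow> x \<in> para c w h 0 \<and> 2 * x0 + \<sigma> * (x$2 - c$2) \<le> x$1 - c$1" for x
    by (auto simp: P4_def algebra_simps)
  have cover: "para c w h 0 = P1 \<union> P3 \<union> P2 \<union> P4" (is "?D = ?U")
  proof (intro set_eqI iffI)
    fix x assume x: "x \<in> ?D"
    show "x \<in> ?U"
      using x \<sigma>y[of "x$2 - c$2"] unfolding Un_iff P2_iff P4_iff unfolding P1_def P3_def para_def c3
      by auto
  next
    fix x assume "x \<in> ?U"
    then show "x \<in> ?D"
      using \<sigma>y[of "x$2 - c$2"] x0 x0w unfolding Un_iff P2_iff P4_iff unfolding P1_def P3_def para_def c3
      by auto
  qed
  have c1_ge: "60 * B / (1 - la) \<le> c1" by (simp add: c1_def)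
  have "60 * B \<le> c1 * (1 - la)" using c1_ge la by (simp add: field_simps)
  then have "60 * B * (w * \<delta> / 2) \<le> c1 * (1 - la) * (w * \<delta> / 2)" using wh \<delta> by (intro mult_right_mono) auto
  moreover have "B * w * \<delta> = \<epsilon>" using B wh by (simp add: \<delta>_def)
  ultimately have \<epsilon>30: "30 * \<epsilon> \<le> x0 * c1 * \<delta>" by (simp add: x0_def algebra_simps)
  have x04h: "x0 \<le> 4 * h" using x0w wh by linarith
  have f1: "fillable K p R \<epsilon> P1 (opara c x0 h 0) ?g (x0 * h * C0)
     (x0 * h * tile_energy \<delta> 0)" unfolding P1_def
  proof (rule fillable_para[where k = "vector [la * \<alpha> * c$1, 0]"])
    fix x assume "x \<in> para c x0 h 0"
    then have *: "cell_profile w h (x$1 - c$1) (x$2 - c$2) = - la * (x$1 - c$1)" by (intro p1) (auto simp: para_def)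
    then show "?g x = mat2 (J$1$1) (\<alpha> * 0) 0 (J$2$2) *v x + vector [la * \<alpha> * c$1, 0]"
      unfolding * by (simp add: vec2_eq_iff matrix_vector_mult_2 F algebra_simps)
  qed (use x0 x04h \<epsilon> \<epsilon>30 \<delta> in auto)
  have f3: "fillable K p R \<epsilon> P3 (opara c3 x0 h \<sigma>) ?g (x0 * h * C0)
     (x0 * h * tile_energy \<delta> \<sigma>)" unfolding P3_def
  proof (rule fillable_para[where k = "vector [la * \<alpha> * c$1 - \<alpha> * \<sigma> * c$2, 0]"])
    fix x assume "x \<in> para c3 x0 h \<sigma>"
    then have *: "cell_profile w h (x$1 - c$1) (x$2 - c$2) = - la * (x$1 - c$1) + \<sigma> * (x$2 - c$2)"
      using \<sigma>y[of "x$2 - c$2"] by (intro p3) (auto simp: para_def c3)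
    then show "?g x = mat2 (J$1$1) (\<alpha> * \<sigma>) 0 (J$2$2) *v x + vector [la * \<alpha> * c$1 - \<alpha> * \<sigma> * c$2, 0]"
      unfolding * by (simp add: vec2_eq_iff matrix_vector_mult_2 F algebra_simps)
  qed (use x0 x04h \<epsilon> \<epsilon>30 \<delta> \<sigma>0 \<sigma>4 in auto)
  have nA: "norm A \<le> R"
  proof -
    have "norm A \<le> norm J + norm (A - J)" by norm
    also have "norm (A - J) \<le> \<bar>\<alpha>\<bar>" using norm_mat2_le[of "A - J"] J diag2_iff by (simp add: A)
    finally show ?thesis using J R0 by (simp add: R_def)
  qed
  have iA: "infdist A K \<le> 0" using infdist_zero[OF A_K] by simp
  have f24: "pw_affine K p R \<epsilon> S ?g (w * h) (\<epsilon> * (w + h))"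
    if S: "S \<subseteq> para c w h 0" "closed S" "convex S" "\<And>x. x \<in> S \<Longrightarrow> cell_profile w h (x$1 - c$1) (x$2 - c$2) = (1 - la) * x$1 + k" for S k
  proof -
    have "?g x = A *v x + vector [\<alpha> * k, 0]" if "x \<in> S" for x
      unfolding S(4)[OF that] by (simp add: vec2_eq_iff matrix_vector_mult_2 F A algebra_simps)
    from pw_affine_box_piece[OF S(1-3) this nA iA, of \<epsilon> p] show ?thesis using wh h \<epsilon> p by simp
  qed
  have cvx: "convex (para c w h 0)" by (simp add: para_eq_cbox)
  have f2: "fillable K p R \<epsilon> P2 {} ?g (w * h) (\<epsilon> * (w + h))"
    unfolding fillable_def
  proof (intro exI[of _ ?g] conjI f24[where k = "- (1 - la) * c$1 - x0"])
    show "closed P2" "convex P2" unfolding P2_def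
      by (intro closed_Int convex_Int para_closed closed_halfplane2 convex_halfplane2 cvx)+
    fix x assume "x \<in> P2"
    then show "cell_profile w h (x $ 1 - c $ 1) (x $ 2 - c $ 2) = (1 - la) * x $ 1 + (- (1 - la) * c$1 - x0)"
      by (subst p2) (auto simp: P2_iff algebra_simps)
  qed (auto simp: P2_def)
  have f4: "fillable K p R \<epsilon> P4 {} ?g (w * h) (\<epsilon> * (w + h))"
    unfolding fillable_def
  proof (intro exI[of _ ?g] conjI f24[where k = "- (1 - la) * (c$1 + w)"])
    show "closed P4" "convex P4" unfolding P4_def
      by (intro closed_Int convex_Int para_closed closed_halfplane2 convex_halfplane2 cvx)+
    fix x assume x: "x \<in> P4"
    then have "0 \<le> \<sigma> * (x$2 - c$2)" using \<sigma>y[of "x$2 - c$2"] by (auto simp: P4_iff para_def)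
    then show "cell_profile w h (x $ 1 - c $ 1) (x $ 2 - c $ 2) = (1 - la) * x $ 1 + (- (1 - la) * (c$1 + w))"
      using x by (subst p4) (auto simp: P4_iff algebra_simps)
  qed (auto simp: P4_def)
  \<comment> \<open>Only the interiors of the two \<open>J\<close> strips are free while the pieces
    are glued, so that \<open>P2\<close> and \<open>P4\<close> avoid the free set; it is enlarged to
    the open box in the last step.\<close>
  define W where "W = opara c x0 h 0 \<union> opara c3 x0 h \<sigma>"
  have all: "fillable K p R \<epsilon> (P1 \<union> P3 \<union> P2 \<union> P4) (opara c w h 0) ?g
    (x0 * h * C0 + x0 * h * C0 + w * h + w * h)
    (x0 * h * tile_energy \<delta> 0 + x0 * h * tile_energy \<delta> \<sigma>
      + \<epsilon> * (w + h) + \<epsilon> * (w + h))"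
  proof (rule fillable_glue[OF fillable_glue[OF fillable_glue[OF f1 f3, where W = W] f2, where W = W] f4])
    show "opara c x0 h 0 \<inter> P3 = {}" "opara c3 x0 h \<sigma> \<inter> P1 = {}"
      using \<sigma>y unfolding P1_def P3_def opara_def para_def c3 by fastforce+
    show "opara c x0 h 0 \<subseteq> W" "opara c3 x0 h \<sigma> \<subseteq> W" "W \<subseteq> W" "{} \<subseteq> W" "{} \<inter> (P1 \<union> P3) = {}"
       "{} \<inter> (P1 \<union> P3 \<union> P2) = {}" "{} \<subseteq> opara c w h 0" by (auto simp: W_def)
    show "W \<inter> P2 = {}" unfolding W_def disjoint_iff P2_iff opara_def para_def c3 by auto
    show "W \<inter> P4 = {}" 
    proof -
      have "x \<notin> P4" if "x \<in> W" for x
        using that \<sigma>y[of "x$2 - c$2"] x0 unfolding W_def P4_iff Un_iff opara_def para_def c3 by auto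
      then show ?thesis by auto
    qed
    show "W \<subseteq> opara c w h 0"
    proof
      fix x assume "x \<in> W"
      then show "x \<in> opara c w h 0"
        using \<sigma>y[of "x$2 - c$2"] x0 x0w mult_pos_pos[OF la(1) wh(1)] unfolding W_def Un_iff opara_def c3
        by auto
    qed
  qed
  have x0_le: "2 * (x0 * h) \<le> w * h" using mult_right_mono[OF x0w, of h] h by simp
  have hw: "0 \<le> w * h" using wh h by simp
  have "2 * (x0 * h) * C0 \<le> w * h * C0" using x0_le C0 by (rule mult_right_mono)
  then have a: "x0 * h * C0 + x0 * h * C0 + w * h + w * h \<le> (C0 + 2) * (w * h)" by (simp add: algebra_simps)
  also have "\<dots> \<le> Cc * (w * h)" unfolding Cc_def using C0 c12 B hw by (intro mult_right_mono) auto
  finally have area: "x0 * h * C0 + x0 * h * C0 + w * h + w * h \<le> Cc * (w * h)" .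
  \<comment> \<open>Since \<delta> < 1 and \<rho> \<le> 1, the interfaces of \<open>A\<close>,
    linear in \<delta>, cost no more than the inner construction.\<close>
  have dd: "\<delta> \<le> \<delta> powr \<rho>" using powr_mono'[of \<rho> 1 \<delta>] \<delta> \<rho> by simp
  have sp: "\<sigma> powr p \<le> (w / h) powr p" using \<sigma>0 \<sigma>wh p by (intro powr_mono2) auto
  have e1: "2 * (x0 * h) * (c1 * (C0 * \<delta> powr \<rho>)) \<le> w * h * (c1 * (C0 * \<delta> powr \<rho>))"
    using x0_le C0 c12 by (intro mult_right_mono) auto
  have e2: "x0 * h * (c2 * \<sigma> powr p * C0) \<le> w * h * (c2 * (w / h) powr p * C0)"
    using x0_le h x0 C0 c12 sp by (intro mult_mono) auto
  have e3: "\<epsilon> * (w + h) \<le> w * h * (9 * B * \<delta> powr \<rho>)"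
  proof -
    have "\<epsilon> * (w + h) \<le> (B * w * \<delta>) * (9 * h)" using Bw wh \<epsilon> by (intro mult_mono) (auto simp: \<delta>_def)
    also have "\<dots> = w * h * (9 * B) * \<delta>" by simp
    also have "\<dots> \<le> w * h * (9 * B) * \<delta> powr \<rho>" using dd hw B by (intro mult_left_mono) auto
    finally show ?thesis by (simp add: ac_simps)
  qed
  let ?X = "w * h * \<delta> powr \<rho>" and ?Y = "w * h * (w / h) powr p"
  have XY: "0 \<le> ?X" "0 \<le> ?Y" using hw by simp_all
  have "x0 * h * tile_energy \<delta> 0 + x0 * h * tile_energy \<delta> \<sigma>
      + \<epsilon> * (w + h) + \<epsilon> * (w + h)
     = 2 * (x0 * h) * (c1 * (C0 * \<delta> powr \<rho>)) + x0 * h * (c2 * \<sigma> powr p * C0) + 2 * (\<epsilon> * (w + h))"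
    by (simp add: tile_energy_def algebra_simps)
  also have "\<dots> \<le> w * h * (c1 * (C0 * \<delta> powr \<rho>)) + w * h * (c2 * (w / h) powr p * C0)
      + 2 * (w * h * (9 * B * \<delta> powr \<rho>))"
    using e1 e2 e3 by linarith
  also have "\<dots> = (c1 * C0 + 18 * B) * ?X + c2 * C0 * ?Y" by (simp add: algebra_simps)
  also have "\<dots> \<le> Cc * ?X + Cc * ?Y"
    by (intro add_mono mult_right_mono XY) (use C0 c12 B in \<open>auto simp: Cc_def\<close>)
  also have "\<dots> = Cc * cell_energy \<epsilon> w h" by (simp add: cell_energy_def \<delta>_def algebra_simps)
  finally show ?thesis unfolding cover
    by (intro fillable_mono[OF all _ area]) auto
qed

end

section \<open>Branching towers\<close>

lemma norm_mat2_eq: "norm (M::real^2^2) = sqrt ((M$1$1)\<^sup>2 + (M$1$2)\<^sup>2 + (M$2$1)\<^sup>2 + (M$2$2)\<^sup>2)"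
  by (simp add: norm_vec_def L2_set_def sum_2)

context lamination_step
begin

definition \<kappa> where "\<kappa> = 2 powr (1 / p)"
definition \<theta> where "\<theta> = 1 / (2 * \<kappa>)"
text \<open>Energy per unit width of a cell, up to constants, with the remaining height
  \<open>H\<close> of the tower in place of the cell height \<open>(1 - \<theta>) * H\<close>, which
  lies between H / 2 and H.\<close>

definition scale_energy where
  "scale_energy \<epsilon> w H = H * ((\<epsilon> / (B * w)) powr \<rho> + (w / H) powr p)"
text \<open>The sum of the geometric series with ratio \<open>1 / \<kappa>\<close>, which is summed
  by the recursion \<open>geo = 1 + geo / \<kappa>\<close> in the induction over
  generations.\<close>

definition geo where "geo = \<kappa> / (\<kappa> - 1)"
text \<open>The summands pay for the three pieces of the cutoff layer, for a cell whose height is at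
  least H / 2 (hence \<open>2 powr p\<close>), and for the area of the cutoff layer.\<close>

definition Ct where "Ct = 3 * ((2 * R) powr p + 5 * B) + 2 powr p * Cc + 3"

lemma \<kappa>: "1 < \<kappa>" "\<kappa> \<le> 2" "\<kappa> powr p = 2"
proof -
  have "2 powr 0 < \<kappa>" unfolding \<kappa>_def using p by (intro powr_less_mono) auto
  then show "1 < \<kappa>" by simp
  have "\<kappa> \<le> 2 powr 1" unfolding \<kappa>_def using p by (intro powr_mono) auto
  then show "\<kappa> \<le> 2" by simp
  show "\<kappa> powr p = 2" unfolding \<kappa>_def using p by (simp add: powr_powr)
qed

lemma \<theta>: "0 < \<theta>" "\<theta> \<le> 1/2"
  using \<kappa> by (auto simp: \<theta>_def field_simps)

lemma geo: "geo = 1 + geo / \<kappa>" "0 < geo"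
  using \<kappa> by (auto simp: geo_def field_simps)

lemma Cc_ge: "2 \<le> Cc" using C0 c12 B by (simp add: Cc_def)

lemma Ct_ge: "3 \<le> Ct" "Cc \<le> Ct" "2 powr p * Cc \<le> Ct" "3 * ((2 * R) powr p + 5 * B) \<le> Ct"
proof -
  have "1 * Cc \<le> 2 powr p * Cc" using Cc_ge p by (intro mult_right_mono ge_one_powr_ge_zero) auto
  then show "3 \<le> Ct" "Cc \<le> Ct" "2 powr p * Cc \<le> Ct" "3 * ((2 * R) powr p + 5 * B) \<le> Ct"
    using Cc_ge B powr_ge_zero[of "2*R" p] unfolding Ct_def distrib_left by linarith+
qed

lemma scale_energy_nonneg: "0 \<le> H \<Longrightarrow> 0 \<le> scale_energy \<epsilon> w H"
  by (simp add: scale_energy_def)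

text \<open>Halving w and multiplying H by \<theta> multiplies w / H by \<kappa>, hence its power by
  \<open>\<kappa> powr p = 2\<close>; the other term grows by \<open>2 powr \<rho> \<le> 2\<close>.
  The prefactor \<open>\<theta> = 1 / (2 * \<kappa>)\<close> leaves the ratio
  \<open>1 / \<kappa>\<close> for both.\<close>

lemma scale_energy_next:
  assumes "0 < w" "0 < H" "0 < \<epsilon>"
  shows "scale_energy \<epsilon> (w / 2) (\<theta> * H) \<le> scale_energy \<epsilon> w H / \<kappa>"
proof -
  have Bw: "0 < B * w" using B assms by simp
  have "\<epsilon> / (B * (w / 2)) = 2 * (\<epsilon> / (B * w))" by simp
  then have "(\<epsilon> / (B * (w / 2))) powr \<rho> = 2 powr \<rho> * (\<epsilon> / (B * w)) powr \<rho>" by (metis powr_mult)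
  also have "\<dots> \<le> 2 * (\<epsilon> / (B * w)) powr \<rho>"
    using powr_mono[of \<rho> 1 "2::real"] \<rho> by (intro mult_right_mono) auto
  finally have 1: "(\<epsilon> / (B * (w / 2))) powr \<rho> \<le> 2 * (\<epsilon> / (B * w)) powr \<rho>" .
  have "w / 2 / (\<theta> * H) = \<kappa> * (w / H)" using \<kappa> assms by (simp add: \<theta>_def)
  then have 2: "(w / 2 / (\<theta> * H)) powr p = 2 * (w / H) powr p" by (metis \<kappa>(3) powr_mult)
  have "scale_energy \<epsilon> (w / 2) (\<theta> * H) \<le> (\<theta> * H) * (2 * (\<epsilon> / (B * w)) powr \<rho> + 2 * (w / H) powr p)"
    unfolding scale_energy_def 2 using 1 \<theta> assms by (intro mult_left_mono) auto
  also have "\<dots> = scale_energy \<epsilon> w H / \<kappa>" using \<kappa> by (simp add: scale_energy_def \<theta>_def field_simps)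
  finally show ?thesis .
qed

lemma saw_boundary: "saw w 0 = 0" "saw w w = 0" if "0 \<le> w" for w
  using that la by (auto simp: saw_def max_def mult_le_0_iff not_le zero_less_mult_iff)

lemma saw_le: "0 \<le> z \<Longrightarrow> z \<le> w \<Longrightarrow> saw w z \<le> 0"
  using la by (auto simp: saw_def mult_le_0_iff)

text \<open>The minimum sits at the corner \<open>z = (1 - la) * w\<close>; its depth determines the
  slope \<open>m\<close> in \<open>cutoff\<close>.\<close>

lemma saw_ge: "- (la * (1 - la) * w) \<le> saw w z"
proof (cases "z \<le> (1 - la) * w")
  case True
  then have "la * z \<le> la * ((1 - la) * w)" using la by (intro mult_left_mono) auto
  then show ?thesis by (auto simp: saw_def algebra_simps)
next
  case False
  then have "(1 - la) * ((1 - la) * w) \<le> (1 - la) * z" using la by (intro mult_left_mono) auto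
  then show ?thesis by (auto simp: saw_def algebra_simps le_max_iff_disj)
qed

lemma saw_alt: "saw w z = (if z \<le> (1 - la) * w then - la * z else (1 - la) * (z - w))"
  by (auto simp: saw_def max_def algebra_simps)

lemma cell_profile_boundary:
  assumes wh: "0 < w" "0 < h"
  shows "cell_profile w h x 0 = saw w x"
    "x \<le> w / 2 \<Longrightarrow> cell_profile w h x h = saw (w / 2) x"
    "w / 2 \<le> x \<Longrightarrow> cell_profile w h x h = saw (w / 2) (x - w / 2)"
    "cell_profile w h 0 y = 0"
    "0 \<le> y \<Longrightarrow> y \<le> h \<Longrightarrow> cell_profile w h w y = 0"
proof -
  define x0 where "x0 = (1 - la) * w / 2"
  define \<sigma> where "\<sigma> = la * w / (2 * h)"
  have prof: "cell_profile w h x y = (if x \<le> x0 then - la * x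
      else if x \<le> x0 + \<sigma> * y then (1 - la) * x - x0
      else if x \<le> 2 * x0 + \<sigma> * y then - la * x + \<sigma> * y
      else (1 - la) * (x - w))" for x y
    by (simp add: cell_profile_def Let_def x0_def \<sigma>_def)
  have x0: "0 < x0" "2 * x0 = w - la * w" using la wh by (auto simp: x0_def field_simps)
  have law: "0 < la * w" using la wh by simp
  \<comment> \<open>At height h the wedge thus ends at \<open>x0 + la * w / 2 = w / 2\<close>, the
    common end of the two teeth on top.\<close>
  have \<sigma>h: "\<sigma> * h = la * w / 2" using wh by (simp add: \<sigma>_def)
  have saw: "saw w x = (if x \<le> 2 * x0 then - la * x else (1 - la) * (x - w))" for x
    unfolding saw_alt x0 by (simp add: algebra_simps)
  have saw2: "saw (w/2) x = (if x \<le> x0 then - la * x else (1 - la) * x - x0)" for x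
    unfolding saw_alt x0_def by (simp add: algebra_simps)
  show "cell_profile w h x 0 = saw w x" using x0(1) by (auto simp: prof saw)
  show "x \<le> w / 2 \<Longrightarrow> cell_profile w h x h = saw (w / 2) x"
    using x0 law unfolding prof saw2 \<sigma>h by auto
  show "w / 2 \<le> x \<Longrightarrow> cell_profile w h x h = saw (w / 2) (x - w / 2)"
    using x0 law unfolding prof saw2 \<sigma>h by (auto simp: field_simps)
  show "cell_profile w h 0 y = 0" using x0 by (simp add: prof)
  assume y: "0 \<le> y" "y \<le> h"
  have "\<sigma> * y \<le> la * w / 2" using mult_left_mono[OF y(2), of \<sigma>] la wh unfolding \<sigma>h by (simp add: \<sigma>_def)
  then show "cell_profile w h w y = 0" using x0 law unfolding prof by auto
qed

lemma norm_mats: "norm A \<le> R" "norm J \<le> R" "\<bar>x\<bar> \<le> \<bar>\<alpha>\<bar> \<Longrightarrow> norm (mat2 (F$1$1) x 0 (F$2$2)) \<le> R"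
proof -
  have e: "\<bar>J$i$j\<bar> \<le> R0" for i j using abs_mat_nth_le[of J i j] J by linarith
  have la\<alpha>: "\<bar>la * \<alpha>\<bar> \<le> \<bar>\<alpha>\<bar>" unfolding abs_mult using la by (simp add: mult_left_le_one_le)
  show "norm J \<le> R" using J R0 by (simp add: R_def)
  have "norm A \<le> \<bar>J$1$1 + \<alpha>\<bar> + \<bar>J$2$2\<bar>" using norm_mat2_le[of A] by (simp add: A)
  then show "norm A \<le> R" using e[of 1 1] e[of 2 2] abs_triangle_ineq[of "J$1$1" \<alpha>] R0
    unfolding R_def by linarith
  assume x: "\<bar>x\<bar> \<le> \<bar>\<alpha>\<bar>"
  have "norm (mat2 (F$1$1) x 0 (F$2$2)) \<le> \<bar>J$1$1 + la * \<alpha>\<bar> + \<bar>x\<bar> + \<bar>J$2$2\<bar>"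
    using norm_mat2_le[of "mat2 (F$1$1) x 0 (F$2$2)"] by (simp add: F)
  then show "norm (mat2 (F$1$1) x 0 (F$2$2)) \<le> R"
    using e[of 1 1] e[of 2 2] abs_triangle_ineq[of "J$1$1" "la * \<alpha>"] la\<alpha> R0 x unfolding R_def by linarith
qed

text \<open>The bottom keeps the sawtooth, to be glued to a cell or to a mirror image below; the top
  and the sides already have the final affine data. The two requirements agree at the lower corners
  because \<open>saw\<close> vanishes there.\<close>

definition tower_bc where
  "tower_bc c w H u \<longleftrightarrow> (\<forall>x\<in>para c w H 0.
     (x$2 = c$2 \<longrightarrow> u x = F *v x + vector [\<alpha> * saw w (x$1 - c$1), 0]) \<and>
     (x$1 = c$1 \<or> x$1 = c$1 + w \<or> x$2 = c$2 + H \<longrightarrow> u x = F *v x))"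

lemma vector_zero2: "vector [0, 0] = (0::real^2)" by (simp add: vec2_eq_iff)

text \<open>The sawtooth is cut off by its maximum with a plane \<open>f3\<close> that lies below it
  at the bottom, where \<open>f3\<close> equals its minimum, and vanishes at the top, where the
  sawtooth is nonpositive. A maximum of three affine functions has three convex pieces. The energy
  per unit area is merely bounded, which is affordable because the layer will be thin.\<close>

lemma cutoff:
  assumes w: "0 < w" "w \<le> 4 * H" and \<epsilon>: "0 < \<epsilon>" "\<epsilon> < B * w"
  shows "\<exists>u. pw_affine K p R \<epsilon> (para c w H 0) u (Ct * (w * H)) (Ct * (w * H)) \<and> tower_bc c w H u"
proof -
  have H: "0 < H" using w by linarith
  define m where "m = la * (1 - la) * w / H"
  have m: "m * H = la * (1 - la) * w" using H by (simp add: m_def)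
  define f1 where "f1 x = - la * (x$1 - c$1)" for x :: "real^2"
  define f2 where "f2 x = (1 - la) * (x$1 - c$1 - w)" for x :: "real^2"
  define f3 where "f3 x = m * (x$2 - c$2) - m * H" for x :: "real^2"
  define u where "u x = F *v x + vector [\<alpha> * max (max (f1 x) (f2 x)) (f3 x), 0]" for x
  have cvx: "convex (para c w H 0)" by (simp add: para_eq_cbox)
  have m0: "0 \<le> m" "m \<le> 1"
  proof -
    show "0 \<le> m" using la w H by (simp add: m_def)
    have "0 \<le> (1 - 2 * la)\<^sup>2" by simp
    then have "4 * (la * (1 - la)) \<le> 1" by (simp add: power2_eq_square algebra_simps)
    then have "w * (4 * (la * (1 - la))) \<le> w * 1" using w by (intro mult_left_mono) auto
    then have "la * (1 - la) * w \<le> H" using w(2) by (simp add: algebra_simps)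
    then show "m \<le> 1" using H by (simp add: m_def)
  qed
  have iR: "infdist M K \<le> 2 * R" if "norm M \<le> R" for M
    using infdist_le[OF A_K, of M] norm_triangle_ineq4[of M A] norm_mats(1) that by (simp add: dist_norm)
  let ?e = "w * H * ((2 * R) powr p + 5 * B)"
  have piece: "pw_affine K p R \<epsilon> S u (w * H) ?e"
    if S: "S \<subseteq> para c w H 0" "closed S" "convex S" "norm M \<le> R" "\<And>x. x \<in> S \<Longrightarrow> u x = M *v x + k" for S M k
  proof (rule pw_affine_mono[OF pw_affine_box_piece[OF S(1-3,5,4) iR[OF S(4)]]])
    have "\<epsilon> * (w + H) \<le> (B * w) * (5 * H)" using w \<epsilon> by (intro mult_mono) auto
    then show "w * H * (2 * R) powr p + \<epsilon> * (w + H) \<le> ?e"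
      by (simp add: algebra_simps)
  qed (use w H \<epsilon> p in auto)
  define P1 where "P1 = para c w H 0 \<inter> {x. 1 * x$1 + 0 * x$2 \<le> c$1 + (1 - la) * w} \<inter>
     {x. la * x$1 + m * x$2 \<le> la * c$1 + m * c$2 + m * H}"
  define P2 where "P2 = para c w H 0 \<inter> {x. (-1) * x$1 + 0 * x$2 \<le> - c$1 - (1 - la) * w} \<inter>
     {x. (la - 1) * x$1 + m * x$2 \<le> (la - 1) * (c$1 + w) + m * c$2 + m * H}"
  define P3 where "P3 = para c w H 0 \<inter> {x. (-la) * x$1 + (-m) * x$2 \<le> - la * c$1 - m * c$2 - m * H} \<inter>
     {x. (1 - la) * x$1 + (-m) * x$2 \<le> (1 - la) * (c$1 + w) - m * c$2 - m * H}"
  have i1: "x \<in> P1 \<longleftrightarrow> x \<in> para c w H 0 \<and> f2 x \<le> f1 x \<and> f3 x \<le> f1 x" for x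
    by (auto simp: P1_def f1_def f2_def f3_def algebra_simps)
  have i2: "x \<in> P2 \<longleftrightarrow> x \<in> para c w H 0 \<and> f1 x \<le> f2 x \<and> f3 x \<le> f2 x" for x
    by (auto simp: P2_def f1_def f2_def f3_def algebra_simps)
  have i3: "x \<in> P3 \<longleftrightarrow> x \<in> para c w H 0 \<and> f1 x \<le> f3 x \<and> f2 x \<le> f3 x" for x
    by (auto simp: P3_def f1_def f2_def f3_def algebra_simps)
  have p1: "pw_affine K p R \<epsilon> P1 u (w * H) ?e"
  proof (rule piece[where M = J and k = "vector [\<alpha> * la * c$1, 0]"])
    show "closed P1" "convex P1" unfolding P1_def
      by (intro closed_Int convex_Int para_closed closed_halfplane2 convex_halfplane2 cvx)+
    fix x assume "x \<in> P1"
    then have *: "max (max (f1 x) (f2 x)) (f3 x) = - la * (x$1 - c$1)" by (auto simp: i1 f1_def)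
    show "u x = J *v x + vector [\<alpha> * la * c$1, 0]" unfolding u_def *
      using J by (simp add: vec2_eq_iff matrix_vector_mult_2 F diag2_iff algebra_simps)
  qed (use norm_mats in \<open>auto simp: P1_def\<close>)
  have p2: "pw_affine K p R \<epsilon> P2 u (w * H) ?e"
  proof (rule piece[where M = A and k = "vector [- \<alpha> * (1 - la) * (c$1 + w), 0]"])
    show "closed P2" "convex P2" unfolding P2_def
      by (intro closed_Int convex_Int para_closed closed_halfplane2 convex_halfplane2 cvx)+
    fix x assume "x \<in> P2"
    then have *: "max (max (f1 x) (f2 x)) (f3 x) = (1 - la) * (x$1 - c$1 - w)" by (auto simp: i2 f2_def)
    show "u x = A *v x + vector [- \<alpha> * (1 - la) * (c$1 + w), 0]" unfolding u_def *
      by (simp add: vec2_eq_iff matrix_vector_mult_2 F A algebra_simps)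
  qed (use norm_mats in \<open>auto simp: P2_def\<close>)
  have p3: "pw_affine K p R \<epsilon> P3 u (w * H) ?e"
  proof (rule piece[where M = "mat2 (F$1$1) (\<alpha> * m) 0 (F$2$2)" and k = "vector [- \<alpha> * m * (c$2 + H), 0]"])
    show "closed P3" "convex P3" unfolding P3_def
      by (intro closed_Int convex_Int para_closed closed_halfplane2 convex_halfplane2 cvx)+
    show "norm (mat2 (F$1$1) (\<alpha> * m) 0 (F$2$2)) \<le> R"
      by (rule norm_mats) (use m0 in \<open>simp add: abs_mult mult_left_le\<close>)
    fix x assume "x \<in> P3"
    then have *: "max (max (f1 x) (f2 x)) (f3 x) = m * (x$2 - c$2) - m * H" by (auto simp: i3 f3_def)
    show "u x = mat2 (F$1$1) (\<alpha> * m) 0 (F$2$2) *v x + vector [- \<alpha> * m * (c$2 + H), 0]" unfolding u_def *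
      by (simp add: vec2_eq_iff matrix_vector_mult_2 F algebra_simps)
  qed (auto simp: P3_def)
  have cover: "para c w H 0 = P1 \<union> P2 \<union> P3" by (intro set_eqI) (unfold Un_iff i1 i2 i3, auto)
  have "pw_affine K p R \<epsilon> (para c w H 0) u (Ct * (w * H)) (Ct * (w * H))"
    unfolding cover
  proof (rule pw_affine_mono[OF pw_affine_union[OF pw_affine_union[OF p1 p2] p3]])
    show "w * H + w * H + w * H \<le> Ct * (w * H)"
      using mult_right_mono[OF Ct_ge(1), of "w * H"] w H by simp
    show "?e + ?e + ?e \<le> Ct * (w * H)"
      using mult_right_mono[OF Ct_ge(4), of "w * H"] w H by (simp add: algebra_simps)
  qed auto
  moreover have "tower_bc c w H u"
    unfolding tower_bc_def
  proof (intro ballI conjI impI)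
    fix x assume x: "x \<in> para c w H 0"
    have f12: "max (f1 x) (f2 x) = saw w (x$1 - c$1)" by (simp add: f1_def f2_def saw_def)
    have f3: "f3 x \<le> 0" using mult_left_mono[of "x$2 - c$2" H m] m0 x by (auto simp: f3_def para_def)
    have s0: "saw w (x$1 - c$1) \<le> 0" using x by (intro saw_le) (auto simp: para_def)
    { assume "x$2 = c$2"
      then have "f3 x \<le> saw w (x$1 - c$1)" using saw_ge[of w "x$1 - c$1"] by (simp add: f3_def m)
      then show "u x = F *v x + vector [\<alpha> * saw w (x$1 - c$1), 0]" by (simp add: u_def f12 max_absorb1) }
    assume "x$1 = c$1 \<or> x$1 = c$1 + w \<or> x$2 = c$2 + H"
    then have "max (saw w (x$1 - c$1)) (f3 x) = 0"
      using f3 s0 saw_boundary[of w] w by (auto simp: f3_def)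
    then show "u x = F *v x" by (simp add: u_def f12 vector_zero2)
  qed
  ultimately show ?thesis by blast
qed

text \<open>One cell of height \<open>(1 - \<theta>) * H\<close> carries two towers of width w / 2
  and height \<open>\<theta> * H\<close>. Both conditions pass to the smaller towers:
  \<open>w * \<kappa> ^ n \<le> 4 * H\<close> because \<open>\<theta> = 1 / (2 * \<kappa>)\<close>,
  and \<open>\<epsilon> * 2 ^ n < B * w\<close> because the width is halved. They keep the cells
  tall enough and the parameter of the inner construction below 1. The cutoff layer has total width
  w and height \<open>\<theta> ^ n * H\<close>, which is the last term of the energy.\<close>

lemma tower:
  assumes "0 < w" "w * \<kappa> ^ n \<le> 4 * H" "0 < \<epsilon>" "\<epsilon> * 2 ^ n < B * w"
  shows "\<exists>u. pw_affine K p R \<epsilon> (para c w H 0) u (Ct * (w * H))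
           (Ct * (w * (geo * scale_energy \<epsilon> w H + \<theta> ^ n * H))) \<and> tower_bc c w H u"
  using assms
proof (induction n arbitrary: c w H)
  case 0
  then have "0 < H" by simp
  obtain u where u: "pw_affine K p R \<epsilon> (para c w H 0) u (Ct * (w * H)) (Ct * (w * H))" "tower_bc c w H u"
    using cutoff[of w H \<epsilon> c] 0 by auto
  have "Ct * (w * H) \<le> Ct * (w * (geo * scale_energy \<epsilon> w H + \<theta> ^ 0 * H))"
    using scale_energy_nonneg[of H \<epsilon> w] geo(2) \<open>0 < H\<close> Ct_ge(1) 0 by (intro mult_left_mono) auto
  from pw_affine_mono[OF u(1) order_refl order_refl this] u(2) show ?case by auto
next
  case (Suc n)
  have kn: "1 \<le> \<kappa> ^ n" "1 \<le> \<kappa> ^ Suc n" using \<kappa> by (auto intro: one_le_power simp del: power_Suc)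
  have wH: "w \<le> 4 * H" using mult_left_mono[OF kn(2), of w] Suc.prems by linarith
  have H: "0 < H" using wH Suc.prems by linarith
  define h where "h = (1 - \<theta>) * H"
  have h: "H / 2 \<le> h" "h = H - \<theta> * H" using mult_right_mono[OF \<theta>(2), of H] H unfolding h_def left_diff_distrib by linarith+
  have h0: "0 < h" using h H by linarith
  have \<theta>H: "0 < \<theta> * H" using \<theta> H by simp
  have two: "(1::real) \<le> 2 ^ Suc n" by (intro one_le_power) simp
  have \<epsilon>w: "\<epsilon> < B * w" using mult_left_mono[OF two, of \<epsilon>] Suc.prems by linarith
  have "fillable K p R \<epsilon> (para c w h 0) (opara c w h 0)
     (\<lambda>x. F *v x + vector [\<alpha> * cell_profile w h (x$1 - c$1) (x$2 - c$2), 0])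
     (Cc * (w * h)) (Cc * cell_energy \<epsilon> w h)"
    by (rule fillable_cell[OF Suc.prems(1) _ Suc.prems(3) \<epsilon>w]) (use wH h(1) in linarith)
  then obtain u1 where u1: "pw_affine K p R \<epsilon> (para c w h 0) u1 (Cc * (w * h)) (Cc * cell_energy \<epsilon> w h)"
    "\<And>x. x \<in> para c w h 0 \<Longrightarrow> x \<notin> opara c w h 0 \<Longrightarrow> u1 x = F *v x + vector [\<alpha> * cell_profile w h (x$1 - c$1) (x$2 - c$2), 0]"
    unfolding fillable_def by blast
  have sub: "w / 2 * \<kappa> ^ n \<le> 4 * (\<theta> * H)" "\<epsilon> * 2 ^ n < B * (w / 2)"
    using Suc.prems \<kappa> by (auto simp: \<theta>_def field_simps)
  define cL where "cL = c + vector [0, h]"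
  define cR where "cR = c + vector [w / 2, h]"
  have cLR: "cL$1 = c$1" "cL$2 = c$2 + h" "cR$1 = c$1 + w/2" "cR$2 = c$2 + h" by (auto simp: cL_def cR_def)
  let ?E = "Ct * (w / 2 * (geo * scale_energy \<epsilon> (w / 2) (\<theta> * H) + \<theta> ^ n * (\<theta> * H)))"
  obtain u2 where u2: "pw_affine K p R \<epsilon> (para cL (w / 2) (\<theta> * H) 0) u2 (Ct * (w / 2 * (\<theta> * H))) ?E"
    "tower_bc cL (w / 2) (\<theta> * H) u2"
    using Suc.IH[OF _ sub(1) Suc.prems(3) sub(2), of cL] Suc.prems(1) by auto
  obtain u3 where u3: "pw_affine K p R \<epsilon> (para cR (w / 2) (\<theta> * H) 0) u3 (Ct * (w / 2 * (\<theta> * H))) ?E"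
    "tower_bc cR (w / 2) (\<theta> * H) u3"
    using Suc.IH[OF _ sub(1) Suc.prems(3) sub(2), of cR] Suc.prems(1) by auto
  let ?D1 = "para c w h 0" and ?D2 = "para cL (w / 2) (\<theta> * H) 0" and ?D3 = "para cR (w / 2) (\<theta> * H) 0"
  define u where "u x = (if x \<in> ?D1 then u1 x else if x \<in> ?D2 then u2 x else u3 x)" for x
  have b1: "u1 x = F *v x + vector [\<alpha> * cell_profile w h (x$1 - c$1) (x$2 - c$2), 0]"
    if "x \<in> ?D1" "x$1 = c$1 \<or> x$1 = c$1 + w \<or> x$2 = c$2 \<or> x$2 = c$2 + h" for x
    using that by (intro u1(2)) (auto simp: opara_def)
  note cpb = cell_profile_boundary[OF Suc.prems(1) h0]
  have b2: "u2 x = F *v x + vector [\<alpha> * saw (w/2) (x$1 - c$1), 0]" if "x \<in> ?D2" "x$2 = c$2 + h" for x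
    using u2(2) that unfolding tower_bc_def cLR by blast
  have b2': "u2 x = F *v x" if "x \<in> ?D2" "x$1 = c$1 \<or> x$1 = c$1 + w/2 \<or> x$2 = c$2 + H" for x
    using u2(2) that h(2) unfolding tower_bc_def cLR by (metis add.assoc diff_add_cancel)
  have b3: "u3 x = F *v x + vector [\<alpha> * saw (w/2) (x$1 - c$1 - w/2), 0]" if "x \<in> ?D3" "x$2 = c$2 + h" for x
    using u3(2) that unfolding tower_bc_def cLR by (metis diff_diff_eq)
  have b3': "u3 x = F *v x" if "x \<in> ?D3" "x$1 = c$1 + w/2 \<or> x$1 = c$1 + w \<or> x$2 = c$2 + H" for x
  proof -
    have "x$1 = cR$1 \<or> x$1 = cR$1 + w/2 \<or> x$2 = cR$2 + \<theta> * H" using that(2) h(2) unfolding cLR by auto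
    then show ?thesis using u3(2) that(1) unfolding tower_bc_def by blast
  qed
  have uD1: "u x = u1 x" if "x \<in> ?D1" for x using that by (simp add: u_def)
  have uD2: "u x = u2 x" if "x \<in> ?D2" for x
  proof (cases "x \<in> ?D1")
    case True
    then have x: "x$2 = c$2 + h" "x$1 - c$1 \<le> w/2" using that by (auto simp: para_def cLR)
    then show ?thesis using b1[OF True] b2[OF that] cpb(2)[OF x(2)] True by (simp add: u_def)
  qed (use that in \<open>simp add: u_def\<close>)
  have uD3: "u x = u3 x" if "x \<in> ?D3" for x
  proof (cases "x \<in> ?D1")
    case True
    then have x: "x$2 = c$2 + h" "w/2 \<le> x$1 - c$1" using that by (auto simp: para_def cLR)
    then show ?thesis using b1[OF True] b3[OF that] cpb(3)[OF x(2)] True by (simp add: u_def)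
  next
    case F: False
    show ?thesis
    proof (cases "x \<in> ?D2")
      case True
      then have x: "x$1 = c$1 + w/2" using that by (auto simp: para_def cLR)
      then show ?thesis using b2'[OF True] b3'[OF that] True F by (simp add: u_def)
    qed (use F in \<open>simp add: u_def\<close>)
  qed
  have cover: "para c w H 0 = ?D1 \<union> ?D2 \<union> ?D3"
    using h(2) h0 \<theta>H Suc.prems(1) unfolding para_def cLR by auto
  have pa: "pw_affine K p R \<epsilon> (para c w H 0) u
     (Cc * (w * h) + Ct * (w / 2 * (\<theta> * H)) + Ct * (w / 2 * (\<theta> * H)))
     (Cc * cell_energy \<epsilon> w h + ?E + ?E)"
    unfolding cover
    by (rule pw_affine_union[OF pw_affine_union]; rule pw_affine_mono[OF u1(1)] pw_affine_mono[OF u2(1)] pw_affine_mono[OF u3(1)])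
       (auto simp: uD1 uD2 uD3)
  have "Cc * (w * h) \<le> Ct * (w * h)" using Ct_ge(2) Suc.prems h0 by (intro mult_right_mono) auto
  then have area: "Cc * (w * h) + Ct * (w / 2 * (\<theta> * H)) + Ct * (w / 2 * (\<theta> * H)) \<le> Ct * (w * H)"
    by (simp add: h(2) algebra_simps)
  \<comment> \<open>The cell has at least half the height of the tower; the resulting
    \<open>2 powr p\<close> is contained in \<open>Ct\<close>.\<close>
  have "w / h \<le> w / (H / 2)" using h(1) h0 H Suc.prems(1) by (intro divide_left_mono) auto
  then have "(w / h) powr p \<le> (2 * (w / H)) powr p"
    using h0 Suc.prems(1) p by (intro powr_mono2) (auto simp: ac_simps)
  also have "\<dots> = 2 powr p * (w / H) powr p" by (rule powr_mult)
  finally have wh: "(w / h) powr p \<le> 2 powr p * (w / H) powr p" .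
  have tp: "1 \<le> 2 powr p" using p by (intro ge_one_powr_ge_zero) auto
  have "h * ((\<epsilon> / (B * w)) powr \<rho> + (w / h) powr p) \<le> H * (2 powr p * (\<epsilon> / (B * w)) powr \<rho> + 2 powr p * (w / H) powr p)"
    using h \<theta>H h0 mult_right_mono[OF tp, of "(\<epsilon> / (B * w)) powr \<rho>"] wh
    by (intro mult_mono add_mono) auto
  also have "\<dots> = 2 powr p * scale_energy \<epsilon> w H" by (simp add: scale_energy_def algebra_simps)
  finally have "Cc * (w * (h * ((\<epsilon> / (B * w)) powr \<rho> + (w / h) powr p))) \<le> Cc * (w * (2 powr p * scale_energy \<epsilon> w H))"
    using Cc_ge Suc.prems by (intro mult_left_mono) auto
  also have "\<dots> = (2 powr p * Cc) * (w * scale_energy \<epsilon> w H)" by simp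
  also have "\<dots> \<le> Ct * (w * scale_energy \<epsilon> w H)"
    using Ct_ge(3) Suc.prems scale_energy_nonneg[of H \<epsilon> w] H by (intro mult_right_mono) auto
  finally have ec: "Cc * cell_energy \<epsilon> w h \<le> Ct * (w * scale_energy \<epsilon> w H)"
    by (simp add: cell_energy_def mult.assoc)
  have "?E + ?E = Ct * (w * (geo * scale_energy \<epsilon> (w / 2) (\<theta> * H) + \<theta> ^ Suc n * H))" by (simp add: algebra_simps)
  also have "\<dots> \<le> Ct * (w * (geo * (scale_energy \<epsilon> w H / \<kappa>) + \<theta> ^ Suc n * H))"
    using scale_energy_next[OF Suc.prems(1) H Suc.prems(3)] Ct_ge(1) Suc.prems geo(2) \<theta> H
    by (intro mult_left_mono add_mono) auto
  finally have "Cc * cell_energy \<epsilon> w h + ?E + ?E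
     \<le> Ct * (w * scale_energy \<epsilon> w H) + Ct * (w * (geo * (scale_energy \<epsilon> w H / \<kappa>) + \<theta> ^ Suc n * H))"
    using ec by linarith
  \<comment> \<open>The new cell contributes the 1 in \<open>1 + geo / \<kappa>\<close>, which
    equals \<open>geo\<close>, so the constant does not grow with \<open>n\<close>.\<close>
  also have "\<dots> = Ct * (w * ((1 + geo / \<kappa>) * scale_energy \<epsilon> w H + \<theta> ^ Suc n * H))" by (simp add: algebra_simps)
  finally have energy: "Cc * cell_energy \<epsilon> w h + ?E + ?E
     \<le> Ct * (w * (geo * scale_energy \<epsilon> w H + \<theta> ^ Suc n * H))" unfolding geo(1)[symmetric] .
  have "tower_bc c w H u" unfolding tower_bc_def
  proof (intro ballI conjI impI)
    fix x assume x: "x \<in> para c w H 0"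
    { assume x2: "x$2 = c$2"
      then have "x \<in> ?D1" using x h0 by (auto simp: para_def)
      then show "u x = F *v x + vector [\<alpha> * saw w (x$1 - c$1), 0]"
        using uD1 b1 x2 cpb(1) by simp }
    assume b: "x$1 = c$1 \<or> x$1 = c$1 + w \<or> x$2 = c$2 + H"
    consider "x \<in> ?D1" | "x \<in> ?D2" | "x \<in> ?D3" using x cover by blast
    then show "u x = F *v x"
    proof cases
      case 1
      then have "x$2 \<noteq> c$2 + H" "0 \<le> x$2 - c$2" "x$2 - c$2 \<le> h" using \<theta>H h(2) by (auto simp: para_def)
      then show ?thesis using b uD1[OF 1] b1[OF 1] cpb(4) cpb(5)[of "x$2 - c$2"] by (auto simp: vector_zero2)
    next
      case 2
      then have "x$1 \<noteq> c$1 + w" using Suc.prems(1) by (auto simp: para_def cLR)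
      then show ?thesis using b uD2[OF 2] b2'[OF 2] by auto
    next
      case 3
      then have "x$1 \<noteq> c$1" using Suc.prems(1) by (auto simp: para_def cLR)
      then show ?thesis using b uD3[OF 3] b3'[OF 3] by auto
    qed
  qed
  with pw_affine_mono[OF pa order_refl area energy] show ?case by blast
qed

end

section \<open>The lamination step\<close>

text \<open>\<open>m\<close> is the order of lamination; order 0 means a well, with exponent 1.
  \<open>R\<close> and \<open>C\<close> are chosen before \<epsilon>, which makes the final constant
  uniform.\<close>

definition laminate where
  "laminate K p m F \<longleftrightarrow> (\<exists>R C. 0 \<le> C \<and> norm F \<le> R \<and> (\<forall>\<epsilon>. 0 < \<epsilon> \<longrightarrow> \<epsilon> < 1 \<longrightarrow>
     fillable_square K p R \<epsilon> F C (C * \<epsilon> powr (p / (real m + p)))))"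

lemma infdist_image_le:
  fixes K :: "'a::heine_borel set" and f :: "'a \<Rightarrow> 'b::metric_space"
  assumes "finite K" "K \<noteq> {}" "\<And>A. A \<in> K \<Longrightarrow> f A \<in> K'" "\<And>A. dist (f M) (f A) \<le> dist M A"
  shows "infdist (f M) K' \<le> infdist M K"
proof -
  obtain A where "A \<in> K" "infdist M K = dist M A"
    using infdist_attains_inf[of K M] assms finite_imp_closed by metis
  then show ?thesis using infdist_le[OF assms(3), of A "f M"] assms(4)[of A] by linarith
qed

context lamination_step
begin

text \<open>A tower on the upper half and its mirror image on the lower half. Reflecting domain and
  values conjugates the gradients by diag(1, -1), which fixes diagonal matrices, so the distances to
  the wells do not increase.\<close>

lemma fillable_column:
  assumes "0 < w" "w * \<kappa> ^ n \<le> 2" "0 < \<epsilon>" "\<epsilon> * 2 ^ n < B * w"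
  shows "fillable K p R \<epsilon> (para c w 1 0) (opara c w 1 0) (\<lambda>x. F *v x) (Ct * w)
           (2 * (Ct * (w * (geo * scale_energy \<epsilon> w (1/2) + \<theta> ^ n * (1/2)))))"
    (is "fillable _ _ _ _ _ _ _ _ (2 * ?E)")
proof -
  define c' where "c' = c + vector [0, 1/2]"
  have c': "c'$1 = c$1" "c'$2 = c$2 + 1/2" by (auto simp: c'_def)
  define q where "q = 2 * c$2 + 1"
  obtain u where u: "pw_affine K p R \<epsilon> (para c' w (1/2) 0) u (Ct * (w * (1/2))) ?E" "tower_bc c' w (1/2) u"
    using tower[of w n "1/2" \<epsilon> c'] assms by auto
  define T :: "real^2 \<Rightarrow> real^2" where "T x = vector [x$1, q - x$2]" for x
  have T12: "T x $ 1 = x$1" "T x $ 2 = q - x$2" for x by (auto simp: T_def)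
  have TT: "T (T x) = x" for x by (simp add: vec2_eq_iff T12)
  have Tp: "T x \<in> para c' w (1/2) 0 \<longleftrightarrow> x \<in> para c w (1/2) 0" for x
    unfolding para_def c' T12 q_def mem_Collect_eq by auto
  have img: "T ` para c' w (1/2) 0 = para c w (1/2) 0"
  proof (intro set_eqI iffI)
    fix x assume "x \<in> para c w (1/2) 0"
    then show "x \<in> T ` para c' w (1/2) 0" using Tp TT by (metis imageI)
  next
    fix x assume "x \<in> T ` para c' w (1/2) 0"
    then obtain y where "x = T y" "y \<in> para c' w (1/2) 0" by auto
    then show "x \<in> para c w (1/2) 0" using Tp[of "T y"] TT by simp
  qed
  define \<Psi> where "\<Psi> M = mat2 (M$1$1) (- M$1$2) (- M$2$1) (M$2$2)" for M :: "real^2^2"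
  define \<gamma> :: "real^2^2 \<Rightarrow> real^2 \<Rightarrow> real^2" where
    "\<gamma> M k = vector [k$1 + M$1$2 * q, - k$2 + (F$2$2 - M$2$2) * q]" for M k
  define u' where "u' x = F *v x + mat2 1 0 0 (-1) *v (u (T x) - F *v T x)" for x
  have pa: "pw_affine K p R \<epsilon> (T ` para c' w (1/2) 0) u' (1 * (Ct * (w * (1/2)))) (1 * (1 * ?E + 0 * (Ct * (w * (1/2)))))"
  proof (rule pw_affine_map[OF u(1), where \<nu> = 1 and N = "mat2 1 0 0 (-1)" and \<Psi> = \<Psi> and \<gamma> = \<gamma>])
    show "T y = vector [0, q] + mat2 1 0 0 (-1) *v y" for y by (simp add: vec2_eq_iff T12 matrix_vector_mult_2)
    show "norm (mat2 1 0 0 (-1) *v y) \<le> 1 * norm y" for y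
      by (simp add: norm_vec_def L2_set_def sum_2 matrix_vector_mult_2)
    show "norm (\<Psi> M) \<le> R" if "norm M \<le> R" for M using that by (simp add: norm_mat2_eq \<Psi>_def)
    show "infdist (\<Psi> M) K powr p \<le> 1 * infdist M K powr p + 0" for M
    proof -
      have "infdist (\<Psi> M) K \<le> infdist M K"
      proof (rule infdist_image_le[OF K(1,2)])
        show "\<Psi> A \<in> K" if "A \<in> K" for A
        proof -
          have "\<Psi> A = A" using that K(3) by (auto simp: \<Psi>_def mat2_eq_iff diag2_iff)
          with that show ?thesis by simp
        qed
        show "dist (\<Psi> M) (\<Psi> A) \<le> dist M A" for A
          by (simp add: dist_norm norm_mat2_eq \<Psi>_def power2_commute)
      qed
      then show ?thesis using p infdist_nonneg[of "\<Psi> M" K] powr_mono2[of p "infdist (\<Psi> M) K" "infdist M K"] by simp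
    qed
    show "u' (T y) = \<Psi> M *v T y + \<gamma> M k" if "u y = M *v y + k" for y M k
      using that unfolding u'_def TT by (simp add: vec2_eq_iff matrix_vector_mult_2 T12 \<Psi>_def \<gamma>_def F algebra_simps)
  qed (use assms in \<open>auto simp: det_2\<close>)
  then have pa': "pw_affine K p R \<epsilon> (para c w (1/2) 0) u' (Ct * (w * (1/2))) ?E" by (simp add: img)
  define v where "v x = (if x \<in> para c' w (1/2) 0 then u x else u' x)" for x
  have cover: "para c w 1 0 = para c' w (1/2) 0 \<union> para c w (1/2) 0" unfolding para_def c' by auto
  have ub: "u x = F *v x" if "x \<in> para c' w (1/2) 0" "x$1 = c$1 \<or> x$1 = c$1 + w \<or> x$2 = c$2 + 1" for x
    using u(2) that unfolding tower_bc_def c' by auto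
  have u'b: "u' x = F *v x" if "x \<in> para c w (1/2) 0" "x$1 = c$1 \<or> x$1 = c$1 + w \<or> x$2 = c$2" for x
  proof -
    have "u (T x) = F *v T x" by (rule ub) (use that Tp in \<open>auto simp: T12 q_def\<close>)
    then show ?thesis by (simp add: u'_def)
  qed
  \<comment> \<open>On the common side \<open>u x - F *v x\<close> has only a first component, and
    the reflection of the values leaves that component unchanged.\<close>
  have mid: "u x = u' x" if "x \<in> para c' w (1/2) 0" "x \<in> para c w (1/2) 0" for x
  proof -
    have x2: "x$2 = c$2 + 1/2" using that unfolding para_def c' by auto
    then have Tx: "T x = x" by (simp add: vec2_eq_iff T12 q_def)
    have "u x = F *v x + vector [\<alpha> * saw w (x$1 - c$1), 0]"
      using u(2) that(1) x2 unfolding tower_bc_def c' by auto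
    then show ?thesis unfolding u'_def Tx by (simp add: vec2_eq_iff matrix_vector_mult_2)
  qed
  have "pw_affine K p R \<epsilon> (para c w 1 0) v (Ct * (w * (1/2)) + Ct * (w * (1/2))) (?E + ?E)"
    unfolding cover by (rule pw_affine_glue[OF u(1) pa']) (use mid in \<open>auto simp: v_def\<close>)
  moreover have "v x = F *v x" if x: "x \<in> para c w 1 0 - opara c w 1 0" for x
  proof (cases "x \<in> para c' w (1/2) 0")
    case True
    moreover have "x$2 \<noteq> c$2" using True by (auto simp: para_def c')
    ultimately show ?thesis using ub[OF True] x by (auto simp: v_def para_def opara_def)
  next
    case False
    then have 1: "x \<in> para c w (1/2) 0" using x cover by auto
    moreover have "x$2 \<noteq> c$2 + 1" using 1 by (auto simp: para_def)
    ultimately show ?thesis using u'b[OF 1] x False by (auto simp: v_def para_def opara_def)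
  qed
  moreover have "Ct * (w * (1/2)) + Ct * (w * (1/2)) = Ct * w" "?E + ?E = 2 * ?E" by simp_all
  ultimately show ?thesis unfolding fillable_def by metis
qed

lemma fillable_row:
  assumes "\<And>c. fillable K p R \<epsilon> (para c w 1 0) (opara c w 1 0) g a E" and w: "0 < w" and n: "n \<ge> 1"
  shows "fillable K p R \<epsilon> (para 0 (real n * w) 1 0) (opara 0 (real n * w) 1 0) g (real n * a) (real n * E)"
  using n
proof (induction n rule: nat_induct_at_least)
  case base
  then show ?case using assms(1)[of 0] by simp
next
  case (Suc n)
  define m where "m = real n * w"
  have m: "real (Suc n) * w = m + w" "0 \<le> m" using w by (auto simp: m_def algebra_simps)
  define c :: "real^2" where "c = vector [m, 0]"
  have c: "c$1 = m" "c$2 = 0" by (auto simp: c_def)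
  have D: "para 0 (m + w) 1 0 = para 0 m 1 0 \<union> para c w 1 0"
    unfolding para_def c using m w by auto
  have "fillable K p R \<epsilon> (para 0 (m + w) 1 0) (opara 0 (m + w) 1 0) g (real n * a + a) (real n * E + E)"
    unfolding D by (rule fillable_glue[OF Suc.IH[folded m_def] assms(1)])
      (use m w in \<open>auto simp: para_def opara_def c\<close>)
  then show ?case unfolding m(1) by (simp add: algebra_simps)
qed

text \<open>With a period of order r = \<epsilon> powr (1 / (m + 1 + p)), the inner construction,
  the shear and the cutoff layers are all of order \<open>r powr p\<close>.\<close>

lemma laminate_step:
  assumes m: "\<rho> = p / (real m + p)" and B': "B = 4 * 2 powr (2 * p)"
  shows "laminate K p (Suc m) F"
proof -
  define C where "C = Ct * (geo * (2 + 2 powr p) + 1)"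
  have C0: "0 \<le> C" "Ct \<le> C"
  proof -
    have "0 \<le> geo * (2 + 2 powr p)" using geo(2) by auto
    then have "Ct * 1 \<le> C" unfolding C_def using Ct_ge(1) by (intro mult_left_mono) auto
    then show "0 \<le> C" "Ct \<le> C" using Ct_ge(1) by auto
  qed
  have "fillable_square K p R \<epsilon> F C (C * \<epsilon> powr (p / (real (Suc m) + p)))"
    if \<epsilon>: "0 < \<epsilon>" "\<epsilon> < 1" for \<epsilon>
  proof -
    define e where "e = 1 / (real m + 1 + p)"
    define r where "r = \<epsilon> powr e"
    have e: "0 < e" "e * (real m + 1 + p) = 1" using p by (auto simp: e_def)
    have r: "0 < r" "r \<le> 1" using \<epsilon> e by (auto simp: r_def powr_le1)
    have rm: "r powr (real m + 1 + p) = \<epsilon>" using \<epsilon> e by (simp add: r_def powr_powr)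
    have rp: "r powr p = \<epsilon> powr (p / (real (Suc m) + p))" by (simp add: r_def powr_powr e_def add_ac)
    \<comment> \<open>A whole number of periods must fit into the unit width, so \<open>r\<close> is
      rounded down to \<open>1 / n\<close>; at most a factor 2 is lost.\<close>
    define n where "n = nat \<lceil>1 / r\<rceil>"
    have n: "1 / r \<le> real n" "real n \<le> 1 / r + 1" "n \<ge> 1"
      using divide_pos_pos[OF zero_less_one r(1)] unfolding n_def by linarith+
    define w where "w = 1 / real n"
    have w: "0 < w" "w \<le> r" "real n * w = 1" "w \<le> 1" using n r by (auto simp: w_def field_simps)
    have rw: "r \<le> 2 * w"
    proof -
      have "real n * r \<le> 1 + r" using mult_right_mono[OF n(2), of r] r by (simp add: algebra_simps)
      then show ?thesis using n r by (simp add: w_def field_simps)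
    qed
    obtain N0 where "1 / w < \<kappa> ^ N0" using real_arch_pow[OF \<kappa>(1)] by blast
    then have ex: "1 / w \<le> \<kappa> ^ N0" by simp
    \<comment> \<open>The number of generations is the first that makes the cutoff layer cheap:
      \<open>\<theta> ^ N \<le> (1/2) ^ N\<close>, and \<open>2 ^ N = (\<kappa> ^ N) powr p\<close>
      is at least \<open>(1 / w) powr p\<close>. Minimality and \<open>\<kappa> \<le> 2\<close> give
      \<open>\<kappa> ^ N \<le> 2 / w\<close>, the condition of \<open>tower\<close> for height
      1/2.\<close>
    define N where "N = (LEAST k. 1 / w \<le> \<kappa> ^ k)"
    have N1: "1 / w \<le> \<kappa> ^ N" unfolding N_def using ex by (rule LeastI)
    have N2: "\<kappa> ^ N \<le> 2 / w"
    proof (cases N)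
      case 0
      then show ?thesis using w by (simp add: field_simps)
    next
      case (Suc k)
      then have "\<not> 1 / w \<le> \<kappa> ^ k" unfolding N_def using not_less_Least[of k "\<lambda>k. 1 / w \<le> \<kappa> ^ k"] by simp
      then have "\<kappa> * \<kappa> ^ k \<le> 2 * (1 / w)" using \<kappa> by (intro mult_mono) auto
      then show ?thesis using Suc by simp
    qed
    have \<kappa>N: "(\<kappa> ^ N) powr p = 2 ^ N"
    proof -
      have "\<kappa> ^ N = \<kappa> powr real N" using \<kappa>(1) by (intro powr_realpow[symmetric]) auto
      then have "(\<kappa> ^ N) powr p = (\<kappa> powr p) powr real N" by (simp add: powr_powr mult.commute)
      then show ?thesis unfolding \<kappa>(3) by (simp add: powr_realpow)
    qed
    have t1: "w * \<kappa> ^ N \<le> 2" using mult_left_mono[OF N2, of w] w by simp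
    \<comment> \<open>This fixes \<open>B\<close>:
      \<open>\<epsilon> \<le> (2 * w) powr (1 + p)\<close> and
      \<open>2 ^ N \<le> (2 / w) powr p\<close> bound the left side by
      \<open>2 * 2 powr (2 * p) * w\<close>, half of \<open>B * w\<close>.\<close>
    have t2: "\<epsilon> * 2 ^ N < B * w"
    proof -
      have "\<epsilon> \<le> r powr (1 + p)" unfolding rm[symmetric] using r by (intro powr_mono') auto
      also have "\<dots> \<le> (2 * w) powr (1 + p)" using r rw p by (intro powr_mono2) auto
      finally have 1: "\<epsilon> \<le> (2 * w) powr (1 + p)" .
      have "2 ^ N \<le> (2 / w) powr p" unfolding \<kappa>N[symmetric] using N2 \<kappa>(1) p by (intro powr_mono2) auto
      then have "\<epsilon> * 2 ^ N \<le> (2 * w) powr (1 + p) * (2 / w) powr p" using 1 \<epsilon> by (intro mult_mono) auto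
      also have "\<dots> = 2 powr (1 + p) * 2 powr p * (w powr (1 + p) / w powr p)"
        using w by (simp add: powr_mult powr_divide)
      also have "w powr (1 + p) / w powr p = w" using w by (simp add: powr_add)
      also have "2 powr (1 + p) * 2 powr p = (2::real) powr (1 + 2 * p)" by (simp add: add_ac flip: powr_add)
      also have "\<dots> = 2 * 2 powr (2 * p)" by (simp add: powr_add)
      also have "2 * 2 powr (2 * p) * w < B * w" unfolding B' using w by simp
      finally show ?thesis .
    qed
    have row: "fillable K p R \<epsilon> (para 0 (real n * w) 1 0) (opara 0 (real n * w) 1 0) (\<lambda>x. F *v x) (real n * (Ct * w))
           (real n * (2 * (Ct * (w * (geo * scale_energy \<epsilon> w (1/2) + \<theta> ^ N * (1/2))))))"
      by (rule fillable_row[OF fillable_column[OF w(1) t1 \<epsilon>(1) t2] w(1) n(3)])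
    have B1: "1 \<le> B" by (rule B)
    have "r / 2 \<le> B * w" using rw mult_right_mono[OF B1, of w] w(1) by linarith
    \<comment> \<open>Since \<open>\<epsilon> = r powr (m + 1 + p)\<close>, the quotient is at most
      \<open>2 * r powr (m + p)\<close>, and the exponent \<open>\<rho> = p / (m + p)\<close> turns
      this into a multiple of \<open>r powr p\<close>.\<close>
    then have "\<epsilon> / (B * w) \<le> \<epsilon> / (r / 2)" using \<epsilon> r w B1 by (intro divide_left_mono) auto
    also have "\<dots> = 2 * r powr (real m + p)"
      using rm powr_add[of r "real m + p" 1] r by (simp add: add_ac)
    finally have "(\<epsilon> / (B * w)) powr \<rho> \<le> (2 * r powr (real m + p)) powr \<rho>"
      using \<epsilon> B1 w \<rho> by (intro powr_mono2) auto
    also have "\<dots> = 2 powr \<rho> * r powr p" using r p by (simp add: powr_mult powr_powr m)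
    also have "\<dots> \<le> 2 * r powr p" using powr_mono[of \<rho> 1 "2::real"] \<rho> by (intro mult_right_mono) auto
    finally have s1: "(\<epsilon> / (B * w)) powr \<rho> \<le> 2 * r powr p" .
    have "(w / (1/2)) powr p = 2 powr p * w powr p" by (simp add: powr_mult mult.commute)
    also have "\<dots> \<le> 2 powr p * r powr p" using w r p by (intro mult_left_mono powr_mono2) auto
    finally have s2: "(w / (1/2)) powr p \<le> 2 powr p * r powr p" .
    have s3: "\<theta> ^ N \<le> r powr p"
    proof -
      have "\<theta> ^ N \<le> (1/2) ^ N" using \<theta> by (intro power_mono) auto
      also have "\<dots> = inverse ((\<kappa> ^ N) powr p)" unfolding \<kappa>N by (simp add: power_one_over inverse_eq_divide)
      also have "\<dots> \<le> inverse ((1 / w) powr p)"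
        using N1 w p \<kappa>(1) by (intro le_imp_inverse_le powr_mono2) auto
      also have "\<dots> = w powr p" using w by (simp add: powr_divide)
      also have "\<dots> \<le> r powr p" using w r p by (intro powr_mono2) auto
      finally show ?thesis .
    qed
    have se: "scale_energy \<epsilon> w (1/2) \<le> (1/2) * ((2 + 2 powr p) * r powr p)"
      unfolding scale_energy_def using s1 s2 by (simp add: algebra_simps)
    have "real n * (2 * (Ct * (w * (geo * scale_energy \<epsilon> w (1/2) + \<theta> ^ N * (1/2)))))
       = (real n * w) * (2 * Ct * (geo * scale_energy \<epsilon> w (1/2) + \<theta> ^ N * (1/2)))" by simp
    also have "\<dots> \<le> 1 * (2 * Ct * (geo * ((1/2) * ((2 + 2 powr p) * r powr p)) + r powr p * (1/2)))"
      unfolding w(3) using se s3 Ct_ge(1) geo(2) by (intro mult_left_mono add_mono mult_right_mono) auto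
    also have "\<dots> = C * r powr p" by (simp add: C_def algebra_simps)
    finally have en: "real n * (2 * (Ct * (w * (geo * scale_energy \<epsilon> w (1/2) + \<theta> ^ N * (1/2))))) \<le> C * \<epsilon> powr (p / (real (Suc m) + p))"
      by (simp add: rp)
    have "real n * (Ct * w) = Ct * (real n * w)" by (rule mult.left_commute)
    then have ar: "real n * (Ct * w) \<le> C" using C0(2) by (simp only: w(3) mult_1_right)
    show ?thesis using fillable_mono[OF row order_refl ar en] unfolding w(3) by auto
  qed
  moreover have "norm F \<le> R" using norm_mats(3)[of 0] by (simp add: F)
  ultimately show ?thesis unfolding laminate_def using C0 by blast
qed

end

section \<open>Exchange of coordinates and the induction step\<close>

definition swap2 :: "real^2^2 \<Rightarrow> real^2^2" where
  "swap2 M = mat2 (M$2$2) (M$2$1) (M$1$2) (M$1$1)"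

lemma swap2_swap2 [simp]: "swap2 (swap2 M) = M"
  by (simp add: swap2_def mat2_eq_iff)

lemma norm_swap2: "norm (swap2 M) = norm M"
  by (simp add: swap2_def norm_mat2_eq add_ac)

lemma dist_swap2: "dist (swap2 M) (swap2 N) = dist M N"
  by (simp add: swap2_def dist_norm norm_mat2_eq add_ac)

text \<open>Exchanging the coordinates in domain and range is an isometry of the square and of the
  matrices, so \<open>R\<close> and \<open>C\<close> stay the same. It reduces lamination in
  direction e2 to direction e1.\<close>

lemma (in wells) laminate_swap2:
  assumes "laminate K p m F"
  shows "laminate (swap2 ` K) p m (swap2 F)"
proof -
  obtain R C where RC: "0 \<le> C" "norm F \<le> R" "\<And>\<epsilon>. 0 < \<epsilon> \<Longrightarrow> \<epsilon> < 1 \<Longrightarrow>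
     fillable_square K p R \<epsilon> F C (C * \<epsilon> powr (p / (real m + p)))"
    using assms unfolding laminate_def by blast
  have "fillable_square (swap2 ` K) p R \<epsilon> (swap2 F) C (C * \<epsilon> powr (p / (real m + p)))"
    if \<epsilon>: "0 < \<epsilon>" "\<epsilon> < 1" for \<epsilon>
  proof -
    let ?E = "C * \<epsilon> powr (p / (real m + p))"
    obtain u where u: "pw_affine K p R \<epsilon> (para 0 1 1 0) u C ?E" "\<And>x. x \<in> para 0 1 1 0 - opara 0 1 1 0 \<Longrightarrow> u x = F *v x"
      using RC(3)[OF \<epsilon>] unfolding fillable_def by blast
    define T :: "real^2 \<Rightarrow> real^2" where "T x = vector [x$2, x$1]" for x
    have T12: "T x $ 1 = x$2" "T x $ 2 = x$1" for x by (auto simp: T_def)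
    have TT: "T (T x) = x" for x by (simp add: vec2_eq_iff T12)
    have Tp: "T x \<in> para 0 1 1 0 \<longleftrightarrow> x \<in> para 0 1 1 0" "T x \<in> opara 0 1 1 0 \<longleftrightarrow> x \<in> opara 0 1 1 0" for x
      unfolding para_def opara_def T12 mem_Collect_eq by auto
    have img: "T ` para 0 1 1 0 = para 0 1 1 0"
    proof (intro set_eqI iffI)
      fix x :: "real^2" assume "x \<in> para 0 1 1 0"
      then show "x \<in> T ` para 0 1 1 0" using Tp TT by (metis imageI)
    qed (use Tp TT in auto)
    define u' where "u' x = T (u (T x))" for x
    have "pw_affine (swap2 ` K) p R \<epsilon> (T ` para 0 1 1 0) u' (1 * C) (1 * (1 * ?E + 0 * C))"
    proof (rule pw_affine_map[OF u(1), where \<nu> = 1 and N = "mat2 0 1 1 0" and \<Psi> = swap2 and \<gamma> = "\<lambda>M k. T k"])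
      show "T y = 0 + mat2 0 1 1 0 *v y" for y by (simp add: vec2_eq_iff T12 matrix_vector_mult_2)
      show "norm (mat2 0 1 1 0 *v y) \<le> 1 * norm y" for y
        by (simp add: norm_vec_def L2_set_def sum_2 matrix_vector_mult_2 add_ac)
      show "infdist (swap2 M) (swap2 ` K) powr p \<le> 1 * infdist M K powr p + 0" for M
        using infdist_image_le[OF K(1,2), of swap2 "swap2 ` K" M] p infdist_nonneg[of "swap2 M" "swap2 ` K"]
          powr_mono2[of p "infdist (swap2 M) (swap2 ` K)" "infdist M K"]
        by (simp add: dist_swap2)
      show "u' (T y) = swap2 M *v T y + T k" if "u y = M *v y + k" for y M k
        using that unfolding u'_def TT by (simp add: vec2_eq_iff matrix_vector_mult_2 T12 swap2_def)
    qed (use \<epsilon> in \<open>auto simp: det_2 norm_swap2\<close>)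
    moreover have "u' x = swap2 F *v x" if "x \<in> para 0 1 1 0 - opara 0 1 1 0" for x
    proof -
      have "u (T x) = F *v T x" by (rule u(2)) (use that Tp in auto)
      then show ?thesis by (simp add: u'_def vec2_eq_iff matrix_vector_mult_2 T12 swap2_def)
    qed
    ultimately show ?thesis unfolding fillable_def img by auto
  qed
  with RC(1,2) have "0 \<le> C \<and> norm (swap2 F) \<le> R \<and> (\<forall>\<epsilon>. 0 < \<epsilon> \<longrightarrow> \<epsilon> < 1 \<longrightarrow>
     fillable_square (swap2 ` K) p R \<epsilon> (swap2 F) C (C * \<epsilon> powr (p / (real m + p))))"
    by (simp add: norm_swap2)
  then show ?thesis unfolding laminate_def by blast
qed

lemma (in wells) laminate_Suc_aux:
  assumes A: "A \<in> K" and J: "J \<in> diag2" and eq: "A$2$2 = J$2$2"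
    and la: "0 < la" "la < 1" and lam: "laminate K p m J"
  shows "laminate K p (Suc m) (la *\<^sub>R A + (1 - la) *\<^sub>R J)"
proof -
  obtain R0 C0 where RC: "0 \<le> C0" "norm J \<le> R0" "\<And>\<epsilon>. 0 < \<epsilon> \<Longrightarrow> \<epsilon> < 1 \<Longrightarrow>
     fillable_square K p R0 \<epsilon> J C0 (C0 * \<epsilon> powr (p / (real m + p)))"
    using lam unfolding laminate_def by blast
  have Ad: "A \<in> diag2" using A K(3) by auto
  interpret lamination_step K p A J "la *\<^sub>R A + (1 - la) *\<^sub>R J" la "A$1$1 - J$1$1" R0 C0 "p / (real m + p)" "4 * 2 powr (2 * p)"
  proof
    show "A = mat2 (J $ 1 $ 1 + (A $ 1 $ 1 - J $ 1 $ 1)) 0 0 (J $ 2 $ 2)"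
      using Ad eq by (simp add: mat2_eq_iff diag2_iff)
    show "la *\<^sub>R A + (1 - la) *\<^sub>R J = mat2 (J $ 1 $ 1 + la * (A $ 1 $ 1 - J $ 1 $ 1)) 0 0 (J $ 2 $ 2)"
      using Ad J eq by (simp add: mat2_eq_iff diag2_iff algebra_simps)
    have "1 \<le> 2 powr (2 * p)" using p by (intro ge_one_powr_ge_zero) auto
    then show "1 \<le> 4 * 2 powr (2 * p)" by simp
    show "p / (real m + p) \<le> 1" "0 < p / (real m + p)" using p by auto
  qed (use assms RC in auto)
  show ?thesis by (rule laminate_step) auto
qed

text \<open>A diagonal matrix of rank one is singular, so \<open>A\<close> and \<open>J\<close>
  share a diagonal entry. If it is the first one, the problem is exchanged, solved, and exchanged
  back.\<close>

lemma (in wells) laminate_Suc: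
  assumes A: "A \<in> K" and J: "J \<in> diag2" and rank: "rank (A - J) = 1"
    and la: "0 < la" "la < 1" and lam: "laminate K p m J"
  shows "laminate K p (Suc m) (la *\<^sub>R A + (1 - la) *\<^sub>R J)"
proof -
  have Ad: "A \<in> diag2" using A K(3) by auto
  have "det (A - J) = 0" using rank det_eq_0_rank[of "A - J"] by simp
  then have "A$2$2 = J$2$2 \<or> A$1$1 = J$1$1" using Ad J by (auto simp: det_2 diag2_iff)
  then show ?thesis
  proof
    assume "A$2$2 = J$2$2"
    then show ?thesis by (rule laminate_Suc_aux[OF A J _ la lam])
  next
    assume eq: "A$1$1 = J$1$1"
    have "swap2 ` K \<subseteq> diag2" using K(3) by (auto simp: swap2_def diag2_iff)
    then interpret sw: wells "swap2 ` K" p by unfold_locales (use K p in auto)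
    have "laminate (swap2 ` K) p (Suc m) (la *\<^sub>R swap2 A + (1 - la) *\<^sub>R swap2 J)"
      by (rule sw.laminate_Suc_aux[OF imageI[OF A] _ _ la laminate_swap2[OF lam]])
        (use J eq in \<open>auto simp: swap2_def diag2_iff\<close>)
    from sw.laminate_swap2[OF this]
    have "laminate K p (Suc m) (swap2 (la *\<^sub>R swap2 A + (1 - la) *\<^sub>R swap2 J))" by (simp add: image_image)
    moreover have "swap2 (la *\<^sub>R swap2 A + (1 - la) *\<^sub>R swap2 J) = la *\<^sub>R A + (1 - la) *\<^sub>R J"
      by (simp add: swap2_def mat2_eq_iff)
    ultimately show ?thesis by simp
  qed
qed

text \<open>The affine map with gradient \<open>A\<close> has no elastic energy, and the exponent
  \<open>p / (0 + p)\<close> is 1; the constant 2 bounds the diameter of the square by the sum of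
  its sides.\<close>

lemma (in wells) laminate_0:
  assumes "A \<in> K" shows "laminate K p 0 A"
  unfolding laminate_def
proof (rule exI[of _ "norm A"], rule exI[of _ 2], intro conjI allI impI)
  fix \<epsilon> :: real assume \<epsilon>: "0 < \<epsilon>" "\<epsilon> < 1"
  have "convex (para 0 1 1 0)" by (simp add: para_eq_cbox)
  from pw_affine_box_piece[OF subset_refl para_closed this, of "\<lambda>x. A *v x" A 0 "norm A" K 0 \<epsilon> p]
  have "pw_affine K p (norm A) \<epsilon> (para 0 1 1 0) (\<lambda>x. A *v x) 1 (\<epsilon> * 2)"
    using \<epsilon> p infdist_zero[OF assms] by simp
  from pw_affine_mono[OF this order_refl, of 2 "2 * \<epsilon> powr (p / (real 0 + p))" "\<lambda>x. A *v x"]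
  have "pw_affine K p (norm A) \<epsilon> (para 0 1 1 0) (\<lambda>x. A *v x) 2 (2 * \<epsilon> powr (p / (real 0 + p)))"
    using \<epsilon> p by simp
  then show "fillable K p (norm A) \<epsilon> (para 0 1 1 0) (opara 0 1 1 0) ((*v) A) 2 (2 * \<epsilon> powr (p / (real 0 + p)))"
    unfolding fillable_def by blast
qed auto

section \<open>Test functions and difference quotients\<close>

lemma test_function_diff: "\<phi> \<in> test_functions \<Omega> \<Longrightarrow> \<phi> differentiable (at x)"
  unfolding test_functions_def mem_Collect_eq by (metis C_times.simps(2))

lemma test_function_cont: "\<phi> \<in> test_functions \<Omega> \<Longrightarrow> continuous_on UNIV \<phi>"
  unfolding test_functions_def mem_Collect_eq by (metis C_times.simps(1))

lemma test_function_zero: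
  "\<phi> \<in> test_functions \<Omega> \<Longrightarrow> x \<notin> \<Omega> \<Longrightarrow> \<phi> x = 0"
  unfolding test_functions_def using closure_subset[of "{x. \<phi> x \<noteq> 0}"] by auto

text \<open>Off the closed support \<phi> vanishes in a neighbourhood, and so does its derivative.
  Iterated, this covers the second derivatives in \<open>TV_D2\<close>.\<close>

lemma test_functions_partial_deriv:
  assumes "\<phi> \<in> test_functions \<Omega>"
  shows "partial_deriv j \<phi> \<in> test_functions \<Omega>"
proof -
  let ?S = "closure {x. \<phi> x \<noteq> 0}"
  have sub: "{x. partial_deriv j \<phi> x \<noteq> 0} \<subseteq> ?S"
  proof (rule ccontr)
    assume "\<not> ?thesis"
    then obtain x where x: "partial_deriv j \<phi> x \<noteq> 0" "x \<in> - ?S" by auto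
    have "(\<phi> has_derivative (\<lambda>_. 0)) (at x)"
      by (rule has_derivative_transform_within_open[OF has_derivative_const[of 0] _ x(2)])
        (use closure_subset[of "{x. \<phi> x \<noteq> 0}"] in auto)
    then have "frechet_derivative \<phi> (at x) = (\<lambda>_. 0)" by (metis frechet_derivative_at)
    with x show False by (simp add: partial_deriv_def)
  qed
  then have c: "closure {x. partial_deriv j \<phi> x \<noteq> 0} \<subseteq> ?S" by (simp add: closure_minimal)
  have "compact (closure {x. partial_deriv j \<phi> x \<noteq> 0})"
    using compact_Int_closed[of ?S "closure {x. partial_deriv j \<phi> x \<noteq> 0}"] assms c
    by (simp add: test_functions_def inf.absorb2)
  moreover have "C_times n (partial_deriv j \<phi>)" for n
    using assms unfolding test_functions_def mem_Collect_eq by (metis C_times.simps(2))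
  ultimately show ?thesis using c assms by (auto simp: test_functions_def)
qed

lemma test_function_support_ball:
  assumes "\<phi> \<in> test_functions \<Omega>"
  obtains r where "0 < r" "\<And>x. x \<notin> cball 0 r \<Longrightarrow> \<phi> x = 0"
proof -
  have "bounded (closure {x. \<phi> x \<noteq> 0})" using assms by (simp add: test_functions_def compact_imp_bounded)
  then obtain r where r: "0 < r" "\<And>x. x \<in> closure {x. \<phi> x \<noteq> 0} \<Longrightarrow> norm x \<le> r"
    by (meson bounded_pos)
  then have "\<phi> x = 0" if "x \<notin> cball 0 r" for x
    using that closure_subset[of "{x. \<phi> x \<noteq> 0}"] by (auto simp: subset_iff)
  with r that show ?thesis by blast
qed

lemma test_function_bounded:
  assumes "\<phi> \<in> test_functions \<Omega>"
  obtains M where "0 \<le> M" "\<And>x. \<bar>\<phi> x\<bar> \<le> M"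
proof -
  obtain r where r: "0 < r" "\<And>x. x \<notin> cball 0 r \<Longrightarrow> \<phi> x = 0" using test_function_support_ball[OF assms] by metis
  have "compact (\<phi> ` cball 0 r)"
    by (intro compact_continuous_image continuous_on_subset[OF test_function_cont[OF assms]]) auto
  then obtain M where M: "\<And>x. x \<in> cball 0 r \<Longrightarrow> norm (\<phi> x) \<le> M"
    using compact_imp_bounded bounded_iff by (metis imageI)
  have "\<bar>\<phi> x\<bar> \<le> \<bar>M\<bar>" for x using M[of x] r(2)[of x] by (cases "x \<in> cball 0 r") auto
  then show ?thesis using that[of "\<bar>M\<bar>"] by auto
qed

lemma test_function_borel:
  "\<phi> \<in> test_functions \<Omega> \<Longrightarrow> \<phi> \<in> borel_measurable borel"
  by (intro borel_measurable_continuous_onI test_function_cont)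

lemma test_function_DERIV:
  assumes "\<phi> \<in> test_functions \<Omega>"
  shows "((\<lambda>s. \<phi> (x + s *\<^sub>R axis j 1)) has_real_derivative partial_deriv j \<phi> (x + s *\<^sub>R axis j 1)) (at s)"
proof -
  let ?y = "x + s *\<^sub>R axis j 1"
  have d: "(\<phi> has_derivative frechet_derivative \<phi> (at ?y)) (at ?y)"
    using test_function_diff[OF assms] frechet_derivative_works by blast
  have "((\<lambda>s. x + s *\<^sub>R axis j 1) has_derivative (\<lambda>h. h *\<^sub>R axis j 1)) (at s)"
    by (auto intro!: derivative_eq_intros)
  from has_derivative_compose[OF this d]
  have "((\<lambda>s. \<phi> (x + s *\<^sub>R axis j 1)) has_derivative (\<lambda>h. frechet_derivative \<phi> (at ?y) (h *\<^sub>R axis j 1))) (at s)" .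
  moreover have "frechet_derivative \<phi> (at ?y) (h *\<^sub>R axis j 1) = h * partial_deriv j \<phi> ?y" for h
    using linear_cmul[OF linear_frechet_derivative[OF test_function_diff[OF assms]], of ?y h "axis j 1"]
    by (simp add: partial_deriv_def)
  ultimately show ?thesis by (simp add: has_field_derivative_def mult.commute[of _ "partial_deriv j \<phi> ?y"])
qed

section \<open>Difference quotients and integration by parts\<close>

lemma LIMSEQ_inverse_Suc_at: "filterlim (\<lambda>n. inverse (real (Suc n))) (at 0) sequentially"
  by (rule filterlim_atI[OF LIMSEQ_inverse_real_of_nat]) auto

lemma diff_quotient_limit:
  fixes f :: "real \<Rightarrow> real"
  assumes "(f has_real_derivative D) (at 0)"
  shows "(\<lambda>n. real (Suc n) * (f (inverse (real (Suc n))) - f 0)) \<longlonglongrightarrow> D"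
proof -
  have "((\<lambda>h. (f (0 + h) - f 0) / h) \<longlongrightarrow> D) (at 0)" using assms by (simp add: DERIV_def)
  from filterlim_compose[OF this LIMSEQ_inverse_Suc_at]
  show ?thesis by (simp add: divide_inverse mult.commute)
qed

lemma test_function_lipschitz:
  assumes "\<phi> \<in> test_functions \<Omega>" and L: "\<And>x. \<bar>partial_deriv j \<phi> x\<bar> \<le> L" and t: "0 \<le> t"
  shows "\<bar>\<phi> (x + t *\<^sub>R axis j 1) - \<phi> x\<bar> \<le> L * t"
proof (cases "t = 0")
  case False
  then have "0 < t" using t by simp
  from MVT2[OF this test_function_DERIV[OF assms(1), of x j]]
  obtain z where "\<phi> (x + t *\<^sub>R axis j 1) - \<phi> (x + 0 *\<^sub>R axis j 1) = (t - 0) * partial_deriv j \<phi> (x + z *\<^sub>R axis j 1)"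
    by auto
  then show ?thesis using mult_left_mono[OF L[of "x + z *\<^sub>R axis j 1"] t] t by (simp add: abs_mult mult.commute)
qed simp

lemma integrable_bounded_support:
  fixes f :: "real^2 \<Rightarrow> real"
  assumes [measurable]: "f \<in> borel_measurable borel"
    and "\<And>x. x \<notin> cball 0 r \<Longrightarrow> f x = 0" "\<And>x. x \<in> cball 0 r \<Longrightarrow> \<bar>f x\<bar> \<le> M"
  shows "integrable lborel f"
proof (rule Bochner_Integration.integrable_bound[where f = "\<lambda>x. M * indicator (cball 0 r) x"])
  have "emeasure lborel (cball (0::real^2) r) < \<infinity>" by (rule emeasure_bounded_finite) simp
  then show "integrable lborel (\<lambda>x::real^2. M * indicator (cball 0 r) x)" by auto
  show "AE x in lborel. norm (f x) \<le> norm (M * indicator (cball 0 r) x)"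
    using assms(2,3) by (intro AE_I2) (force simp: indicator_def)
qed auto

lemma integral_translate:
  fixes g :: "real^2 \<Rightarrow> real"
  assumes [measurable]: "g \<in> borel_measurable borel"
  shows "(LINT x|lborel. g (x + c)) = (LINT x|lborel. g x)"
  using integral_distr[of "(+) c" lborel borel g] by (simp add: lborel_distr_plus add.commute)

definition locally_bounded :: "(real^2 \<Rightarrow> real) \<Rightarrow> bool" where
  "locally_bounded f \<longleftrightarrow> (\<forall>r. \<exists>M. \<forall>x\<in>cball 0 r. \<bar>f x\<bar> \<le> M)"

lemma locally_bounded_continuous:
  assumes "continuous_on UNIV f" shows "locally_bounded f"
  unfolding locally_bounded_def
proof
  fix r :: real
  have "compact (f ` cball 0 r)" by (intro compact_continuous_image continuous_on_subset[OF assms]) auto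
  then have "bounded (f ` cball 0 r)" by (rule compact_imp_bounded)
  then show "\<exists>M. \<forall>x\<in>cball 0 r. \<bar>f x\<bar> \<le> M" by (simp add: bounded_iff)
qed

lemma test_function_mult_integrable:
  assumes \<phi>: "\<phi> \<in> test_functions \<Omega>" and [measurable]: "f \<in> borel_measurable borel" and "locally_bounded f"
  shows "integrable lborel (\<lambda>x. f x * \<phi> x)"
proof -
  note [measurable] = test_function_borel[OF \<phi>]
  obtain r where r: "\<And>x. x \<notin> cball 0 r \<Longrightarrow> \<phi> x = 0" using test_function_support_ball[OF \<phi>] by metis
  obtain M where M: "0 \<le> M" "\<And>x. \<bar>\<phi> x\<bar> \<le> M" using test_function_bounded[OF \<phi>] by metis
  obtain N where N: "\<And>x. x \<in> cball 0 r \<Longrightarrow> \<bar>f x\<bar> \<le> N" using assms(3) unfolding locally_bounded_def by blast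
  show ?thesis
  proof (rule integrable_bounded_support[of _ r "\<bar>N\<bar> * M"])
    show "\<bar>f x * \<phi> x\<bar> \<le> \<bar>N\<bar> * M" if "x \<in> cball 0 r" for x
      unfolding abs_mult using N[OF that] M by (intro mult_mono) auto
  qed (use r in auto)
qed

text \<open>A change of variables moves the shift from \<open>f\<close> to \<phi>, whose quotients
  converge pointwise and are bounded by the maximum of its derivative. Hence local boundedness of
  \<open>f\<close> suffices, and the lemma applies to the Lipschitz map and to its discontinuous
  gradient alike.\<close>

lemma difference_quotient_integral:
  assumes \<phi>: "\<phi> \<in> test_functions \<Omega>" and f [measurable]: "f \<in> borel_measurable borel" and lb: "locally_bounded f"
  shows "(\<lambda>n. LINT x|lborel. real (Suc n) * (f (x - inverse (real (Suc n)) *\<^sub>R axis j 1) - f x) * \<phi> x)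
     \<longlonglongrightarrow> (LINT x|lborel. f x * partial_deriv j \<phi> x)"
proof -
  note [measurable] = test_function_borel[OF \<phi>] test_function_borel[OF test_functions_partial_deriv[OF \<phi>]]
  define t where "t n = inverse (real (Suc n))" for n
  define e :: "real^2" where "e = axis j 1"
  have t: "0 < t n" "t n \<le> 1" "real (Suc n) * t n = 1" for n by (simp_all add: t_def field_simps)
  have ne: "norm e = 1" by (simp add: e_def)
  obtain r where r: "0 < r" "\<And>x. x \<notin> cball 0 r \<Longrightarrow> \<phi> x = 0" using test_function_support_ball[OF \<phi>] by metis
  obtain L where L: "0 \<le> L" "\<And>x. \<bar>partial_deriv j \<phi> x\<bar> \<le> L"
    using test_function_bounded[OF test_functions_partial_deriv[OF \<phi>]] by metis
  obtain B where B: "0 \<le> B" "\<And>x. \<bar>\<phi> x\<bar> \<le> B" using test_function_bounded[OF \<phi>] by metis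
  obtain M where M: "\<And>x. x \<in> cball 0 (r + 1) \<Longrightarrow> \<bar>f x\<bar> \<le> M" using lb unfolding locally_bounded_def by blast
  have M0: "0 \<le> M" using M[of 0] r by auto
  \<comment> \<open>All shifts are at most 1, so the ball of radius \<open>r + 1\<close> contains
    the supports of all shifted test functions.\<close>
  have sh: "x + t n *\<^sub>R e \<notin> cball 0 r" if "x \<notin> cball 0 (r + 1)" for x n
    using that t[of n] ne norm_triangle_ineq2[of x "- (t n *\<^sub>R e)"] by auto
  let ?q = "\<lambda>n x. real (Suc n) * (\<phi> (x + t n *\<^sub>R e) - \<phi> x)"
  have "(\<lambda>n. LINT x|lborel. f x * ?q n x)
     \<longlonglongrightarrow> (LINT x|lborel. f x * partial_deriv j \<phi> x)"
  proof (rule integral_dominated_convergence[where w = "\<lambda>x. M * L * indicator (cball 0 (r + 1)) x"])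
    have "emeasure lborel (cball (0::real^2) (r + 1)) < \<infinity>" by (rule emeasure_bounded_finite) simp
    then show "integrable lborel (\<lambda>x::real^2. M * L * indicator (cball 0 (r + 1)) x)" by auto
    show "AE x in lborel. (\<lambda>n. f x * ?q n x) \<longlonglongrightarrow> f x * partial_deriv j \<phi> x"
    proof (intro AE_I2 tendsto_mult tendsto_const)
      fix x
      have "((\<lambda>s. \<phi> (x + s *\<^sub>R e)) has_real_derivative partial_deriv j \<phi> x) (at 0)"
        using test_function_DERIV[OF \<phi>, of x j 0] by (simp add: e_def)
      from diff_quotient_limit[OF this] show "(\<lambda>n. real (Suc n) * (\<phi> (x + t n *\<^sub>R e) - \<phi> x)) \<longlonglongrightarrow> partial_deriv j \<phi> x"
        by (simp add: t_def)
    qed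
    show "AE x in lborel. norm (f x * ?q n x) \<le> M * L * indicator (cball 0 (r + 1)) x" for n
    proof (intro AE_I2)
      fix x
      show "norm (f x * ?q n x) \<le> M * L * indicator (cball 0 (r + 1)) x"
      proof (cases "x \<in> cball 0 (r + 1)")
        case True
        have "\<bar>?q n x\<bar> = real (Suc n) * \<bar>\<phi> (x + t n *\<^sub>R e) - \<phi> x\<bar>"
          by (simp add: abs_mult)
        also have "\<dots> \<le> real (Suc n) * (L * t n)"
          using test_function_lipschitz[OF \<phi> L(2), of "t n" x] t(1)[of n] unfolding e_def by (intro mult_left_mono) auto
        also have "\<dots> = L * (real (Suc n) * t n)" by (rule mult.left_commute)
        finally have "\<bar>?q n x\<bar> \<le> L" unfolding t(3) by simp
        then have "\<bar>f x\<bar> * \<bar>?q n x\<bar> \<le> M * L"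
          using M[OF True] M0 by (intro mult_mono) auto
        then show ?thesis using True by (simp add: abs_mult)
      next
        case False
        then have "\<phi> (x + t n *\<^sub>R e) = 0" "\<phi> x = 0" using sh r(2) by auto
        then show ?thesis using False by simp
      qed
    qed
  qed (auto simp: e_def)
  moreover have "(LINT x|lborel. f x * ?q n x) =
      (LINT x|lborel. real (Suc n) * (f (x - t n *\<^sub>R e) - f x) * \<phi> x)" for n
  proof -
    have i1: "integrable lborel (\<lambda>x. f x * \<phi> (x + t n *\<^sub>R e))"
    proof (rule integrable_bounded_support[of _ "r + 1" "M * B"])
      show "\<bar>f x * \<phi> (x + t n *\<^sub>R e)\<bar> \<le> M * B" if "x \<in> cball 0 (r + 1)" for x
        unfolding abs_mult using M[OF that] B M0 by (intro mult_mono) auto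
    qed (use sh r in auto)
    have i2: "integrable lborel (\<lambda>x. f (x - t n *\<^sub>R e) * \<phi> x)"
    proof (rule integrable_bounded_support[of _ r "M * B"])
      show "\<bar>f (x - t n *\<^sub>R e) * \<phi> x\<bar> \<le> M * B" if "x \<in> cball 0 r" for x
      proof -
        have "norm (x - t n *\<^sub>R e) \<le> norm x + norm (t n *\<^sub>R e)" by (rule norm_triangle_ineq4)
        then have "x - t n *\<^sub>R e \<in> cball 0 (r + 1)" using that t[of n] ne by auto
        then show ?thesis unfolding abs_mult using M B M0 by (intro mult_mono) auto
      qed
    qed (use r in auto)
    have i3: "integrable lborel (\<lambda>x. f x * \<phi> x)" by (rule test_function_mult_integrable[OF \<phi> f lb])
    have "(LINT x|lborel. f x * \<phi> (x + t n *\<^sub>R e)) = (LINT x|lborel. f (x - t n *\<^sub>R e) * \<phi> x)"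
      using integral_translate[of "\<lambda>x. f (x - t n *\<^sub>R e) * \<phi> x" "t n *\<^sub>R e"] by simp
    moreover have "(LINT x|lborel. f x * ?q n x)
       = real (Suc n) * ((LINT x|lborel. f x * \<phi> (x + t n *\<^sub>R e)) - (LINT x|lborel. f x * \<phi> x))"
      unfolding Bochner_Integration.integral_diff[OF i1 i3, symmetric] integral_mult_right_zero[symmetric]
      by (rule Bochner_Integration.integral_cong) (auto simp: algebra_simps)
    moreover have "(LINT x|lborel. real (Suc n) * (f (x - t n *\<^sub>R e) - f x) * \<phi> x)
       = real (Suc n) * ((LINT x|lborel. f (x - t n *\<^sub>R e) * \<phi> x) - (LINT x|lborel. f x * \<phi> x))"
      unfolding Bochner_Integration.integral_diff[OF i2 i3, symmetric] integral_mult_right_zero[symmetric]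
      by (rule Bochner_Integration.integral_cong) (auto simp: algebra_simps)
    ultimately show ?thesis by simp
  qed
  ultimately show ?thesis by (simp add: t_def e_def)
qed

lemma integral_partial_deriv_zero:
  assumes "\<phi> \<in> test_functions \<Omega>"
  shows "(LINT x|lborel. partial_deriv j \<phi> x) = 0"
proof -
  have "(\<lambda>n. LINT x|lborel. real (Suc n) * (1 - 1) * \<phi> x) \<longlonglongrightarrow> (LINT x|lborel. 1 * partial_deriv j \<phi> x)"
    by (rule difference_quotient_integral[OF assms, of "\<lambda>_. 1"]) (auto simp: locally_bounded_def)
  then show ?thesis by (simp add: LIMSEQ_const_iff)
qed

text \<open>The limit of the same quotients is computed twice: by
  \<open>difference_quotient_integral\<close>, and by dominated convergence with the Lipschitz
  constant as bound. Backward quotients of \<open>f\<close> occur, hence the sign.\<close>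

lemma lipschitz_integration_by_parts:
  assumes \<phi>: "\<phi> \<in> test_functions \<Omega>"
    and L: "\<And>x y. \<bar>f x - f y\<bar> \<le> L * norm (x - y)"
    and g [measurable]: "g \<in> borel_measurable borel"
    and d: "AE x in lborel. ((\<lambda>s. f (x + s *\<^sub>R axis j 1)) has_real_derivative g x) (at 0)"
  shows "(LINT x|lborel. f x * partial_deriv j \<phi> x) = - (LINT x|lborel. g x * \<phi> x)"
proof -
  define e :: "real^2" where "e = axis j 1"
  define t where "t n = inverse (real (Suc n))" for n
  have "L-lipschitz_on UNIV f"
    unfolding lipschitz_on_def using L order_trans[OF abs_ge_zero L[of "axis 1 1" 0]] by (auto simp: dist_norm)
  then have cont: "continuous_on UNIV f" by (rule lipschitz_on_continuous_on)
  then have f [measurable]: "f \<in> borel_measurable borel" by (rule borel_measurable_continuous_onI)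
  note [measurable] = test_function_borel[OF \<phi>]
  note lim1 = difference_quotient_integral[OF \<phi> f locally_bounded_continuous[OF cont], of j]
  have "(\<lambda>n. LINT x|lborel. real (Suc n) * (f (x - t n *\<^sub>R e) - f x) * \<phi> x) \<longlonglongrightarrow> (LINT x|lborel. - g x * \<phi> x)"
  proof (rule integral_dominated_convergence[where w = "\<lambda>x. L * \<bar>\<phi> x\<bar>"])
    have "integrable lborel (\<lambda>x. 1 * \<phi> x)"
      by (rule test_function_mult_integrable[OF \<phi>]) (auto simp: locally_bounded_def)
    then show "integrable lborel (\<lambda>x. L * \<bar>\<phi> x\<bar>)" by auto
    show "AE x in lborel. (\<lambda>n. real (Suc n) * (f (x - t n *\<^sub>R e) - f x) * \<phi> x) \<longlonglongrightarrow> - g x * \<phi> x"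
      using d
    proof eventually_elim
      case (elim x)
      have "((\<lambda>s. f (x + (-s) *\<^sub>R e)) has_real_derivative - g x) (at 0)"
        using DERIV_chain2[of "\<lambda>s. f (x + s *\<^sub>R e)" "g x" uminus 0 "-1" UNIV] elim
          DERIV_minus[OF DERIV_ident, of "0::real"] by (simp add: e_def)
      from diff_quotient_limit[OF this] show ?case by (intro tendsto_mult tendsto_const) (simp add: t_def)
    qed
    show "AE x in lborel. norm (real (Suc n) * (f (x - t n *\<^sub>R e) - f x) * \<phi> x) \<le> L * \<bar>\<phi> x\<bar>" for n
    proof (intro AE_I2)
      fix x
      have "\<bar>f (x - t n *\<^sub>R e) - f x\<bar> \<le> L * t n" using L[of "x - t n *\<^sub>R e" x] by (simp add: e_def t_def)
      then have "real (Suc n) * \<bar>f (x - t n *\<^sub>R e) - f x\<bar> \<le> real (Suc n) * (L * t n)" by (intro mult_left_mono) auto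
      also have "\<dots> = L" by (simp add: t_def)
      finally have "real (Suc n) * \<bar>f (x - t n *\<^sub>R e) - f x\<bar> * \<bar>\<phi> x\<bar> \<le> L * \<bar>\<phi> x\<bar>" by (intro mult_right_mono) auto
      then show "norm (real (Suc n) * (f (x - t n *\<^sub>R e) - f x) * \<phi> x) \<le> L * \<bar>\<phi> x\<bar>" by (simp add: abs_mult)
    qed
  qed auto
  with lim1 show ?thesis unfolding t_def e_def using LIMSEQ_unique by fastforce
qed

text \<open>The quotient for the step t lives where \<open>f\<close> differs from its translate, a
  set of measure at most t V, and is at most 2 R / t there; the powers of t cancel.\<close>

lemma integral_partial_deriv_bound:
  assumes \<phi>: "\<phi> \<in> test_functions \<Omega>" and \<phi>1: "\<And>x. \<bar>\<phi> x\<bar> \<le> 1"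
    and f [measurable]: "f \<in> borel_measurable borel" and R: "\<And>x. \<bar>f x\<bar> \<le> R"
    and V: "\<And>t. 0 < t \<Longrightarrow> emeasure lborel {x. f (x - t *\<^sub>R axis j 1) \<noteq> f x} \<le> ennreal (t * V)" and V0: "0 \<le> V"
  shows "\<bar>LINT x|lborel. f x * partial_deriv j \<phi> x\<bar> \<le> 2 * R * V"
proof -
  note [measurable] = test_function_borel[OF \<phi>]
  have lb: "locally_bounded f" unfolding locally_bounded_def using R by blast
  have R0: "0 \<le> R" using R[of 0] by linarith
  have "\<bar>LINT x|lborel. real (Suc n) * (f (x - inverse (real (Suc n)) *\<^sub>R axis j 1) - f x) * \<phi> x\<bar> \<le> 2 * R * V" for n
  proof -
    define t where "t = inverse (real (Suc n))"
    have t: "0 < t" "real (Suc n) * t = 1" by (simp_all add: t_def)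
    define S where "S = {x. f (x - t *\<^sub>R axis j 1) \<noteq> f x}"
    have S [measurable]: "S \<in> sets borel" unfolding S_def by measurable
    have eS: "emeasure lborel S \<le> ennreal (t * V)" unfolding S_def by (rule V[OF t(1)])
    then have fin: "emeasure lborel S < \<infinity>" using ennreal_less_top le_less_trans by (metis infinity_ennreal_def)
    have "ennreal (measure lborel S) \<le> ennreal (t * V)" using eS fin by (simp add: emeasure_eq_ennreal_measure less_top)
    then have mS: "measure lborel S \<le> t * V" using t V0 by simp
    let ?h = "\<lambda>x. real (Suc n) * (f (x - t *\<^sub>R axis j 1) - f x) * \<phi> x"
    have hb: "norm (?h x) \<le> real (Suc n) * (2 * R) * indicator S x" for x
    proof (cases "x \<in> S")
      case True
      have "\<bar>f (x - t *\<^sub>R axis j 1) - f x\<bar> \<le> 2 * R" using R[of x] R[of "x - t *\<^sub>R axis j 1"] by linarith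
      then have "real (Suc n) * \<bar>f (x - t *\<^sub>R axis j 1) - f x\<bar> * \<bar>\<phi> x\<bar> \<le> real (Suc n) * (2 * R) * 1"
        using \<phi>1[of x] R0 by (intro mult_mono) auto
      then show ?thesis using True by (simp add: abs_mult)
    qed (simp add: S_def)
    have iS: "integrable lborel (\<lambda>x. real (Suc n) * (2 * R) * indicator S x)" using fin by auto
    have "\<bar>LINT x|lborel. ?h x\<bar> \<le> (LINT x|lborel. norm (?h x))" using integral_norm_bound[of lborel ?h] by simp
    also have "\<dots> \<le> (LINT x|lborel. real (Suc n) * (2 * R) * indicator S x)"
    proof (rule integral_mono[OF _ iS hb])
      show "integrable lborel (\<lambda>x. norm (?h x))"
        by (rule Bochner_Integration.integrable_bound[OF iS])
          (use order.trans[OF hb abs_ge_self] in \<open>auto intro!: AE_I2 simp del: of_nat_Suc\<close>)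
    qed
    also have "\<dots> = real (Suc n) * (2 * R) * measure lborel S" by simp
    also have "\<dots> \<le> real (Suc n) * (2 * R) * (t * V)" using mS R0 by (intro mult_left_mono) auto
    also have "\<dots> = 2 * R * V * (real (Suc n) * t)" by simp
    finally show ?thesis unfolding t(2) by (simp add: t_def)
  qed
  then show ?thesis
    by (intro LIMSEQ_le_const2[OF tendsto_rabs[OF difference_quotient_integral[OF \<phi> f lb, of j]]]) auto
qed

section \<open>Translates of convex sets\<close>

lemma measure_diff_translate_le:
  fixes S :: "(real^2) set"
  assumes S: "compact S" "convex S" and t: "0 < t"
  shows "measure lebesgue (S - (+) (t *\<^sub>R axis j 1) ` S) \<le> t * (2 * diameter S)"
proof (cases "S = {}")
  case False
  then obtain z where z: "z \<in> S" by auto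
  define v :: "real^2" where "v = t *\<^sub>R axis j 1"
  define A where "A = S - (+) v ` S"
  define d where "d = diameter S"
  have d0: "0 \<le> d" unfolding d_def using S by (simp add: diameter_ge_0 compact_imp_bounded)
  have vS: "compact ((+) v ` S)" using S compact_translation by blast
  have mem: "x \<in> (+) v ` S \<longleftrightarrow> x - v \<in> S" for x by (force simp: image_iff)
  have Am: "A \<in> lmeasurable" unfolding A_def using S vS by (simp add: fmeasurable.Diff lmeasurable_compact)
  \<comment> \<open>By convexity the translates of \<open>A\<close> by multiples of \<open>v\<close> are disjoint, and \<open>m\<close> of them fit
    into a box of size \<open>2 d\<close> times \<open>2 d + m t\<close>.\<close>
  have disj0: "(+) (real i *\<^sub>R v) ` A \<inter> (+) (real k *\<^sub>R v) ` A = {}" if "i < k" for i k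
  proof (rule ccontr)
    assume "\<not> ?thesis"
    then obtain x y where xy: "x \<in> A" "y \<in> A" "real i *\<^sub>R v + x = real k *\<^sub>R v + y" by auto
    define s where "s = real k - real i"
    have s: "1 \<le> s" using that by (simp add: s_def)
    have x: "x = y + s *\<^sub>R v" using xy(3) by (simp add: s_def algebra_simps)
    \<comment> \<open>The point \<open>x - v\<close> lies on the segment from
      \<open>y = x - s *\<^sub>R v\<close> to \<open>x\<close>, hence in \<open>S\<close>, although
      \<open>x\<close> is not in the translate of \<open>S\<close> by \<open>v\<close>.\<close>
    have "(1 / s) *\<^sub>R y + (1 - 1 / s) *\<^sub>R x \<in> S" using S(2) xy s unfolding A_def
      by (intro convexD) (auto simp: field_simps)
    moreover have "(1 / s) *\<^sub>R y + (1 - 1 / s) *\<^sub>R x = x - v" using s by (simp add: x algebra_simps)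
    ultimately show False using xy(1) by (simp add: A_def mem)
  qed
  have disj: "pairwise (\<lambda>i k. disjnt ((+) (real i *\<^sub>R v) ` A) ((+) (real k *\<^sub>R v) ` A)) {..<m}" for m
    unfolding pairwise_def disjnt_def using disj0 by (metis inf_commute linorder_neqE_nat)
  have bound: "real m * measure lebesgue A \<le> 2 * d * (2 * d + real m * t)" for m
  proof -
    let ?F = "\<lambda>i. (+) (real i *\<^sub>R v) ` A"
    define a :: "real^2" where "a = z - (\<chi> i. d)"
    define b :: "real^2" where "b = z + (\<chi> i. d) + (real m * t) *\<^sub>R axis j 1"
    have ab: "a$i \<le> b$i" for i using d0 t by (simp add: a_def b_def axis_def add_nonneg_nonneg)
    have "real m * measure lebesgue A = (\<Sum>i<m. measure lebesgue (?F i))"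
      by (simp add: measure_translation)
    also have "\<dots> = measure lebesgue (\<Union>i<m. ?F i)"
      by (rule measure_UNION'[symmetric]) (use disj Am measurable_translation in auto)
    also have "\<dots> \<le> measure lebesgue (cbox a b)"
    proof (rule measure_mono_fmeasurable)
      show "(\<Union>i<m. ?F i) \<subseteq> cbox a b"
      proof safe
        fix i x assume i: "i < m" and x: "x \<in> A"
        have "\<bar>x$k - z$k\<bar> \<le> d" for k
        proof -
          have "\<bar>x$k - z$k\<bar> \<le> norm (x - z)" using component_le_norm_cart[of "x - z" k] by simp
          also have "\<dots> \<le> d" using diameter_bounded_bound[OF compact_imp_bounded[OF S(1)], of x z] x z
            by (simp add: A_def d_def dist_norm)
          finally show ?thesis .
        qed
        note xz = this
        have "0 \<le> real i * t" "real i * t \<le> real m * t" using i t by auto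
        then show "real i *\<^sub>R v + x \<in> cbox a b"
          using xz unfolding mem_box_cart by (auto simp: a_def b_def v_def axis_def abs_le_iff algebra_simps)
            (smt (verit) xz)+
      qed
      show "(\<Union>i<m. ?F i) \<in> sets lebesgue"
        using Am measurable_translation by (intro sets.finite_UN) (auto intro: fmeasurableD)
    qed simp
    also have "\<dots> = (\<Prod>i\<in>UNIV. b$i - a$i)"
      using content_cbox_cart[of a b] ab by (simp add: interval_ne_empty_cart)
    also have "\<dots> = 2 * d * (2 * d + real m * t)"
      using exhaust_2[of j] by (auto simp: UNIV_2 a_def b_def axis_def)
    finally show ?thesis .
  qed
  \<comment> \<open>Division of \<open>bound\<close> by \<open>m\<close> leaves
    \<open>2 * d * t\<close> plus a term of order 1 / m.\<close>
  have "measure lebesgue A \<le> 2 * d * t"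
  proof (rule LIMSEQ_le_const)
    have "(\<lambda>n. 4 * d * d * inverse (real (Suc n)) + 2 * d * t) \<longlonglongrightarrow> 4 * d * d * 0 + 2 * d * t"
      by (intro tendsto_intros LIMSEQ_inverse_real_of_nat)
    then show "(\<lambda>n. 4 * d * d * inverse (real (Suc n)) + 2 * d * t) \<longlonglongrightarrow> 2 * d * t" by simp
    have "measure lebesgue A \<le> 4 * d * d * inverse (real (Suc n)) + 2 * d * t" for n
      using bound[of "Suc n"] by (simp add: field_simps)
    then show "\<exists>N. \<forall>n\<ge>N. measure lebesgue A \<le> 4 * d * d * inverse (real (Suc n)) + 2 * d * t" by blast
  qed
  then show ?thesis by (simp add: A_def v_def d_def mult.commute)
qed simp

text \<open>\<open>S\<close> and its translate have equal measure, so the two halves of the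
  symmetric difference do as well, and the previous bound doubles.\<close>

lemma emeasure_translate_symdiff_le:
  fixes S :: "(real^2) set"
  assumes S: "compact S" "convex S" and t: "0 < t"
  shows "emeasure lborel {x. (x - t *\<^sub>R axis j 1 \<in> S) \<noteq> (x \<in> S)} \<le> ennreal (t * (4 * diameter S))"
proof -
  define v :: "real^2" where "v = t *\<^sub>R axis j 1"
  define T where "T = (+) v ` S"
  have T: "compact T" unfolding T_def using S compact_translation by blast
  have mem: "x \<in> T \<longleftrightarrow> x - v \<in> S" for x unfolding T_def by (force simp: image_iff)
  have fm: "S \<in> lmeasurable" "T \<in> lmeasurable" using S T by (auto simp: lmeasurable_compact)
  have ST: "measure lebesgue (S - T) \<le> t * (2 * diameter S)"
    unfolding T_def v_def by (rule measure_diff_translate_le[OF S t])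
  have "measure lebesgue (T - S) = measure lebesgue T - measure lebesgue (S \<inter> T)"
    using measurable_measure_Diff[of T lebesgue "S \<inter> T"] fm by (simp add: Diff_Int fmeasurableD)
  also have "\<dots> = measure lebesgue S - measure lebesgue (S \<inter> T)" unfolding T_def by (simp add: measure_translation)
  also have "\<dots> = measure lebesgue (S - T)"
    using measurable_measure_Diff[of S lebesgue "S \<inter> T"] fm by (simp add: Diff_Int fmeasurableD)
  finally have TS: "measure lebesgue (T - S) \<le> t * (2 * diameter S)" using ST by simp
  have eq: "{x. (x - t *\<^sub>R axis j 1 \<in> S) \<noteq> (x \<in> S)} = (S - T) \<union> (T - S)"
    using mem by (auto simp: v_def)
  have b: "S \<in> sets borel" "T \<in> sets borel" using S T by (auto intro: borel_compact)
  have "measure lebesgue ((S - T) \<union> (T - S)) \<le> t * (2 * diameter S) + t * (2 * diameter S)"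
    by (rule order.trans[OF measure_Un_le add_mono[OF ST TS]]) (use fm in auto)
  moreover have "emeasure lborel ((S - T) \<union> (T - S)) = ennreal (measure lebesgue ((S - T) \<union> (T - S)))"
  proof -
    have "(S - T) \<union> (T - S) \<in> lmeasurable" using fm by (intro fmeasurable.Un fmeasurable.Diff) auto
    then have "emeasure lebesgue ((S - T) \<union> (T - S)) = ennreal (measure lebesgue ((S - T) \<union> (T - S)))"
      by (intro emeasure_eq_ennreal_measure fmeasurableD2)
    then show ?thesis using b by simp
  qed
  ultimately show ?thesis unfolding eq by (simp add: ennreal_leI)
qed

section \<open>Uniqueness of weak gradients\<close>

definition exp_bump :: "nat \<Rightarrow> real \<Rightarrow> real" where
  "exp_bump k t = (if t \<le> 0 then 0 else exp (- 1 / t) / t ^ k)"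

lemma exp_bump_tendsto_0: "(exp_bump k \<longlongrightarrow> 0) (at 0)"
proof -
  have "((\<lambda>x. inverse x ^ k / exp (inverse x)) \<longlongrightarrow> (0::real)) (at_right 0)"
    by (rule filterlim_compose[OF tendsto_power_div_exp_0 filterlim_inverse_at_top_right])
  then have "(exp_bump k \<longlongrightarrow> 0) (at_right 0)"
    by (rule Lim_transform_eventually)
      (auto simp: eventually_at_filter exp_bump_def exp_minus field_simps intro!: eventuallyI)
  moreover have "(exp_bump k \<longlongrightarrow> 0) (at_left 0)"
    by (rule Lim_transform_eventually[OF tendsto_const])
      (auto simp: eventually_at_filter exp_bump_def intro!: eventuallyI)
  ultimately show ?thesis by (simp add: filterlim_split_at)
qed

text \<open>The index \<open>k\<close> makes the family closed under differentiation up to linear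
  combinations. At 0 the difference quotient is \<open>exp_bump (k + 1)\<close>, which tends to
  0.\<close>

lemma exp_bump_DERIV:
  "(exp_bump k has_real_derivative exp_bump (k + 2) t - real k * exp_bump (k + 1) t) (at t)"
proof -
  consider "t < 0" | "t = 0" | "t > 0" by linarith
  then show ?thesis
  proof cases
    case 1
    have "(exp_bump k has_real_derivative 0) (at t)"
      by (rule has_field_derivative_transform_within_open[OF DERIV_const[of 0] open_lessThan[of 0]])
        (use 1 in \<open>auto simp: exp_bump_def\<close>)
    then show ?thesis using 1 by (simp add: exp_bump_def)
  next
    case 2
    have "((\<lambda>h. (exp_bump k (0 + h) - exp_bump k 0) / h) \<longlongrightarrow> 0) (at 0)"
      by (rule Lim_transform_eventually[OF exp_bump_tendsto_0[of "k + 1"]])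
        (auto simp: exp_bump_def eventually_at_filter intro!: eventuallyI)
    then show ?thesis using 2 by (simp add: DERIV_def exp_bump_def)
  next
    case 3
    have "((\<lambda>t. exp (- 1 / t) / t ^ k) has_real_derivative
       (exp (- 1 / t) * (1 / (t * t)) * t ^ k - exp (- 1 / t) * (real k * t ^ (k - 1))) / (t ^ k * t ^ k)) (at t)"
      using 3 by (auto intro!: derivative_eq_intros)
    also have "(exp (- 1 / t) * (1 / (t * t)) * t ^ k - exp (- 1 / t) * (real k * t ^ (k - 1))) / (t ^ k * t ^ k)
      = exp_bump (k + 2) t - real k * exp_bump (k + 1) t"
      using 3 by (cases k) (simp_all add: exp_bump_def field_simps)
    finally show ?thesis
      by (rule has_field_derivative_transform_within_open[OF _ open_greaterThan[of 0]])
        (use 3 in \<open>auto simp: exp_bump_def\<close>)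
  qed
qed

text \<open>An algebra that contains its own partial derivatives, so smoothness of all orders takes
  one induction.\<close>

inductive bump_like :: "(real^2 \<Rightarrow> real) \<Rightarrow> bool" where
  const: "bump_like (\<lambda>_. c)"
| bump: "bump_like (\<lambda>x. exp_bump k (a * x $ i + b))"
| add: "bump_like f \<Longrightarrow> bump_like g \<Longrightarrow> bump_like (\<lambda>x. f x + g x)"
| mult: "bump_like f \<Longrightarrow> bump_like g \<Longrightarrow> bump_like (\<lambda>x. f x * g x)"

lemma bump_like_derivative:
  assumes "bump_like f"
  shows "\<exists>D. (\<forall>j. bump_like (D j)) \<and> (\<forall>x. (f has_derivative (\<lambda>h. \<Sum>j\<in>UNIV. D j x * h $ j)) (at x))"
  using assms
proof induction
  case (const c)
  show ?case by (rule exI[of _ "\<lambda>_ _. 0"]) (auto intro: bump_like.const)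
next
  case (bump k a i b)
  define D where "D = (\<lambda>j (x::real^2). (exp_bump (k + 2) (a * x $ i + b) + (- real k) * exp_bump (k + 1) (a * x $ i + b))
     * (if j = i then a else 0))"
  have "((\<lambda>x. exp_bump k (a * x $ i + b)) has_derivative (\<lambda>h. \<Sum>j\<in>UNIV. D j x * h $ j)) (at x)" for x
  proof -
    have "((\<lambda>x::real^2. a * x $ i + b) has_derivative (\<lambda>h. a * h $ i)) (at x)"
      by (auto intro!: derivative_eq_intros bounded_linear_imp_has_derivative)
    from has_derivative_compose[OF this exp_bump_DERIV[unfolded has_field_derivative_def, of k]]
    show ?thesis by (simp add: D_def if_distrib if_distribR cong: if_cong)
      (simp add: algebra_simps)
  qed
  moreover have "bump_like (D j)" for j unfolding D_def
    by (intro bump_like.intros)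
  ultimately show ?case by blast
next
  case (add f g)
  then obtain D E where D: "\<And>j. bump_like (D j)" "\<And>x. (f has_derivative (\<lambda>h. \<Sum>j\<in>UNIV. D j x * h $ j)) (at x)"
    and E: "\<And>j. bump_like (E j)" "\<And>x. (g has_derivative (\<lambda>h. \<Sum>j\<in>UNIV. E j x * h $ j)) (at x)" by blast
  show ?case
  proof (rule exI[of _ "\<lambda>j x. D j x + E j x"], intro conjI allI)
    show "((\<lambda>x. f x + g x) has_derivative (\<lambda>h. \<Sum>j\<in>UNIV. (D j x + E j x) * h $ j)) (at x)" for x
      using has_derivative_add[OF D(2) E(2), of x] by (simp add: distrib_right sum.distrib)
    show "bump_like (\<lambda>x. D j x + E j x)" for j by (intro bump_like.add D E)
  qed
next
  case (mult f g)
  then obtain D E where D: "\<And>j. bump_like (D j)" "\<And>x. (f has_derivative (\<lambda>h. \<Sum>j\<in>UNIV. D j x * h $ j)) (at x)"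
    and E: "\<And>j. bump_like (E j)" "\<And>x. (g has_derivative (\<lambda>h. \<Sum>j\<in>UNIV. E j x * h $ j)) (at x)" by blast
  show ?case
  proof (rule exI[of _ "\<lambda>j x. f x * E j x + D j x * g x"], intro conjI allI)
    show "((\<lambda>x. f x * g x) has_derivative (\<lambda>h. \<Sum>j\<in>UNIV. (f x * E j x + D j x * g x) * h $ j)) (at x)" for x
      using has_derivative_mult[OF D(2) E(2), of x]
      by (simp add: sum_2 algebra_simps)
    show "bump_like (\<lambda>x. f x * E j x + D j x * g x)" for j
      by (intro bump_like.add bump_like.mult D E mult.hyps)
  qed
qed

lemma bump_like_partial_deriv:
  assumes "bump_like f"
  shows "f differentiable (at x)" "bump_like (partial_deriv j f)"
proof -
  obtain D where D: "\<And>j. bump_like (D j)" "\<And>x. (f has_derivative (\<lambda>h. \<Sum>j\<in>UNIV. D j x * h $ j)) (at x)"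
    using bump_like_derivative[OF assms] by blast
  show "f differentiable (at x)" using D(2) differentiableI by blast
  have "partial_deriv j f = D j"
    unfolding partial_deriv_def frechet_derivative_at[OF D(2), symmetric]
    by (auto simp: axis_def if_distrib cong: if_cong)
  then show "bump_like (partial_deriv j f)" using D(1) by simp
qed

lemma bump_like_C_times: "bump_like f \<Longrightarrow> C_times n f"
proof (induction n arbitrary: f)
  case 0
  then show ?case using bump_like_partial_deriv(1)
    by (auto simp: continuous_on_eq_continuous_within intro: differentiable_imp_continuous_within)
next
  case (Suc n)
  then show ?case using bump_like_partial_deriv by auto
qed

text \<open>The arguments have the form \<open>a * x $ i + b\<close> to match the rule
  \<open>bump\<close> of \<open>bump_like\<close>. The factor \<open>Suc n\<close> makes the
  functions tend to the indicator of the open box.\<close>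

definition box_bump :: "nat \<Rightarrow> real^2 \<Rightarrow> real^2 \<Rightarrow> real^2 \<Rightarrow> real" where
  "box_bump n a b x =
     exp_bump 0 (real (Suc n) * x $ 1 + - real (Suc n) * a $ 1) * exp_bump 0 (- real (Suc n) * x $ 1 + real (Suc n) * b $ 1) *
    (exp_bump 0 (real (Suc n) * x $ 2 + - real (Suc n) * a $ 2) * exp_bump 0 (- real (Suc n) * x $ 2 + real (Suc n) * b $ 2))"

lemma exp_bump_0: "exp_bump 0 (real (Suc n) * t) = (if t \<le> 0 then 0 else exp (- 1 / (real (Suc n) * t)))"
  by (simp add: exp_bump_def mult_le_0_iff del: of_nat_Suc)

lemma box_bump_alt:
  "box_bump n a b x = exp_bump 0 (real (Suc n) * (x$1 - a$1)) * exp_bump 0 (real (Suc n) * (b$1 - x$1)) *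
     (exp_bump 0 (real (Suc n) * (x$2 - a$2)) * exp_bump 0 (real (Suc n) * (b$2 - x$2)))"
  by (simp add: box_bump_def right_diff_distrib algebra_simps del: of_nat_Suc)

lemma box_bump_outside: "x \<notin> box a b \<Longrightarrow> box_bump n a b x = 0"
  unfolding box_bump_alt exp_bump_0 by (auto simp: mem_box_cart forall_2 not_less)

lemma box_bump_le_1: "\<bar>box_bump n a b x\<bar> \<le> 1"
proof -
  have *: "0 \<le> exp_bump 0 t \<and> exp_bump 0 t \<le> 1" for t by (auto simp: exp_bump_def)
  show ?thesis unfolding box_bump_alt abs_mult using * by (intro mult_le_one) (auto simp: abs_of_nonneg)
qed

lemma box_bump_tendsto: "(\<lambda>n. box_bump n a b x) \<longlonglongrightarrow> indicator (box a b) x"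
proof (cases "x \<in> box a b")
  case True
  have *: "(\<lambda>n. exp_bump 0 (real (Suc n) * t)) \<longlonglongrightarrow> 1" if "0 < t" for t
  proof -
    have "(\<lambda>n. exp (- (1 / t) * inverse (real (Suc n)))) \<longlonglongrightarrow> exp (- (1 / t) * 0)"
      by (intro tendsto_intros LIMSEQ_inverse_real_of_nat)
    then show ?thesis using that unfolding exp_bump_0 by (simp add: divide_inverse mult.commute del: of_nat_Suc)
  qed
  have "(\<lambda>n. box_bump n a b x) \<longlonglongrightarrow> 1 * 1 * (1 * 1)" unfolding box_bump_alt
    using True by (intro tendsto_mult *) (auto simp: mem_box_cart)
  then show ?thesis using True by simp
qed (simp add: box_bump_outside)

lemma box_bump_test_function:
  assumes "cbox a b \<subseteq> \<Omega>"
  shows "box_bump n a b \<in> test_functions \<Omega>"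
proof -
  have "bump_like (box_bump n a b)" unfolding box_bump_def by (intro bump_like.intros)
  then have "C_times m (box_bump n a b)" for m by (rule bump_like_C_times)
  moreover have sub: "closure {x. box_bump n a b x \<noteq> 0} \<subseteq> cbox a b"
    using box_bump_outside[of _ a b n] box_subset_cbox[of a b] by (intro closure_minimal) blast+
  moreover have "compact (closure {x. box_bump n a b x \<noteq> 0})"
    using sub by (meson bounded_cbox bounded_subset compact_eq_bounded_closed closed_closure)
  ultimately show ?thesis using assms by (auto simp: test_functions_def)
qed

text \<open>Boxes form an intersection-stable generator of the Borel sets, and the sets with
  vanishing integral are closed under complements and disjoint unions. The integral over the whole
  plane is what the complements require.\<close>

lemma AE_zero_if_box_integrals_zero:
  fixes f :: "real^2 \<Rightarrow> real"
  assumes f: "integrable lborel f" and UN: "(LINT x|lborel. f x) = 0"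
    and z: "\<And>a b. (LINT x:box a b|lborel. f x) = 0"
  shows "AE x in lborel. f x = 0"
proof (rule sigma_finite_measure.density_zero[OF sigma_finite_lborel f])
  fix A :: "(real^2) set" assume "A \<in> sets lborel"
  then have A: "A \<in> sigma_sets UNIV (range (\<lambda>(a, b). box a b))" by (simp add: borel_eq_box)
  have "Int_stable (range (\<lambda>(a, b). box a b :: (real^2) set))" by (auto simp: Int_stable_def box_Int_box)
  moreover have "range (\<lambda>(a, b). box a b :: (real^2) set) \<subseteq> Pow UNIV" by auto
  ultimately show "(LINT x:A|lborel. f x) = 0" using A
  proof (induction rule: sigma_sets_induct_disjoint)
    case (basic A)
    then show ?case using z by auto
  next
    case (compl A)
    then have A: "A \<in> sets borel" by (simp add: borel_eq_box)
    have "(LINT x|lborel. f x) = (LINT x:A|lborel. f x) + (LINT x:UNIV - A|lborel. f x)"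
    proof -
      have "set_integrable lborel A f" "set_integrable lborel (UNIV - A) f"
        unfolding set_integrable_def using A f by (auto intro!: integrable_mult_indicator simp del: real_scaleR_def)
      then show ?thesis using set_integral_Un[of A "UNIV - A" lborel f] by (simp add: set_lebesgue_integral_def)
    qed
    then show ?case using compl UN by simp
  next
    case (union F)
    then have F: "F i \<in> sets lborel" for i by (auto simp: borel_eq_box subset_eq)
    have "(LINT x:(\<Union>i. F i)|lborel. f x) = (\<Sum>i. (LINT x:F i|lborel. f x))"
    proof (rule lebesgue_integral_countable_add[OF F])
      show "F i \<inter> F j = {}" if "i \<noteq> j" for i j using union(1) that by (auto simp: disjoint_family_on_def)
      show "set_integrable lborel (\<Union>i. F i) f"
        unfolding set_integrable_def using F f by (intro integrable_mult_indicator) auto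
    qed
    then show ?case using union by simp
  qed (simp add: set_lebesgue_integral_def)
qed

text \<open>Restricted to the box, \<open>h\<close> is integrable. Its integrals over smaller boxes
  are limits of integrals against \<open>box_bump\<close>, and any other box is first intersected
  with the given one. The Borel version \<open>H'\<close> is needed because the generator argument
  concerns Borel sets.\<close>

lemma fundamental_lemma_box:
  fixes h :: "real^2 \<Rightarrow> real"
  assumes h: "set_integrable lebesgue (cbox a0 b0) h" and sub: "cbox a0 b0 \<subseteq> \<Omega>" and \<Omega>: "\<Omega> \<in> sets borel"
    and z: "\<And>\<phi>. \<phi> \<in> test_functions \<Omega> \<Longrightarrow> (LINT x|lebesgue_on \<Omega>. h x * \<phi> x) = 0"
  shows "AE x in lebesgue. x \<in> box a0 b0 \<longrightarrow> h x = 0"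
proof -
  define H where "H x = indicator (box a0 b0) x * h x" for x
  have Hi: "integrable lebesgue H"
  proof -
    have "set_integrable lebesgue (box a0 b0) h"
      by (rule set_integrable_subset[OF h]) (auto simp: box_subset_cbox)
    then show ?thesis by (simp add: set_integrable_def H_def[abs_def])
  qed
  obtain H' where H' [measurable]: "H' \<in> borel_measurable lborel" and HH': "AE x in lborel. H x = H' x"
    using completion_ex_borel_measurable_real[OF borel_measurable_integrable[OF Hi]] by auto
  have HH'c: "AE x in lebesgue. H x = H' x" using HH' by (rule AE_completion)
  have H'i: "integrable lborel H'"
    using integrable_cong_AE_imp[OF Hi measurable_completion[OF H'] HH'c] integrable_completion[OF H'] by blast
  have int_box: "(LINT x|lborel. indicator (box a b) x * H' x) = 0" if "box a b \<subseteq> box a0 b0" for a b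
  proof (cases "box a b = {}")
    case False
    have "closure (box a b) \<subseteq> cbox a0 b0"
      by (intro closure_minimal order.trans[OF that box_subset_cbox] closed_cbox)
    then have c: "cbox a b \<subseteq> cbox a0 b0" using closure_box[OF False] by simp
    have tf: "box_bump n a b \<in> test_functions \<Omega>" for n
      by (rule box_bump_test_function) (use c sub in auto)
    have "(LINT x|lebesgue. H x * box_bump n a b x) = 0" for n
    proof -
      have "(LINT x|lebesgue. H x * box_bump n a b x) = (LINT x|lebesgue. indicator \<Omega> x *\<^sub>R (h x * box_bump n a b x))"
      proof (intro Bochner_Integration.integral_cong refl)
        fix x
        show "H x * box_bump n a b x = indicator \<Omega> x *\<^sub>R (h x * box_bump n a b x)"
        proof (cases "x \<in> box a b")
          case True
          then have "x \<in> box a0 b0" "x \<in> \<Omega>" using that sub box_subset_cbox[of a0 b0] by blast+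
          then show ?thesis by (simp add: H_def)
        qed (simp add: box_bump_outside)
      qed
      also have "\<dots> = (LINT x|lebesgue_on \<Omega>. h x * box_bump n a b x)"
        by (rule integral_restrict_space[symmetric]) (use \<Omega> in auto)
      finally show ?thesis using z[OF tf] by simp
    qed
    moreover have "(\<lambda>n. LINT x|lebesgue. H x * box_bump n a b x) \<longlonglongrightarrow> (LINT x|lebesgue. H x * indicator (box a b) x)"
    proof (rule integral_dominated_convergence[where w = "\<lambda>x. \<bar>H x\<bar>"])
      note [measurable] = borel_measurable_integrable[OF Hi]
      have [measurable]: "box a b \<in> sets lebesgue" by simp
      have bm: "box_bump n a b \<in> borel_measurable lebesgue" for n
        using test_function_borel[OF tf] by (intro measurable_completion) simp
      show "(\<lambda>x. H x * indicator (box a b) x) \<in> borel_measurable lebesgue" by measurable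
      show "(\<lambda>x. H x * box_bump n a b x) \<in> borel_measurable lebesgue" for n using bm by measurable
      show "AE x in lebesgue. norm (H x * box_bump n a b x) \<le> \<bar>H x\<bar>" for n
        using box_bump_le_1 by (intro AE_I2) (simp add: abs_mult mult_left_le)
      show "AE x in lebesgue. (\<lambda>n. H x * box_bump n a b x) \<longlonglongrightarrow> H x * indicator (box a b) x"
        by (intro AE_I2 tendsto_mult tendsto_const box_bump_tendsto)
    qed (use Hi in auto)
    ultimately have "(LINT x|lebesgue. H x * indicator (box a b) x) = 0" by (simp add: LIMSEQ_const_iff)
    also have "(LINT x|lebesgue. H x * indicator (box a b) x) = (LINT x|lebesgue. indicator (box a b) x * H' x)"
    proof (rule integral_cong_AE)
      note [measurable] = borel_measurable_integrable[OF Hi] measurable_completion[OF H']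
      have [measurable]: "box a b \<in> sets lebesgue" by simp
      show "(\<lambda>x. H x * indicator (box a b) x) \<in> borel_measurable lebesgue" by measurable
      show "(\<lambda>x. indicator (box a b) x * H' x) \<in> borel_measurable lebesgue" by measurable
      show "AE x in lebesgue. H x * indicator (box a b) x = indicator (box a b) x * H' x"
        using HH'c by eventually_elim auto
    qed
    also have "\<dots> = (LINT x|lborel. indicator (box a b) x * H' x)"
      by (rule integral_completion) measurable
    finally show ?thesis .
  qed simp
  have H'0: "AE x in lborel. indicator (box a0 b0) x * H' x = H' x"
    using HH' by eventually_elim (auto simp: H_def indicator_def split: if_splits)
  have cut: "(LINT x|lborel. indicator (box a b) x * H' x) = 0" for a b
  proof -
    obtain a' b' where ab: "box a b \<inter> box a0 b0 = box a' b'" using box_Int_box by blast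
    have "(LINT x|lborel. indicator (box a b) x * H' x) = (LINT x|lborel. indicator (box a' b') x * H' x)"
    proof (rule integral_cong_AE)
      show "AE x in lborel. indicator (box a b) x * H' x = indicator (box a' b') x * H' x"
        using H'0
      proof eventually_elim
        case (elim x)
        have "indicator (box a' b') x = (indicator (box a b) x * indicator (box a0 b0) x :: real)"
          unfolding ab[symmetric] by (rule indicator_inter_arith)
        then have "indicator (box a' b') x * H' x = indicator (box a b) x * (indicator (box a0 b0) x * H' x)" by simp
        then show ?case unfolding elim by (rule sym)
      qed
    qed measurable
    then show ?thesis using int_box[of a' b'] ab by auto
  qed
  have "AE x in lborel. H' x = 0"
  proof (rule AE_zero_if_box_integrals_zero[OF H'i])
    show "(LINT x:box a b|lborel. H' x) = 0" for a b using cut[of a b] by (simp add: set_lebesgue_integral_def)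
    have "(LINT x|lborel. H' x) = (LINT x|lborel. indicator (box a0 b0) x * H' x)"
    proof (rule integral_cong_AE)
      show "AE x in lborel. H' x = indicator (box a0 b0) x * H' x" using H'0 by eventually_elim simp
    qed measurable
    then show "(LINT x|lborel. H' x) = 0" using cut by simp
  qed
  then have "AE x in lebesgue. H' x = 0" by (rule AE_completion)
  with HH'c show ?thesis by eventually_elim (auto simp: H_def)
qed

text \<open>Boxes whose closures are compact in the square, so that local integrability gives
  integrability on them; for \<open>n = 0\<close> and \<open>n = 1\<close> they are empty.\<close>

abbreviation inner_box :: "nat \<Rightarrow> (real^2) set" where
  "inner_box n \<equiv> box (\<chi> i. inverse (real (Suc n))) (\<chi> i. 1 - inverse (real (Suc n)))"

lemma unit_square_exhaustion: "unit_square = (\<Union>n. inner_box n)"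
proof (intro set_eqI iffI)
  fix x assume "x \<in> unit_square"
  then have x: "0 < x$i" "x$i < 1" for i by (auto simp: unit_square_def mem_box_cart)
  define m where "m = min (min (x$1) (x$2)) (min (1 - x$1) (1 - x$2))"
  have "0 < m" using x by (simp add: m_def)
  then obtain n where "inverse (real (Suc n)) < m" using reals_Archimedean by blast
  then have "x \<in> inner_box n"
    unfolding mem_box_cart forall_2 m_def by (simp del: of_nat_Suc)
  then show "x \<in> (\<Union>n. inner_box n)" by blast
next
  fix x :: "real^2" assume "x \<in> (\<Union>n. inner_box n)"
  then obtain n where n: "\<And>i. inverse (real (Suc n)) < x$i" "\<And>i. x$i < 1 - inverse (real (Suc n))"
    by (auto simp: mem_box_cart simp del: of_nat_Suc)
  have "0 < inverse (real (Suc n))" by simp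
  then have "0 < x$i" "x$i < 1" for i using n[of i] by linarith+
  then show "x \<in> unit_square" by (auto simp: unit_square_def mem_box_cart)
qed

lemma locally_integrable_mult_test_function:
  assumes G: "locally_integrable \<Omega> G" and \<Omega>: "\<Omega> \<in> sets borel" and \<phi>: "\<phi> \<in> test_functions \<Omega>"
  shows "integrable (lebesgue_on \<Omega>) (\<lambda>x. (G x :: real^2^2) $ i $ j * \<phi> x)"
proof -
  define C where "C = closure {x. \<phi> x \<noteq> 0}"
  have C: "compact C" "C \<subseteq> \<Omega>" using \<phi> by (auto simp: C_def test_functions_def)
  have "G absolutely_integrable_on C" using G C by (auto simp: locally_integrable_def)
  then have "integrable lebesgue (\<lambda>x. indicator C x *\<^sub>R G x)" by (simp add: set_integrable_def)
  then have i: "integrable lebesgue (\<lambda>x. (indicator C x *\<^sub>R G x) $ i $ j)"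
    by (intro integrable_bounded_linear[OF bounded_linear_compose[OF bounded_linear_vec_nth bounded_linear_vec_nth]])
  obtain M where M: "0 \<le> M" "\<And>x. \<bar>\<phi> x\<bar> \<le> M" using test_function_bounded[OF \<phi>] by metis
  have [measurable]: "\<phi> \<in> borel_measurable lebesgue"
    using test_function_borel[OF \<phi>] by (intro measurable_completion) simp
  note [measurable] = borel_measurable_integrable[OF i]
  have "integrable lebesgue (\<lambda>x. (indicator C x *\<^sub>R G x) $ i $ j * \<phi> x)"
  proof (rule Bochner_Integration.integrable_bound[OF integrable_mult_right[OF i, of M]])
    show "(\<lambda>x. (indicator C x *\<^sub>R G x) $ i $ j * \<phi> x) \<in> borel_measurable lebesgue" by measurable
    show "AE x in lebesgue. norm ((indicator C x *\<^sub>R G x) $ i $ j * \<phi> x) \<le> norm (M * (indicator C x *\<^sub>R G x) $ i $ j)"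
    proof (intro AE_I2)
      fix x
      have "\<bar>(indicator C x *\<^sub>R G x) $ i $ j\<bar> * \<bar>\<phi> x\<bar> \<le> \<bar>(indicator C x *\<^sub>R G x) $ i $ j\<bar> * \<bar>M\<bar>"
        using M by (intro mult_left_mono) (auto intro: order.trans[OF M(2)])
      then show "norm ((indicator C x *\<^sub>R G x) $ i $ j * \<phi> x) \<le> norm (M * (indicator C x *\<^sub>R G x) $ i $ j)"
        by (simp only: real_norm_def abs_mult mult.commute)
    qed
  qed
  moreover have "(\<lambda>x. (indicator C x *\<^sub>R G x) $ i $ j * \<phi> x) = (\<lambda>x. indicator \<Omega> x *\<^sub>R (G x $ i $ j * \<phi> x))"
  proof
    fix x
    show "(indicator C x *\<^sub>R G x) $ i $ j * \<phi> x = indicator \<Omega> x *\<^sub>R (G x $ i $ j * \<phi> x)"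
    proof (cases "\<phi> x = 0")
      case False
      then have "x \<in> C" using closure_subset[of "{x. \<phi> x \<noteq> 0}"] by (auto simp: C_def)
      moreover from this have "x \<in> \<Omega>" using C by blast
      ultimately show ?thesis by simp
    qed simp
  qed
  ultimately show ?thesis using \<Omega> by (subst integrable_restrict_space) simp_all
qed

text \<open>\<open>weak_gradient\<close> is an arbitrary choice, so the energy can be evaluated on
  an explicit gradient only after all choices are known to agree almost everywhere.\<close>

lemma weak_gradient_unique:
  assumes G: "is_weak_gradient unit_square u G" and G': "is_weak_gradient unit_square u G'"
  shows "AE x in lebesgue_on unit_square. G x = G' x"
proof -
  let ?M = "lebesgue_on unit_square"
  have \<Omega>: "unit_square \<in> sets borel" by (simp add: unit_square_def)
  have li: "locally_integrable unit_square G" "locally_integrable unit_square G'"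
    using G G' by (simp_all add: is_weak_gradient_def)
  have "AE x in lebesgue. \<forall>n. x \<in> inner_box n \<longrightarrow> G x $ i $ j - G' x $ i $ j = 0"
    for i j
    unfolding AE_all_countable
  proof (intro allI fundamental_lemma_box[OF _ _ \<Omega>])
    fix n
    let ?C = "cbox (\<chi> i. inverse (real (Suc n))) (\<chi> i. 1 - inverse (real (Suc n))) :: (real^2) set"
    show sub: "?C \<subseteq> unit_square"
    proof
      fix x assume "x \<in> ?C"
      then have n: "inverse (real (Suc n)) \<le> x$i" "x$i \<le> 1 - inverse (real (Suc n))" for i
        by (simp_all add: mem_box_cart)
      have "0 < inverse (real (Suc n))" by simp
      then have "0 < x$i" "x$i < 1" for i using n[of i] by linarith+
      then show "x \<in> unit_square" by (simp add: unit_square_def mem_box_cart)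
    qed
    have "G absolutely_integrable_on ?C" "G' absolutely_integrable_on ?C"
      using li sub compact_cbox[of "\<chi> i. inverse (real (Suc n))" "\<chi> i. 1 - inverse (real (Suc n)) :: real^2"]
      unfolding locally_integrable_def by auto
    then have "(\<lambda>x. G x - G' x) absolutely_integrable_on ?C" by (rule set_integral_diff)
    then have "integrable lebesgue (\<lambda>x. indicator ?C x *\<^sub>R (G x - G' x))" by (simp add: set_integrable_def)
    then have "integrable lebesgue (\<lambda>x. (indicator ?C x *\<^sub>R (G x - G' x)) $ i $ j)"
      by (intro integrable_bounded_linear[OF bounded_linear_compose[OF bounded_linear_vec_nth bounded_linear_vec_nth]])
    then show "set_integrable lebesgue ?C (\<lambda>x. G x $ i $ j - G' x $ i $ j)" by (simp add: set_integrable_def)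
    fix \<phi> assume \<phi>: "\<phi> \<in> test_functions unit_square"
    have "(LINT x|?M. u x $ i * partial_deriv j \<phi> x) = - (LINT x|?M. G x $ i $ j * \<phi> x)"
      "(LINT x|?M. u x $ i * partial_deriv j \<phi> x) = - (LINT x|?M. G' x $ i $ j * \<phi> x)"
      using G G' \<phi> unfolding is_weak_gradient_def by blast+
    then have "(LINT x|?M. G x $ i $ j * \<phi> x) = (LINT x|?M. G' x $ i $ j * \<phi> x)"
      by linarith
    then show "(LINT x|?M. (G x $ i $ j - G' x $ i $ j) * \<phi> x) = 0"
      unfolding left_diff_distrib
      by (subst Bochner_Integration.integral_diff)
        (simp_all add: locally_integrable_mult_test_function[OF li(1) \<Omega> \<phi>] locally_integrable_mult_test_function[OF li(2) \<Omega> \<phi>])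
  qed
  then have "AE x in lebesgue. \<forall>i j n. x \<in> inner_box n \<longrightarrow> G x $ i $ j - G' x $ i $ j = 0"
    unfolding AE_all_countable by blast
  then have "AE x in lebesgue. x \<in> unit_square \<longrightarrow> G x = G' x"
  proof eventually_elim
    case (elim x)
    show ?case
    proof
      assume "x \<in> unit_square"
      then have "G x $ i $ j - G' x $ i $ j = 0" for i j using elim unfolding unit_square_exhaustion by blast
      then show "G x = G' x" by (simp add: vec_eq_iff)
    qed
  qed
  then show ?thesis using \<Omega> by (subst AE_restrict_space_iff) auto
qed

section \<open>Energy of piecewise affine maps\<close>

lemma norm_matrix_vector_mult_le: "norm (M *v x) \<le> norm M * norm x" for M :: "real^2^2"
proof -
  have "norm (M *v x) = L2_set (\<lambda>i. \<bar>M $ i \<bullet> x\<bar>) UNIV"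
    by (simp add: norm_vec_def matrix_vector_mult_def inner_vec_def)
  also have "\<dots> \<le> L2_set (\<lambda>i. norm (M $ i) * norm x) UNIV"
    by (intro L2_set_mono Cauchy_Schwarz_ineq2) auto
  also have "\<dots> = norm M * norm x" by (simp add: norm_vec_def[of M] L2_set_right_distrib mult.commute)
  finally show ?thesis .
qed

text \<open>Continuity across interfaces is automatic: \<open>u\<close> is a single function, affine
  on each of finitely many closed sets. Along a segment these sets cut out a finite closed cover of
  an interval, on which a common Lipschitz constant on the parts holds for the whole.\<close>

lemma lipschitz_closed_cover:
  fixes u :: "real^2 \<Rightarrow> real^2" and Q :: "((real^2) set \<times> (real^2^2) \<times> (real^2)) set"
  assumes Q: "finite Q" "(\<Union>(S, M, c)\<in>Q. S) = UNIV"
    and *: "\<And>S M c. (S, M, c) \<in> Q \<Longrightarrow> closed S \<and> norm M \<le> R \<and> (\<forall>x\<in>S. u x = M *v x + c)"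
    and R: "0 \<le> R"
  shows "norm (u y - u x) \<le> R * norm (y - x)"
proof -
  define f where "f t = u (x + t *\<^sub>R (y - x))" for t :: real
  have "(R * norm (y - x))-lipschitz_on {0..1} f"
  proof (rule lipschitz_on_closed_Union[where I = Q and U = "\<lambda>(S, M, c). {t. x + t *\<^sub>R (y - x) \<in> S}"])
    fix q assume q: "q \<in> Q"
    obtain S M c where qe: "q = (S, M, c)" by (cases q)
    note S = *[OF q[unfolded qe]]
    have "continuous_on UNIV (\<lambda>t::real. x + t *\<^sub>R (y - x))" by (intro continuous_intros)
    then have "closed ((\<lambda>t::real. x + t *\<^sub>R (y - x)) -` S)" using S continuous_closed_vimage
      by (metis continuous_on_eq_continuous_at open_UNIV UNIV_I)
    then show "closed (case q of (S, M, c) \<Rightarrow> {t. x + t *\<^sub>R (y - x) \<in> S})" by (simp add: qe vimage_def)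
    show "(R * norm (y - x))-lipschitz_on (case q of (S, M, c) \<Rightarrow> {t. x + t *\<^sub>R (y - x) \<in> S}) f"
      unfolding qe prod.case
    proof (rule lipschitz_onI)
      fix s t assume st: "s \<in> {t. x + t *\<^sub>R (y - x) \<in> S}" "t \<in> {t. x + t *\<^sub>R (y - x) \<in> S}"
      have "f s - f t = M *v ((s - t) *\<^sub>R (y - x))"
        using S st by (simp add: f_def algebra_simps)
      then have "dist (f s) (f t) \<le> norm M * norm ((s - t) *\<^sub>R (y - x))"
        using norm_matrix_vector_mult_le[of M "(s - t) *\<^sub>R (y - x)"] by (simp only: dist_norm)
      also have "\<dots> \<le> R * norm ((s - t) *\<^sub>R (y - x))" using S by (intro mult_right_mono) auto
      finally show "dist (f s) (f t) \<le> R * norm (y - x) * dist s t" by (simp add: dist_norm mult_ac)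
    qed (use R in auto)
  next
    show "{0..1} \<subseteq> (\<Union>q\<in>Q. case q of (S, M, c) \<Rightarrow> {t. x + t *\<^sub>R (y - x) \<in> S})"
    proof
      fix t :: real
      have "x + t *\<^sub>R (y - x) \<in> (\<Union>(S, M, c)\<in>Q. S)" using Q by simp
      then show "t \<in> (\<Union>q\<in>Q. case q of (S, M, c) \<Rightarrow> {t. x + t *\<^sub>R (y - x) \<in> S})" by auto
    qed
  qed (use Q R in auto)
  from lipschitz_onD[OF this, of 1 0] show ?thesis by (simp add: f_def dist_norm)
qed

text \<open>On overlaps the first piece in the list decides. The value depends only on which pieces
  contain the point, so it can jump only where membership in some piece changes.\<close>

primrec piece_gradient ::
  "real^2^2 \<Rightarrow> ((real^2) set \<times> (real^2^2) \<times> (real^2)) list \<Rightarrow> real^2 \<Rightarrow> real^2^2" where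
  "piece_gradient F [] x = F"
| "piece_gradient F (q # ps) x = (if x \<in> fst q then fst (snd q) else piece_gradient F ps x)"

lemma piece_gradient_cases:
  "(\<exists>S M c. (S, M, c) \<in> set ps \<and> x \<in> S \<and> piece_gradient F ps x = M) \<or>
   (x \<notin> piece_union ps \<and> piece_gradient F ps x = F)"
  by (induction ps) (auto; metis fst_conv snd_conv prod.collapse)+

lemma piece_gradient_eq:
  "(\<And>S M c. (S, M, c) \<in> set ps \<Longrightarrow> x \<in> S \<longleftrightarrow> y \<in> S) \<Longrightarrow> piece_gradient F ps x = piece_gradient F ps y"
proof (induction ps)
  case (Cons q ps)
  obtain S M c where "q = (S, M, c)" by (cases q)
  then show ?case using Cons by auto
qed simp

lemma piece_gradient_borel:
  assumes "\<And>S M c. (S, M, c) \<in> set ps \<Longrightarrow> closed S"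
  shows "piece_gradient F ps \<in> borel_measurable borel"
  using assms
proof (induction ps)
  case (Cons q ps)
  obtain S M c where q: "q = (S, M, c)" by (cases q)
  have [measurable]: "piece_gradient F ps \<in> borel_measurable borel" using Cons by auto
  have [measurable]: "S \<in> sets borel" using Cons.prems[of S M c] q by auto
  have "piece_gradient F (q # ps) = (\<lambda>x. if x \<in> S then M else piece_gradient F ps x)" by (auto simp: q)
  then show ?case by simp
next
  case Nil
  have "piece_gradient F [] = (\<lambda>_. F)" by auto
  then show ?case by simp
qed

lemma test_function_integral_on:
  assumes \<phi>: "\<phi> \<in> test_functions \<Omega>" and \<Omega>: "\<Omega> \<in> sets borel"
    and f [measurable]: "f \<in> borel_measurable borel" and lb: "locally_bounded f"
  shows "integrable (lebesgue_on \<Omega>) (\<lambda>x. f x * \<phi> x)"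
    "(LINT x|lebesgue_on \<Omega>. f x * \<phi> x) = (LINT x|lborel. f x * \<phi> x)"
proof -
  note [measurable] = test_function_borel[OF \<phi>]
  have eq: "(\<lambda>x. indicator \<Omega> x *\<^sub>R (f x * \<phi> x)) = (\<lambda>x. f x * \<phi> x)"
  proof
    fix x show "indicator \<Omega> x *\<^sub>R (f x * \<phi> x) = f x * \<phi> x"
      using test_function_zero[OF \<phi>, of x] by (cases "x \<in> \<Omega>") auto
  qed
  have i: "integrable lborel (\<lambda>x. f x * \<phi> x)" by (rule test_function_mult_integrable[OF \<phi> f lb])
  have m: "(\<lambda>x. f x * \<phi> x) \<in> borel_measurable lborel" by measurable
  show "integrable (lebesgue_on \<Omega>) (\<lambda>x. f x * \<phi> x)"
    using \<Omega> i by (subst integrable_restrict_space) (simp_all only: eq integrable_completion[OF m], auto)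
  show "(LINT x|lebesgue_on \<Omega>. f x * \<phi> x) = (LINT x|lborel. f x * \<phi> x)"
    using \<Omega> by (subst integral_restrict_space) (simp_all only: eq integral_completion[OF m], auto)
qed

lemma locally_integrable_bounded:
  fixes f :: "real^2 \<Rightarrow> 'b::euclidean_space"
  assumes [measurable]: "f \<in> borel_measurable borel" and b: "\<And>C. compact C \<Longrightarrow> bounded (f ` C)"
  shows "locally_integrable \<Omega> f"
  unfolding locally_integrable_def
proof (intro allI impI)
  fix C :: "(real^2) set" assume C: "compact C \<and> C \<subseteq> \<Omega>"
  obtain B where "\<And>x. x \<in> C \<Longrightarrow> norm (f x) \<le> B" using b[of C] C unfolding bounded_iff by auto
  moreover have "emeasure lborel C < \<infinity>" using C emeasure_bounded_finite compact_imp_bounded by blast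
  ultimately have "integrable lborel (\<lambda>x. indicator C x *\<^sub>R f x)"
    using C by (intro integrableI_bounded_set_indicator[where B = B])
      (auto simp: borel_compact)
  moreover have "(\<lambda>x. indicator C x *\<^sub>R f x) \<in> borel_measurable lborel"
    using C borel_compact by (intro borel_measurable_scaleR borel_measurable_indicator) auto
  ultimately show "f absolutely_integrable_on C"
    unfolding set_integrable_def by (simp add: integrable_completion)
qed

lemma cbox_unit_eq_para: "cbox 0 1 = para 0 1 1 0" "unit_square = opara 0 1 1 0"
  by (auto simp: para_def opara_def unit_square_def mem_box_cart forall_2)

lemma borel_measurable_sum_pieces:
  assumes "\<And>S M c. (S, M, c) \<in> set ps \<Longrightarrow> compact S"
  shows "(\<lambda>x::real^2. \<Sum>(S, M, c)\<leftarrow>ps. indicator S x * g M :: real) \<in> borel_measurable lebesgue"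
  using assms
proof (induction ps)
  case (Cons q ps)
  obtain S M c where q: "q = (S, M, c)" by (cases q)
  have "S \<in> sets lebesgue" using Cons.prems[of S M c] q lmeasurable_compact by (auto intro!: fmeasurableD)
  moreover have "(\<lambda>x. \<Sum>(S, M, c)\<leftarrow>ps. indicator S x * g M) \<in> borel_measurable lebesgue"
    by (rule Cons.IH) (use Cons.prems in auto)
  ultimately show ?case unfolding q by (simp add: borel_measurable_add borel_measurable_times)
qed simp

lemma nn_integral_pieces:
  fixes ps :: "((real^2) set \<times> 'a \<times> 'b) list"
  assumes "\<And>S M c. (S, M, c) \<in> set ps \<Longrightarrow> compact S" "\<And>M. 0 \<le> g M"
  shows "(\<integral>\<^sup>+ x. ennreal (\<Sum>(S, M, c)\<leftarrow>ps. indicator S x * g M) \<partial>lebesgue)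
     = ennreal (\<Sum>(S, M, c)\<leftarrow>ps. measure lebesgue S * g M)"
  using assms(1)
proof (induction ps)
  case (Cons q ps)
  obtain S M c where q: "q = (S, M, c)" by (cases q)
  have S: "compact S" "S \<in> lmeasurable" using Cons.prems q lmeasurable_compact by auto
  have nn: "0 \<le> (\<Sum>(S, M, c)\<leftarrow>ps. indicator S x * g M)" for x
    by (intro sum_list_nonneg) (auto simp: assms(2))
  have nn2: "0 \<le> (\<Sum>(S, M, c)\<leftarrow>ps. measure lebesgue S * g M)"
    by (intro sum_list_nonneg) (auto simp: assms(2))
  have meas: "(\<lambda>x. \<Sum>(S, M, c)\<leftarrow>ps. indicator S x * g M) \<in> borel_measurable lebesgue"
    by (rule borel_measurable_sum_pieces) (use Cons.prems in auto)
  have "(\<integral>\<^sup>+ x. ennreal (\<Sum>(S, M, c)\<leftarrow>q # ps. indicator S x * g M) \<partial>lebesgue)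
     = (\<integral>\<^sup>+ x. ennreal (g M) * indicator S x + ennreal (\<Sum>(S, M, c)\<leftarrow>ps. indicator S x * g M) \<partial>lebesgue)"
    using nn assms(2)[of M] by (intro nn_integral_cong) (auto simp: q indicator_def simp flip: ennreal_plus)
  also have "\<dots> = ennreal (g M) * emeasure lebesgue S + ennreal (\<Sum>(S, M, c)\<leftarrow>ps. measure lebesgue S * g M)"
    using S meas Cons by (subst nn_integral_add) (auto simp: nn_integral_cmult_indicator fmeasurableD)
  also have "emeasure lebesgue S = ennreal (measure lebesgue S)"
    using S(2) by (intro emeasure_eq_ennreal_measure fmeasurableD2)
  finally show ?case using assms(2)[of M] nn2
    by (simp add: q mult.commute flip: ennreal_mult ennreal_plus)
qed simp

text \<open>\<open>u\<close> is Lipschitz, and off the frontiers of the convex pieces, a null set,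
  \<open>piece_gradient\<close> is its classical derivative and hence its weak gradient. For the
  total variation one derivative is moved back onto \<open>u\<close>; the resulting gradient differs
  from its translate by t only on a set of measure at most 4 t times the sum of the
  diameters.\<close>

lemma pw_affine_energy:
  assumes pa: "pw_affine K p R \<epsilon> (cbox 0 1) u a E" and u: "\<And>x. x \<notin> unit_square \<Longrightarrow> u x = F *v x + b"
    and F: "norm F \<le> R" and \<epsilon>: "0 < \<epsilon>"
  shows "u \<in> W_1_infinity unit_square" "attains_affine_boundary F b u"
    "energy p K \<epsilon> u chi \<le> ennreal ((1 + 64 * R) * E)"
proof -
  let ?M = "lebesgue_on unit_square"
  obtain ps where ps: "affine_pieces R u ps"
    "cbox 0 1 = piece_union ps"
    "piece_energy K p \<epsilon> ps \<le> E"
    using pa unfolding pw_affine_def by blast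
  have piece: "compact S" "convex S" "norm M \<le> R" "\<And>x. x \<in> S \<Longrightarrow> u x = M *v x + c" if "(S, M, c) \<in> set ps" for S M c
    using ps(1) that by auto
  have R: "0 \<le> R" using F norm_ge_zero order_trans by blast
  have \<Omega>: "unit_square \<in> sets borel" by (simp add: unit_square_def)
  \<comment> \<open>Four closed half planes complete the pieces to a cover of the plane. They avoid
    the open square, so \<open>u\<close> is \<open>F *v x + b\<close> on them.\<close>
  define Q where "Q = set ps \<union> {({x. x$1 \<le> 0}, F, b), ({x. 1 \<le> x$1}, F, b), ({x. x$2 \<le> 0}, F, b), ({x. 1 \<le> x$2}, F, b)}"
  have lip: "norm (u y - u x) \<le> R * norm (y - x)" for x y
  proof (rule lipschitz_closed_cover[of Q])
    show "(\<Union>(S, M, c)\<in>Q. S) = UNIV"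
    proof (intro set_eqI iffI UNIV_I)
      fix x :: "real^2"
      show "x \<in> (\<Union>(S, M, c)\<in>Q. S)"
      proof (cases "x \<in> cbox 0 1")
        case True
        then show ?thesis using ps(2) unfolding Q_def by blast
      next
        case False
        then show ?thesis unfolding Q_def by (auto simp: mem_box_cart forall_2)
      qed
    qed
    have cl: "closed {x::real^2. x$i \<le> 0}" "closed {x::real^2. 1 \<le> x$i}" for i
      by (intro closed_Collect_le continuous_intros)+
    fix S M c assume "(S, M, c) \<in> Q"
    then consider "(S, M, c) \<in> set ps" | "M = F" "c = b" "S \<inter> unit_square = {}" "closed S"
      unfolding Q_def unit_square_def
      using cl by (auto simp: mem_box_cart forall_2 disjoint_iff)
    then show "closed S \<and> norm M \<le> R \<and> (\<forall>x\<in>S. u x = M *v x + c)"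
    proof cases
      case 1
      then show ?thesis using piece compact_imp_closed by blast
    next
      case 2
      then show ?thesis using F u by blast
    qed
  qed (auto simp: Q_def R)
  have lipc: "\<bar>u x $ i - u y $ i\<bar> \<le> R * norm (x - y)" for x y i
    using component_le_norm_cart[of "u x - u y" i] lip[of x y] by simp
  have "R-lipschitz_on UNIV u" using lip R by (auto simp: lipschitz_on_def dist_norm)
  then have cont: "continuous_on UNIV u" by (rule lipschitz_on_continuous_on)
  then have um [measurable]: "u \<in> borel_measurable borel" by (rule borel_measurable_continuous_onI)
  have conti: "continuous_on UNIV (\<lambda>x. u x $ i)" for i using cont by (intro continuous_intros)
  have umi: "(\<lambda>x. u x $ i) \<in> borel_measurable borel" for i by (rule borel_measurable_continuous_onI[OF conti])
  define G where "G = piece_gradient F ps"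
  have Gm [measurable]: "G \<in> borel_measurable borel" unfolding G_def
    by (rule piece_gradient_borel) (use piece compact_imp_closed in blast)
  have Gn: "norm (G x) \<le> R" for x using piece_gradient_cases[of ps x F] piece F unfolding G_def by fastforce
  have Gc: "\<bar>G x $ i $ j\<bar> \<le> R" for x i j using abs_mat_nth_le[of "G x" i j] Gn[of x] by linarith
  have Gmi [measurable]: "(\<lambda>x. G x $ i $ j) \<in> borel_measurable borel" for i j
    using borel_measurable_continuous_onI[of "\<lambda>M::real^2^2. M $ i $ j"] Gm
    by (rule measurable_compose_rev) (intro continuous_intros)
  have "negligible (\<Union>(S, M, c)\<in>set ps. frontier S)"
  proof (rule negligible_Union)
    fix T assume "T \<in> (\<lambda>(S, M, c). frontier S) ` set ps"
    then obtain S M c where "(S, M, c) \<in> set ps" "T = frontier S" by auto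
    then show "negligible T" using negligible_convex_frontier[OF piece(2)] by blast
  qed simp
  then have "AE x in lebesgue. x \<notin> (\<Union>(S, M, c)\<in>set ps. frontier S)"
    using AE_not_in negligible_iff_null_sets by blast
  then have "AE x in lborel. x \<notin> (\<Union>(S, M, c)\<in>set ps. frontier S)" by (simp only: AE_completion_iff)
  then have deriv: "AE x in lborel. \<forall>i j. ((\<lambda>s. u (x + s *\<^sub>R axis j 1) $ i) has_real_derivative G x $ i $ j) (at 0)"
  proof eventually_elim
    case (elim x)
    obtain S M c where S: "open S" "x \<in> S" "\<And>y. y \<in> S \<Longrightarrow> u y = M *v y + c" "G x = M"
      using piece_gradient_cases[of ps x F]
    proof (elim disjE exE conjE)
      fix S M c assume *: "(S, M, c) \<in> set ps" "x \<in> S" "piece_gradient F ps x = M"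
      have "x \<notin> frontier S" using elim * by auto
      then have "x \<in> interior S" using *(2) by (simp add: frontier_def closure_def)
      then show thesis using that[of "interior S" M c] piece[OF *(1)] * interior_subset[of S] by (auto simp: G_def)
    next
      assume *: "x \<notin> piece_union ps" "piece_gradient F ps x = F"
      show thesis
      proof (rule that[of "- cbox 0 1" F b])
        show "u y = F *v y + b" if "y \<in> - cbox 0 1" for y
          using that box_subset_cbox[of 0 "1::real^2"] by (intro u) (auto simp: unit_square_def)
        show "open (- cbox 0 (1::real^2))" by auto
        show "x \<in> - cbox 0 1" unfolding ps(2) Compl_iff by (rule *(1))
        show "G x = F" using *(2) by (simp add: G_def)
      qed
    qed
    show ?case
    proof (intro allI)
      fix i j
      define V where "V = (\<lambda>s. x + s *\<^sub>R axis j 1) -` S"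
      have "continuous_on UNIV (\<lambda>s. x + s *\<^sub>R axis j (1::real))" by (intro continuous_intros)
      then have V: "open V" "0 \<in> V" unfolding V_def using S(1,2) by (auto intro: open_vimage)
      have comp: "(M *v axis j 1) $ i = M $ i $ j" by (simp add: matrix_vector_mul_component inner_axis)
      have "((\<lambda>s. (M *v x + c) $ i + s * M $ i $ j) has_real_derivative M $ i $ j) (at 0)"
        by (auto intro!: derivative_eq_intros)
      then show "((\<lambda>s. u (x + s *\<^sub>R axis j 1) $ i) has_real_derivative G x $ i $ j) (at 0)"
        unfolding S(4)
        by (rule has_field_derivative_transform_within_open[OF _ V])
          (use S(3) comp in \<open>simp add: V_def matrix_vector_right_distrib matrix_vector_mult_scaleR\<close>)
    qed
  qed
  have ibp: "(LINT x|lborel. u x $ i * partial_deriv j \<phi> x) = - (LINT x|lborel. G x $ i $ j * \<phi> x)"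
    if \<phi>: "\<phi> \<in> test_functions unit_square" for \<phi> i j
    by (rule lipschitz_integration_by_parts[OF \<phi> lipc Gmi]) (use deriv in \<open>eventually_elim, blast\<close>)
  have lbu: "locally_bounded (\<lambda>x. u x $ i)" for i by (rule locally_bounded_continuous[OF conti])
  have lbG: "locally_bounded (\<lambda>x. G x $ i $ j)" for i j unfolding locally_bounded_def using Gc by blast
  have wg: "is_weak_gradient unit_square u G"
    unfolding is_weak_gradient_def
  proof (intro conjI ballI allI)
    show "locally_integrable unit_square u"
      by (rule locally_integrable_bounded)
        (auto intro!: compact_imp_bounded compact_continuous_image continuous_on_subset[OF cont])
    show "locally_integrable unit_square G"
      by (rule locally_integrable_bounded) (use Gn in \<open>auto simp: bounded_iff\<close>)
    fix \<phi> i j assume \<phi>: "\<phi> \<in> test_functions unit_square"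
    show "(LINT x|?M. u x $ i * partial_deriv j \<phi> x) =
        - (LINT x|?M. G x $ i $ j * \<phi> x)"
      unfolding test_function_integral_on(2)[OF \<phi> \<Omega> Gmi lbG]
        test_function_integral_on(2)[OF test_functions_partial_deriv[OF \<phi>] \<Omega> umi lbu]
      by (rule ibp[OF \<phi>])
  qed
  obtain B where ub: "\<And>x. x \<in> unit_square \<Longrightarrow> norm (u x) \<le> B"
  proof -
    have "bounded (u ` cbox 0 1)"
      by (intro compact_imp_bounded compact_continuous_image continuous_on_subset[OF cont]) auto
    then show thesis using that box_subset_cbox[of 0 "1::real^2"] unfolding bounded_iff unit_square_def by blast
  qed
  have rm: "f \<in> borel_measurable ?M" if "f \<in> borel_measurable borel" for f :: "real^2 \<Rightarrow> 'c::topological_space"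
    using that by (intro measurable_restrict_space1 measurable_completion) simp
  have "u \<in> L_infinity unit_square" unfolding L_infinity_def mem_Collect_eq
    using rm[OF um] AE_I2[of ?M "\<lambda>x. norm (u x) \<le> B"] ub by (auto simp: space_restrict_space)
  moreover have "G \<in> L_infinity unit_square" unfolding L_infinity_def mem_Collect_eq
    using rm[OF Gm] AE_I2[of ?M "\<lambda>x. norm (G x) \<le> R"] Gn by auto
  ultimately show "u \<in> W_1_infinity unit_square" unfolding W_1_infinity_def using wg by blast
  show "attains_affine_boundary F b u"
    unfolding attains_affine_boundary_def using continuous_on_subset[OF cont] u by auto
  define d where "d = (\<Sum>(S, M, c)\<leftarrow>ps. diameter S)"
  have diam0: "0 \<le> diameter S" if "(S, M, c) \<in> set ps" for S M c
    using piece(1)[OF that] by (simp add: diameter_ge_0 compact_imp_bounded)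
  have d0: "0 \<le> d" unfolding d_def by (intro sum_list_nonneg) (use diam0 in auto)
  have jump: "emeasure lborel {x. G (x - t *\<^sub>R axis k 1) \<noteq> G x} \<le> ennreal (t * (4 * d))" if t: "0 < t" for t k
  proof -
    let ?J = "\<lambda>qs. \<Union>q\<in>set qs. {x. (x - t *\<^sub>R axis k 1 \<in> fst q) \<noteq> (x \<in> fst q)}"
    have aux: "emeasure lborel (?J qs)
       \<le> ennreal (t * (4 * (\<Sum>q\<leftarrow>qs. diameter (fst q)))) \<and>
       ?J qs \<in> sets borel"
      if "set qs \<subseteq> set ps" for qs
      using that
    proof (induction qs)
      case (Cons q qs)
      obtain S M c where q: "q = (S, M, c)" by (cases q)
      then have S: "(S, M, c) \<in> set ps" using Cons.prems by auto
      define B where "B = {x. (x - t *\<^sub>R axis k 1 \<in> S) \<noteq> (x \<in> S)}"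
      define C where "C = ?J qs"
      have [measurable]: "S \<in> sets borel" using piece(1)[OF S] by (rule borel_compact)
      have Bm: "B \<in> sets borel" unfolding B_def by measurable
      have C: "emeasure lborel C \<le> ennreal (t * (4 * (\<Sum>q\<leftarrow>qs. diameter (fst q))))" "C \<in> sets borel"
      proof -
        have "set qs \<subseteq> set ps" using Cons.prems by auto
        from Cons.IH[OF this] show "emeasure lborel C \<le> ennreal (t * (4 * (\<Sum>q\<leftarrow>qs. diameter (fst q))))" "C \<in> sets borel"
          unfolding C_def by blast+
      qed
      have "emeasure lborel (B \<union> C) \<le> emeasure lborel B + emeasure lborel C"
        using Bm C(2) by (intro emeasure_subadditive) auto
      also have "\<dots> \<le> ennreal (t * (4 * diameter S)) + ennreal (t * (4 * (\<Sum>q\<leftarrow>qs. diameter (fst q))))"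
        unfolding B_def by (intro add_mono C(1) emeasure_translate_symdiff_le piece(1,2)[OF S] t)
      also have "\<dots> = ennreal (t * (4 * diameter S) + t * (4 * (\<Sum>q\<leftarrow>qs. diameter (fst q))))"
        using t diam0 S Cons.prems by (intro ennreal_plus[symmetric] mult_nonneg_nonneg sum_list_nonneg) auto
      finally show ?case using Bm C(2) by (simp add: q B_def C_def distrib_left)
    qed simp
    have "emeasure lborel {x. G (x - t *\<^sub>R axis k 1) \<noteq> G x}
      \<le> emeasure lborel (?J ps)"
    proof (rule emeasure_mono)
      show "{x. G (x - t *\<^sub>R axis k 1) \<noteq> G x} \<subseteq> ?J ps"
      proof (rule ccontr)
        assume "\<not> ?thesis"
        then obtain x where x: "G (x - t *\<^sub>R axis k 1) \<noteq> G x"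
          "\<And>q. q \<in> set ps \<Longrightarrow> (x - t *\<^sub>R axis k 1 \<in> fst q) = (x \<in> fst q)" by blast
        have "(x - t *\<^sub>R axis k 1 \<in> S) = (x \<in> S)" if "(S, M, c) \<in> set ps" for S M c
          using x(2)[OF that] by simp
        then have "piece_gradient F ps (x - t *\<^sub>R axis k 1) = piece_gradient F ps x" by (rule piece_gradient_eq)
        with x(1) show False unfolding G_def by simp
      qed
    qed (use aux[of ps] in auto)
    also have "\<dots> \<le> ennreal (t * (4 * d))" using aux[of ps] by (simp add: d_def case_prod_unfold)
    finally show ?thesis .
  qed
  have jumpi: "emeasure lborel {x. G (x - t *\<^sub>R axis k 1) $ i $ j \<noteq> G x $ i $ j} \<le> ennreal (t * (4 * d))" if t: "0 < t" for t i j k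
  proof (rule order.trans[OF emeasure_mono jump[OF t, of k]])
    show "{x. G (x - t *\<^sub>R axis k 1) $ i $ j \<noteq> G x $ i $ j} \<subseteq> {x. G (x - t *\<^sub>R axis k 1) \<noteq> G x}" by auto
    have "{x \<in> space lborel. G (x - t *\<^sub>R axis k 1) \<noteq> G x} \<in> sets lborel" by measurable
    then show "{x. G (x - t *\<^sub>R axis k 1) \<noteq> G x} \<in> sets lborel" by simp
  qed
  have tv1: "\<bar>LINT x|lborel. G x $ i $ j * partial_deriv k \<phi> x\<bar> \<le> 2 * R * (4 * d)"
    if "\<phi> \<in> test_functions unit_square" "\<And>x. \<bar>\<phi> x\<bar> \<le> 1" for \<phi> i j k
    by (rule integral_partial_deriv_bound[OF that Gmi Gc jumpi]) (use d0 in auto)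
  \<comment> \<open>Each of the eight components of the test field contributes at most
    \<open>2 * R * (4 * d)\<close>.\<close>
  have TV: "TV_D2 unit_square u \<le> ennreal (64 * R * d)"
    unfolding TV_D2_def
  proof (rule SUP_least, rule ennreal_leI)
    fix \<Phi> assume \<Phi>: "\<Phi> \<in> test_fields unit_square"
    have tf: "(\<lambda>x. \<Phi> x $ i $ j $ k) \<in> test_functions unit_square" for i j k using \<Phi> by (simp add: test_fields_def)
    have n1: "\<bar>\<Phi> x $ i $ j $ k\<bar> \<le> 1" for x i j k
    proof -
      have "\<bar>\<Phi> x $ i $ j $ k\<bar> \<le> norm (\<Phi> x $ i)" using abs_mat_nth_le .
      also have "\<dots> \<le> norm (\<Phi> x)" by (rule Finite_Cartesian_Product.norm_nth_le)
      also have "\<dots> \<le> 1" using \<Phi> by (simp add: test_fields_def)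
      finally show ?thesis .
    qed
    let ?f = "\<lambda>i j k x. u x $ i * partial_deriv j (partial_deriv k (\<lambda>y. \<Phi> y $ i $ j $ k)) x"
    note tf' = test_functions_partial_deriv[OF tf]
    have int: "integrable ?M (?f i j k)" for i j k
      by (rule test_function_integral_on(1)[OF test_functions_partial_deriv[OF tf'] \<Omega> umi lbu])
    have le: "(LINT x|?M. ?f i j k x) \<le> 8 * R * d" for i j k
    proof -
      have "(LINT x|?M. ?f i j k x) = - (LINT x|lborel. G x $ i $ j * partial_deriv k (\<lambda>y. \<Phi> y $ i $ j $ k) x)"
        unfolding test_function_integral_on(2)[OF test_functions_partial_deriv[OF tf'] \<Omega> umi lbu] by (rule ibp[OF tf'])
      then show ?thesis using tv1[OF tf n1, of i j k i j k] by linarith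
    qed
    have "(LINT x|?M. (\<Sum>i\<in>UNIV. \<Sum>j\<in>UNIV. \<Sum>k\<in>UNIV. ?f i j k x))
      = (\<Sum>i\<in>UNIV. \<Sum>j\<in>UNIV. \<Sum>k\<in>UNIV. LINT x|?M. ?f i j k x)"
      using int by (simp add: Bochner_Integration.integral_sum)
    also have "\<dots> \<le> (\<Sum>i\<in>(UNIV::2 set). \<Sum>j\<in>(UNIV::2 set). \<Sum>k\<in>(UNIV::2 set). 8 * R * d)"
      by (intro sum_mono le)
    also have "\<dots> = 64 * R * d" by simp
    finally show "(LINT x|?M. (\<Sum>i\<in>UNIV. \<Sum>j\<in>UNIV. \<Sum>k\<in>UNIV. ?f i j k x)) \<le> 64 * R * d" .
  qed
  define el where "el = (\<Sum>(S, M, c)\<leftarrow>ps. measure lebesgue S * infdist M K powr p)"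
  have el0: "0 \<le> el" unfolding el_def by (intro sum_list_nonneg) auto
  have elE: "el + \<epsilon> * d \<le> E"
    using ps(3) by (simp add: el_def d_def case_prod_unfold sum_list_addf sum_list_const_mult)
  have wgu: "is_weak_gradient unit_square u (weak_gradient unit_square u)"
    unfolding weak_gradient_def by (rule someI[of "is_weak_gradient unit_square u"]) (rule wg)
  have "(\<integral>\<^sup>+ x. ennreal (infdist (weak_gradient unit_square u x) K powr p) \<partial>?M)
     = (\<integral>\<^sup>+ x. ennreal (infdist (G x) K powr p) \<partial>?M)"
    by (rule nn_integral_cong_AE) (use weak_gradient_unique[OF wgu wg] in \<open>eventually_elim, simp\<close>)
  also have "\<dots> = (\<integral>\<^sup>+ x. ennreal (infdist (G x) K powr p) * indicator unit_square x \<partial>lebesgue)"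
    by (rule nn_integral_restrict_space) (use \<Omega> in auto)
  also have "\<dots> \<le> (\<integral>\<^sup>+ x. ennreal (\<Sum>(S, M, c)\<leftarrow>ps. indicator S x * infdist M K powr p) \<partial>lebesgue)"
  proof (rule nn_integral_mono)
    fix x :: "real^2"
    show "ennreal (infdist (G x) K powr p) * indicator unit_square x \<le> ennreal (\<Sum>(S, M, c)\<leftarrow>ps. indicator S x * infdist M K powr p)"
    proof (cases "x \<in> unit_square")
      case True
      then have "x \<in> cbox 0 1" using box_subset_cbox[of 0 "1::real^2"] by (auto simp: unit_square_def)
      then obtain S M c where *: "(S, M, c) \<in> set ps" "x \<in> S" "G x = M"
        using piece_gradient_cases[of ps x F] ps(2) unfolding G_def by auto
      have "indicator S x * infdist M K powr p \<le> (\<Sum>(S, M, c)\<leftarrow>ps. indicator S x * infdist M K powr p)"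
        by (rule member_le_sum_list) (use *(1) in \<open>force+\<close>)
      then show ?thesis using True * by (simp add: ennreal_leI)
    qed simp
  qed
  also have "\<dots> = ennreal el" unfolding el_def by (rule nn_integral_pieces) (use piece in auto)
  finally have "energy p K \<epsilon> u chi \<le> ennreal el + ennreal \<epsilon> * ennreal (64 * R * d)"
    unfolding energy_def using TV by (intro add_mono mult_left_mono) auto
  also have "\<dots> = ennreal (el + 64 * R * (\<epsilon> * d))"
    using el0 \<epsilon> R d0 by (simp add: ennreal_mult[symmetric] mult_ac flip: ennreal_plus)
  also have "\<dots> \<le> ennreal ((1 + 64 * R) * E)"
  proof (rule ennreal_leI)
    have "64 * R * (\<epsilon> * d) \<le> 64 * R * E" using elE el0 R by (intro mult_left_mono) auto
    moreover have "el \<le> E" using elE \<epsilon> d0 mult_nonneg_nonneg[of \<epsilon> d] by linarith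
    ultimately show "el + 64 * R * (\<epsilon> * d) \<le> (1 + 64 * R) * E" by (simp add: algebra_simps)
  qed
  finally show "energy p K \<epsilon> u chi \<le> ennreal ((1 + 64 * R) * E)" .
qed

text \<open>A constant field has no variation, because the integral of a derivative of a test
  function vanishes.\<close>

lemma const_in_BV_into:
  assumes "A \<in> K"
  shows "(\<lambda>_. A) \<in> BV_into unit_square K"
proof -
  let ?M = "lebesgue_on unit_square"
  have \<Omega>: "unit_square \<in> sets borel" by (simp add: unit_square_def)
  have fin: "emeasure lebesgue unit_square < \<infinity>" by (simp add: unit_square_def emeasure_lborel_box_eq)
  have "integrable ?M (\<lambda>_. A)"
  proof (subst integrable_restrict_space)
    show "integrable lebesgue (\<lambda>x. indicator unit_square x *\<^sub>R A)"
      by (intro integrable_scaleR_left integrable_real_indicator) (use \<Omega> fin in auto)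
  qed (use \<Omega> in auto)
  moreover have "TV_D unit_square (\<lambda>_. A) \<le> 0" unfolding TV_D_def
  proof (rule SUP_least)
    fix \<Phi> assume \<Phi>: "\<Phi> \<in> test_fields unit_square"
    have tf: "(\<lambda>x. \<Phi> x $ i $ j $ k) \<in> test_functions unit_square" for i j k using \<Phi> by (simp add: test_fields_def)
    note tf' = test_functions_partial_deriv[OF tf]
    let ?f = "\<lambda>i j k x. A $ i $ j * partial_deriv k (\<lambda>y. \<Phi> y $ i $ j $ k) x"
    have lb: "locally_bounded (\<lambda>_. c)" for c by (auto simp: locally_bounded_def)
    have cm: "(\<lambda>_. c) \<in> borel_measurable borel" for c :: real by simp
    have int: "integrable ?M (?f i j k)" for i j k
      by (rule test_function_integral_on(1)[OF tf' \<Omega> cm lb])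
    have z: "(LINT x|?M. ?f i j k x) = 0" for i j k
      unfolding test_function_integral_on(2)[OF tf' \<Omega> cm lb] by (simp add: integral_partial_deriv_zero[OF tf])
    have "(LINT x|?M. (\<Sum>i\<in>UNIV. \<Sum>j\<in>UNIV. \<Sum>k\<in>UNIV. ?f i j k x))
      = (\<Sum>i\<in>UNIV. \<Sum>j\<in>UNIV. \<Sum>k\<in>UNIV. LINT x|?M. ?f i j k x)"
      using int by (simp add: Bochner_Integration.integral_sum del: integral_mult_right_zero)
    then show "ennreal (- (LINT x|?M. (\<Sum>i\<in>UNIV. \<Sum>j\<in>UNIV. \<Sum>k\<in>UNIV. ?f i j k x))) \<le> 0"
      unfolding z by simp
  qed
  ultimately show ?thesis using assms by (auto simp: BV_into_def le_less_trans[of _ 0])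
qed

section \<open>From fillings to the theorem\<close>

lemma laminate_energy:
  assumes lam: "laminate K p m F" and A: "A \<in> K"
  shows "\<exists>C>0. \<forall>\<epsilon>. 0 < \<epsilon> \<and> \<epsilon> < 1 \<longrightarrow>
           (\<exists>u\<in>W_1_infinity unit_square. \<exists>chi\<in>BV_into unit_square K.
              attains_affine_boundary F b u \<and>
              energy p K \<epsilon> u chi \<le> ennreal (C * \<epsilon> powr (p / (real m + p))))"
proof -
  obtain R C where RC: "0 \<le> C" "norm F \<le> R" "\<And>\<epsilon>. 0 < \<epsilon> \<Longrightarrow> \<epsilon> < 1 \<Longrightarrow>
     fillable_square K p R \<epsilon> F C (C * \<epsilon> powr (p / (real m + p)))"
    using lam unfolding laminate_def by blast
  have R: "0 \<le> R" using RC(2) norm_ge_zero order_trans by blast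
  \<comment> \<open>The added 1 makes the constant positive even if \<open>C\<close> is 0.\<close>
  define C' where "C' = (1 + 64 * R) * C + 1"
  have "0 \<le> (1 + 64 * R) * C" using R RC by simp
  then have C': "0 < C'" "(1 + 64 * R) * C \<le> C'" by (auto simp: C'_def)
  show ?thesis
  proof (rule exI[of _ C'], intro conjI C' allI impI)
    fix \<epsilon> :: real assume \<epsilon>: "0 < \<epsilon> \<and> \<epsilon> < 1"
    obtain v where v: "pw_affine K p R \<epsilon> (para 0 1 1 0) v C (C * \<epsilon> powr (p / (real m + p)))"
      "\<And>x. x \<in> para 0 1 1 0 - opara 0 1 1 0 \<Longrightarrow> v x = F *v x" using RC(3)[of \<epsilon>] \<epsilon> unfolding fillable_def by blast
    define u where "u x = (if x \<in> cbox 0 1 then v x else F *v x) + b" for x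
    \<comment> \<open>The identity change of variables only adds \<open>b\<close> to the
      offsets.\<close>
    have "pw_affine K p R \<epsilon> ((\<lambda>y. y) ` para 0 1 1 0) u (1 * C) (1 * (1 * (C * \<epsilon> powr (p / (real m + p))) + 0 * C))"
      by (rule pw_affine_map[OF v(1), where N = "mat 1" and \<nu> = 1 and \<Psi> = "\<lambda>M. M" and \<gamma> = "\<lambda>M c. c + b"])
        (use \<epsilon> in \<open>auto simp: u_def cbox_unit_eq_para add.assoc\<close>)
    then have pa: "pw_affine K p R \<epsilon> (cbox 0 1) u C (C * \<epsilon> powr (p / (real m + p)))"
      by (simp add: cbox_unit_eq_para)
    have bd: "u x = F *v x + b" if "x \<notin> unit_square" for x
      using that v(2) unfolding u_def cbox_unit_eq_para by auto
    note en = pw_affine_energy[OF pa bd RC(2)]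
    have "energy p K \<epsilon> u (\<lambda>_. A) \<le> ennreal ((1 + 64 * R) * (C * \<epsilon> powr (p / (real m + p))))"
      using en(3) \<epsilon> by blast
    also have "\<dots> \<le> ennreal (C' * \<epsilon> powr (p / (real m + p)))"
      using mult_right_mono[OF C'(2), of "\<epsilon> powr (p / (real m + p))"] by (intro ennreal_leI) (simp add: mult.assoc)
    finally show "\<exists>u\<in>W_1_infinity unit_square. \<exists>chi\<in>BV_into unit_square K.
              attains_affine_boundary F b u \<and> energy p K \<epsilon> u chi \<le> ennreal (C' * \<epsilon> powr (p / (real m + p)))"
      using en(1,2) \<epsilon> const_in_BV_into[OF A] by blast
  qed
qed

theorem corollaryA2:
  fixes k :: nat
    and A J :: "nat \<Rightarrow> real^2^2"
    and l :: "nat \<Rightarrow> real" and l0 :: real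
    and K :: "(real^2^2) set" and F :: "real^2^2"
    and p :: real and b :: "real^2"
  assumes k: "k \<ge> 1"
    and K: "K = A ` {1..k+1}"
    and A_diag: "\<And>j. j \<in> {1..k+1} \<Longrightarrow> A j \<in> diag2"
    and J_diag: "\<And>j. j \<in> {3..k+1} \<Longrightarrow> J j \<in> diag2"
    and rank_12: "rank (A 1 - A 2) = 1"
    and rank_A: "\<And>j j'. j \<in> {2..k+1} \<Longrightarrow> j' \<in> {2..k+1} \<Longrightarrow> j \<noteq> j' \<Longrightarrow> rank (A j - A j') = 2"
    and rank_AJ: "\<And>j. j \<in> {3..k+1} \<Longrightarrow> rank (A j - J j) = 1"
    and l: "\<And>j. j \<in> {3..k+1} \<Longrightarrow> 0 < l j \<and> l j < 1"
    and J_3: "k \<ge> 2 \<Longrightarrow> J 3 = l 3 *\<^sub>R A 1 + (1 - l 3) *\<^sub>R A 2"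
    and J_step: "\<And>j. j \<in> {4..k+1} \<Longrightarrow> J j = l j *\<^sub>R A (j-1) + (1 - l j) *\<^sub>R J (j-1)"
    and l0: "0 < l0" "l0 < 1"
    and F: "F = (if k = 1 then l0 *\<^sub>R A 1 + (1 - l0) *\<^sub>R A 2
                 else l0 *\<^sub>R A (k+1) + (1 - l0) *\<^sub>R J (k+1))"
    and p: "p \<ge> 1"
  shows "\<exists>C>0. \<forall>\<epsilon>. 0 < \<epsilon> \<and> \<epsilon> < 1 \<longrightarrow>
           (\<exists>u\<in>W_1_infinity unit_square. \<exists>chi\<in>BV_into unit_square K.
              attains_affine_boundary F b u \<and>
              energy p K \<epsilon> u chi \<le> ennreal (C * \<epsilon> powr (p / (real k + p))))"
proof -
  have A_K: "A j \<in> K" if "j \<in> {1..k+1}" for j unfolding K using that by (rule imageI)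
  interpret wells K p
  proof
    show "finite K" "K \<noteq> {}" using K by auto
    show "K \<subseteq> diag2" unfolding K using A_diag by (intro image_subsetI)
  qed (rule p)
  have first: "laminate K p (Suc 0) (t *\<^sub>R A 1 + (1 - t) *\<^sub>R A 2)" if "0 < t" "t < 1" for t
    by (rule laminate_Suc[OF A_K[of 1] A_diag[of 2] rank_12 that laminate_0[OF A_K[of 2]]]) (use k in auto)
  \<comment> \<open>Index shift: \<open>J 3\<close> has order 1, so \<open>J (k + 1)\<close> has
    order k - 1, and \<open>F\<close>, one lamination further, has order k.\<close>
  have chain: "laminate K p (Suc n) (J (n + 3))" if "n + 3 \<le> k + 1" for n
    using that
  proof (induction n)
    case 0
    then have "k \<ge> 2" "3 \<in> {3..k+1}" by auto
    then show ?case using first[of "l 3"] l[of 3] J_3 by simp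
  next
    case (Suc n)
    have j: "n + 3 \<in> {1..k+1}" "n + 3 \<in> {3..k+1}" "n + 4 \<in> {4..k+1}" "n + 4 \<in> {3..k+1}"
      using Suc.prems by auto
    have IH: "laminate K p (Suc n) (J (n + 3))" using Suc by simp
    have la: "0 < l (n + 4)" "l (n + 4) < 1" using l[OF j(4)] by auto
    have eq: "n + 4 - 1 = n + 3" "Suc n + 3 = n + 4" by simp_all
    show ?case unfolding eq J_step[OF j(3)]
      by (rule laminate_Suc[OF A_K[OF j(1)] J_diag[OF j(2)] rank_AJ[OF j(2)] la IH])
  qed
  have "laminate K p k F"
  proof (cases "k = 1")
    case True
    then show ?thesis using first[OF l0] by (simp add: F)
  next
    case False
    define n where "n = k - 2"
    have n: "n + 3 = k + 1" "Suc (Suc n) = k" using k False by (simp_all add: n_def)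
    have j: "k + 1 \<in> {1..k+1}" "k + 1 \<in> {3..k+1}" using n by auto
    have "laminate K p (Suc n) (J (k + 1))" using chain[of n] unfolding n(1) by simp
    from laminate_Suc[OF A_K[OF j(1)] J_diag[OF j(2)] rank_AJ[OF j(2)] l0 this]
    show ?thesis unfolding n(2) F using False by simp
  qed
  then show ?thesis by (rule laminate_energy[OF _ A_K[of 1]]) simp
qed

end
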